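(* Let $d,k\in\mathbb{Z}_+$, let $\mu\in\mathbb{R}^d$ be an unknown $k$-sparse vector (at most $k$ nonzero coordinates), let $D=\mathcal{N}(\mu,I)$, and let $\epsilon,\tau>0$. Let $S$ be an $\epsilon$-corrupted set of samples from $D$ of size $N=\widetilde{\Omega}(k^2\log(d/\tau)/\epsilon^2)$ (i.e., $N$ at least $k^2\log(d/\tau)/\epsilon^2$ times a sufficiently large polylogarithmic factor). Then there is an efficient (polynomial-time) algorithm that, on input $S$, $k$, $\epsilon$ and $\tau$, returns a vector $\widehat{\mu}\in\mathbb{R}^d$ such that with probability at least $1-\tau$ it holds that $\|\widehat{\mu}-\mu\|_2=O(\epsilon\sqrt{\log(1/\epsilon)})$.
   Context: $\epsilon$-corruption model: for $0<\epsilon<1/2$, the algorithm specifies a number of samples $N$; $N$ i.i.d. samples $X_1,\dots,X_N$ are drawn from the unknown distribution $D$; an adversary inspects them, removes $\epsilon N$ of them and replaces them by arbitrary points; the resulting $N$ points are given to the algorithm. Such a set is called $\epsilon$-corrupted. $O(\cdot)$ hides absolute constants, $\widetilde{\Omega}(\cdot)$ hides logarithmic factors.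
   Formalization: The bound O(ε√log(1/ε)) is claimed only for ε below some absolute constant ε₀ ≤ 1/2, since no absolute constant works for all ε < 1/2 (the best possible error tends to infinity as ε → 1/2); polynomial time is still claimed for all ε < 1/2, counted in exact real-arithmetic steps. *)

theory Defs
  imports "HOL-Probability.Probability" "HOL-Library.Multiset"
begin

section \<open>A uniform real-arithmetic machine model\<close>

text \<open>
  Since the data are real vectors, running time is measured on a real RAM in the style of
  Blum, Shub and Smale: exact field operations and order tests on reals have unit cost.
  One fixed program handles all dimensions and sample sizes.  There are two memories, one for
  natural numbers (indices and counters) and one for reals, both with indirect addressing.
  A program contains no real constants other than those built from natural numbers, and there
  is no rounding, integer division, root or transcendental operation, so unit cost does not
  hide bit-level computation beyond what that model already allows.
\<close>

type_synonym state = "(nat \<Rightarrow> nat) \<times> (nat \<Rightarrow> real)"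

datatype nexp =
    NConst nat
  | NMem nexp
  | NAdd nexp nexp
  | NSub nexp nexp
  | NMul nexp nexp

datatype rexp =
    RMem nexp
  | ROfNat nexp
  | RAdd rexp rexp
  | RSub rexp rexp
  | RMul rexp rexp
  | RDiv rexp rexp

datatype test =
    NLess nexp nexp
  | RLess rexp rexp

primrec nval :: "nexp \<Rightarrow> state \<Rightarrow> nat" where
  "nval (NConst n) s = n"
| "nval (NMem e) s = fst s (nval e s)"
| "nval (NAdd e f) s = nval e s + nval f s"
| "nval (NSub e f) s = nval e s - nval f s"
| "nval (NMul e f) s = nval e s * nval f s"

primrec rval :: "rexp \<Rightarrow> state \<Rightarrow> real" where
  "rval (RMem e) s = snd s (nval e s)"
| "rval (ROfNat e) s = real (nval e s)"
| "rval (RAdd e f) s = rval e s + rval f s"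
| "rval (RSub e f) s = rval e s - rval f s"
| "rval (RMul e f) s = rval e s * rval f s"
| "rval (RDiv e f) s = rval e s / rval f s"

primrec holds :: "test \<Rightarrow> state \<Rightarrow> bool" where
  "holds (NLess e f) s \<longleftrightarrow> nval e s < nval f s"
| "holds (RLess e f) s \<longleftrightarrow> rval e s < rval f s"

datatype com =
    Skip
  | NAssign nexp nexp
  | RAssign nexp rexp
  | Seq com com
  | Cond test com com
  | Loop test com

text \<open>
  In \<open>exec c s t s'\<close>, the number \<open>t\<close> counts executed assignments, skips and tests.  The expressions
  occurring in a fixed program have bounded size, so \<open>t\<close> is the number of elementary operations up
  to a factor depending only on the program.  The first expression of an assignment is the address
  of the target cell.
\<close>

inductive exec :: "com \<Rightarrow> state \<Rightarrow> nat \<Rightarrow> state \<Rightarrow> bool" where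
  Skip: "exec Skip s 1 s"
| NAssign: "exec (NAssign a e) s 1 ((fst s)(nval a s := nval e s), snd s)"
| RAssign: "exec (RAssign a e) s 1 (fst s, (snd s)(nval a s := rval e s))"
| Seq: "exec c1 s t1 s1 \<Longrightarrow> exec c2 s1 t2 s2 \<Longrightarrow> exec (Seq c1 c2) s (t1 + t2) s2"
| CondTrue: "holds b s \<Longrightarrow> exec c1 s t s' \<Longrightarrow> exec (Cond b c1 c2) s (1 + t) s'"
| CondFalse: "\<not> holds b s \<Longrightarrow> exec c2 s t s' \<Longrightarrow> exec (Cond b c1 c2) s (1 + t) s'"
| LoopFalse: "\<not> holds b s \<Longrightarrow> exec (Loop b c) s 1 s"
| LoopTrue: "holds b s \<Longrightarrow> exec c s t1 s1 \<Longrightarrow> exec (Loop b c) s1 t2 s2 \<Longrightarrow>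
    exec (Loop b c) s (1 + t1 + t2) s2"

inductive_cases SkipE: "exec Skip s t s'"
inductive_cases NAssignE: "exec (NAssign a e) s t s'"
inductive_cases RAssignE: "exec (RAssign a e) s t s'"
inductive_cases SeqE: "exec (Seq c1 c2) s t s'"

lemma exec_deterministic:
  "exec c s t s' \<Longrightarrow> exec c s u s'' \<Longrightarrow> t = u \<and> s' = s''"
proof (induction arbitrary: u s'' rule: exec.induct)
  case (Skip s)
  then show ?case by (auto elim: SkipE)
next
  case (NAssign a e s)
  then show ?case by (auto elim: NAssignE)
next
  case (RAssign a e s)
  then show ?case by (auto elim: RAssignE)
next
  case (Seq c1 s t1 s1 c2 t2 s2)
  from Seq.prems obtain u1 u2 r where
    u: "u = u1 + u2" "exec c1 s u1 r" "exec c2 r u2 s''" by (rule SeqE)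
  from Seq.IH(1)[OF u(2)] have "t1 = u1" "s1 = r" by simp_all
  with Seq.IH(2) u show ?case by simp
next
  case (CondTrue b s c1 t s' c2)
  from CondTrue.prems CondTrue.hyps(1) obtain v where "u = 1 + v" "exec c1 s v s''"
    by cases simp_all
  with CondTrue.IH show ?case by simp
next
  case (CondFalse b s c2 t s' c1)
  from CondFalse.prems CondFalse.hyps(1) obtain v where "u = 1 + v" "exec c2 s v s''"
    by cases simp_all
  with CondFalse.IH show ?case by simp
next
  case (LoopFalse b s c)
  from LoopFalse.prems LoopFalse.hyps(1) show ?case by cases simp_all
next
  case (LoopTrue b s c t1 s1 t2 s2)
  from LoopTrue.prems LoopTrue.hyps(1) obtain u1 u2 r where
    u: "u = 1 + u1 + u2" "exec c s u1 r" "exec (Loop b c) r u2 s''"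
    by cases simp_all
  from LoopTrue.IH(1)[OF u(2)] have "t1 = u1" "s1 = r" by simp_all
  with LoopTrue.IH(2) u show ?case by simp
qed


section \<open>Vectors, Gaussian samples and corruption\<close>

text \<open>
  The dimension is quantified jointly with the data, so vectors of dimension \<open>d\<close> are functions on
  \<open>{..<d}\<close>, made canonical by extensionality.
\<close>

definition vectors :: "nat \<Rightarrow> (nat \<Rightarrow> real) set" where
  "vectors d = ({..<d} \<rightarrow>\<^sub>E UNIV)"

definition l2_dist :: "nat \<Rightarrow> (nat \<Rightarrow> real) \<Rightarrow> (nat \<Rightarrow> real) \<Rightarrow> real" where
  "l2_dist d x y = L2_set (\<lambda>j. x j - y j) {..<d}"

definition k_sparse :: "nat \<Rightarrow> nat \<Rightarrow> (nat \<Rightarrow> real) \<Rightarrow> bool" where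
  "k_sparse d k x \<longleftrightarrow> card {j. j < d \<and> x j \<noteq> 0} \<le> k"

text \<open>Identity covariance: the coordinates are independent with unit variance.\<close>

definition gaussian :: "nat \<Rightarrow> (nat \<Rightarrow> real) \<Rightarrow> (nat \<Rightarrow> real) measure" where
  "gaussian d \<mu> = (\<Pi>\<^sub>M j\<in>{..<d}. density lborel (\<lambda>x. ennreal (normal_density (\<mu> j) 1 x)))"

definition gaussian_samples :: "nat \<Rightarrow> nat \<Rightarrow> (nat \<Rightarrow> real) \<Rightarrow> (nat \<Rightarrow> nat \<Rightarrow> real) measure" where
  "gaussian_samples N d \<mu> = (\<Pi>\<^sub>M i\<in>{..<N}. gaussian d \<mu>)"

text \<open>
  Multiset difference counts the removed points; the corrupted points may come in any order.
\<close>

definition corrupted :: "real \<Rightarrow> 'a list \<Rightarrow> 'a list \<Rightarrow> bool" where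
  "corrupted \<epsilon> xs ys \<longleftrightarrow>
     length ys = length xs \<and> real (size (mset xs - mset ys)) \<le> \<epsilon> * real (length xs)"

text \<open>
  An adversary is an arbitrary, not necessarily measurable or computable, function of all samples.
\<close>

definition adversary ::
  "nat \<Rightarrow> nat \<Rightarrow> real \<Rightarrow> ((nat \<Rightarrow> real) list \<Rightarrow> (nat \<Rightarrow> real) list) \<Rightarrow> bool" where
  "adversary d N \<epsilon> A \<longleftrightarrow>
     (\<forall>xs. length xs = N \<and> set xs \<subseteq> vectors d \<longrightarrow>
        set (A xs) \<subseteq> vectors d \<and> corrupted \<epsilon> xs (A xs))"

text \<open>
  As the adversary need not be measurable, neither need the event of interest; it is required to
  contain a measurable event of the stated probability.
\<close>

definition with_probability_at_least :: "'a measure \<Rightarrow> real \<Rightarrow> ('a \<Rightarrow> bool) \<Rightarrow> bool" where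
  "with_probability_at_least M p P \<longleftrightarrow> (\<exists>E\<in>sets M. (\<forall>x\<in>E. P x) \<and> p \<le> measure M E)"


section \<open>Algorithms for estimating a vector\<close>

text \<open>
  Cells 0, 1, 2 of the natural-number memory hold \<open>d\<close>, \<open>N\<close>, \<open>k\<close>.  Cells 0 and 1 of the real memory
  hold \<open>\<epsilon>\<close> and \<open>\<tau>\<close>, and coordinate \<open>j\<close> of point \<open>i\<close> is in cell \<open>2 + i * d + j\<close>.  All other cells are 0.
\<close>

definition input_state :: "nat \<Rightarrow> (nat \<Rightarrow> real) list \<Rightarrow> nat \<Rightarrow> real \<Rightarrow> real \<Rightarrow> state" where
  "input_state d xs k \<epsilon> \<tau> =
     ((\<lambda>_. 0)(0 := d, 1 := length xs, 2 := k),
      (\<lambda>a. if a = 0 then \<epsilon> else if a = 1 then \<tau>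
           else if a < 2 + length xs * d then (xs ! ((a - 2) div d)) ((a - 2) mod d)
           else 0))"

text \<open>The output occupies real cells \<open>0, \<dots>, d - 1\<close>.\<close>

definition returns ::
  "com \<Rightarrow> nat \<Rightarrow> (nat \<Rightarrow> real) list \<Rightarrow> nat \<Rightarrow> real \<Rightarrow> real \<Rightarrow> (nat \<Rightarrow> real) \<Rightarrow> bool" where
  "returns P d xs k \<epsilon> \<tau> v \<longleftrightarrow>
     (\<exists>t s. exec P (input_state d xs k \<epsilon> \<tau>) t s \<and> v = restrict (snd s) {..<d})"

text \<open>
  Worst-case time over all admissible inputs, whether or not \<open>N\<close> is large enough for the
  statistical guarantee.  The input consists of \<open>N * d\<close> coordinates and five numbers.
\<close>

definition polynomial_time :: "com \<Rightarrow> bool" where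
  "polynomial_time P \<longleftrightarrow>
     (\<exists>a b :: nat. \<forall>d k :: nat. \<forall>\<epsilon> \<tau> :: real. \<forall>xs.
        1 \<le> d \<and> 1 \<le> k \<and> 0 < \<epsilon> \<and> \<epsilon> < 1/2 \<and> 0 < \<tau> \<and> set xs \<subseteq> vectors d \<longrightarrow>
        (\<exists>t s. exec P (input_state d xs k \<epsilon> \<tau>) t s \<and> t \<le> a * (length xs + d) ^ b))"

text \<open>
  \<open>k\<^sup>2 log (d / \<tau>) / \<epsilon>\<^sup>2\<close> times a polylogarithmic factor in \<open>d\<close>, \<open>k\<close>, \<open>1 / \<epsilon>\<close>, \<open>1 / \<tau>\<close>; the summand 3
  keeps that factor at least 1.
\<close>

definition sample_bound :: "real \<Rightarrow> nat \<Rightarrow> nat \<Rightarrow> nat \<Rightarrow> real \<Rightarrow> real \<Rightarrow> real" where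
  "sample_bound K c d k \<epsilon> \<tau> =
     K * ln (3 + real d * real k / (\<epsilon> * \<tau>)) ^ c * ((real k)\<^sup>2 * ln (real d / \<tau>) / \<epsilon>\<^sup>2)"

text \<open>
  An error bound \<open>O(\<epsilon> sqrt (log (1 / \<epsilon>)))\<close> is understood as \<open>\<epsilon>\<close> tends to 0: it holds with an absolute
  constant for all \<open>\<epsilon>\<close> below an absolute threshold.  No absolute constant works up to \<open>\<epsilon> = 1/2\<close>, where
  the best possible error tends to infinity while \<open>\<epsilon> sqrt (log (1 / \<epsilon>))\<close> stays bounded.
\<close>

end

theory Submission
  imports Defs "HOL-Combinatorics.Permutations"
begin

text \<open>
  The algorithm is a deterministic soft filter.  Given weights on the points, let \<open>M\<close> be the weighted
  empirical covariance minus the identity.  In place of the intractable supremum of \<open>v\<^sup>T M v\<close> over sparse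
  unit vectors it uses the Frobenius norm \<open>\<kappa>\<close> of the \<open>k\<close> heaviest rows of \<open>M\<close>, each cut down to its \<open>k\<close>
  largest entries; let \<open>A\<close> be this submatrix.  Because every row of \<open>A\<close> has at most \<open>k\<close> entries, \<open>b\<^sup>T A b\<close>
  is controlled by the \<open>k\<close>-sparse norm of the displacement \<open>b\<close> of the weighted mean, and
  \<open>\<parallel>b\<parallel> = O(\<epsilon> sqrt (ln (1 / \<epsilon>)) + sqrt (\<epsilon> \<kappa>))\<close>.  So if \<open>\<kappa> = O(\<epsilon> ln (1 / \<epsilon>))\<close>, truncating the weighted mean
  to its \<open>k\<close> largest coordinates is accurate.  Otherwise the quadratic form of \<open>A\<close> is large on average, the
  uncorrupted points cannot be responsible for that, and reducing the weights in proportion to the upper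
  tail of the form removes more corrupted than uncorrupted weight.  Each such step annihilates one weight,
  so one of the first \<open>N\<close> iterates is good; the one with the smallest \<open>\<kappa>\<close> is returned, which avoids computing
  \<open>ln (1 / \<epsilon>)\<close>.

  The sample only needs small entrywise deviations of its mean and covariance, and, for every
  \<open>k\<^sup>2\<close>-sparse unit matrix, a bound on the upper tail of its quadratic form; the latter follows from exponential
  moments of Gaussian quadratic forms and a union bound over a net.
\<close>


section \<open>The filter algorithm\<close>

text \<open>The sample bound fixes two accuracies. Entries of the mean and covariance must be right
  to \<open>\<epsilon> / k\<close>, so that \<open>k^2\<close> of them together are right to
  \<open>\<epsilon>\<close> in Frobenius norm; this costs about \<open>k^2 / \<epsilon>^2\<close>
  samples. The net has log-cardinality about \<open>k^2\<close> up to logarithms, but its tail sums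
  are needed only up to \<open>\<epsilon> N\<close>, so each unit of entropy costs only about
  \<open>1 / \<epsilon>\<close> samples. The weights are computed from the same data, so they cannot
  be treated as fixed. Every tail statement is therefore uniform over all weightings
  \<open>c\<close> of total at most \<open>5 * \<epsilon> * N\<close>, and sums over uncorrupted
  points are written as full sums minus such light sums. The adversary may also reorder the points
  and need not be measurable. Hence the probabilistic event concerns the clean sample alone, and
  everything after it is deterministic along a bijection between the two lists. Each quantity below
  is built from finite sums, field operations and strict comparisons, with 0/1 masks for selections,
  so that it can be transcribed into the small expression language compiled later.\<close>

definition rank :: "nat \<Rightarrow> (nat \<Rightarrow> real) \<Rightarrow> nat \<Rightarrow> real" where
  "rank n f j = (\<Sum>l<n. if f j < f l then 1 else if f l < f j then 0 else if l < j then 1 else 0)"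

text \<open>Ties in \<open>rank\<close> are broken by index, so the mask selects exactly
  \<open>min k n\<close> positions. It is a real 0/1 factor because the compiled expressions are
  real valued.\<close>

definition topmask :: "nat \<Rightarrow> nat \<Rightarrow> (nat \<Rightarrow> real) \<Rightarrow> nat \<Rightarrow> real" where
  "topmask n k f j = (if rank n f j < real k then 1 else 0)"

definition wmean :: "nat \<Rightarrow> (nat \<Rightarrow> real) \<Rightarrow> (nat \<Rightarrow> nat \<Rightarrow> real) \<Rightarrow> nat \<Rightarrow> real" where
  "wmean N w y j = (\<Sum>i<N. w i * y i j) / (\<Sum>i<N. w i)"

definition excess_cov :: "nat \<Rightarrow> (nat \<Rightarrow> real) \<Rightarrow> (nat \<Rightarrow> nat \<Rightarrow> real) \<Rightarrow> nat \<Rightarrow> nat \<Rightarrow> real" where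
  "excess_cov N w y r c =
     (\<Sum>i<N. w i * ((y i r - wmean N w y r) * (y i c - wmean N w y c))) / (\<Sum>i<N. w i) - (if r = c then 1 else 0)"

text \<open>A squared norm in spite of its name: the machine has no square roots, so the algorithm
  works with squares throughout.\<close>

definition rownorm :: "nat \<Rightarrow> nat \<Rightarrow> (nat \<Rightarrow> nat \<Rightarrow> real) \<Rightarrow> nat \<Rightarrow> real" where
  "rownorm d k M r = (\<Sum>c<d. topmask d k (\<lambda>c. (M r c)\<^sup>2) c * (M r c)\<^sup>2)"

definition selected :: "nat \<Rightarrow> nat \<Rightarrow> (nat \<Rightarrow> nat \<Rightarrow> real) \<Rightarrow> nat \<Rightarrow> nat \<Rightarrow> real" where
  "selected d k M r c = topmask d k (rownorm d k M) r * (topmask d k (\<lambda>c. (M r c)\<^sup>2) c * M r c)"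

definition sqnorm :: "nat \<Rightarrow> nat \<Rightarrow> (nat \<Rightarrow> nat \<Rightarrow> real) \<Rightarrow> real" where
  "sqnorm d k M = (\<Sum>r<d. topmask d k (rownorm d k M) r * rownorm d k M r)"

text \<open>With \<open>u\<close> the weighted mean, subtracting the trace makes the weighted
  average of the scores the inner product of \<open>A\<close> with the excess covariance. For the
  selected part this is exactly \<open>sqnorm\<close>.\<close>

definition score :: "nat \<Rightarrow> (nat \<Rightarrow> nat \<Rightarrow> real) \<Rightarrow> (nat \<Rightarrow> real) \<Rightarrow> (nat \<Rightarrow> real) \<Rightarrow> real" where
  "score d A u x = (\<Sum>r<d. \<Sum>c<d. A r c * ((x r - u r) * (x c - u c) - (if r = c then 1 else 0)))"

text \<open>The factor 3 leaves a margin: a positive value left unscored at a point of positive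
  weight has more than \<open>3 * \<epsilon> * N\<close> weight at or above it, of which at most
  \<open>\<epsilon> * N\<close> is corrupted. The test \<open>0 < w i\<close> ensures that a step
  annihilates a weight that was still positive.\<close>

definition tail_score :: "nat \<Rightarrow> real \<Rightarrow> (nat \<Rightarrow> real) \<Rightarrow> (nat \<Rightarrow> real) \<Rightarrow> nat \<Rightarrow> real" where
  "tail_score N \<epsilon> w p i =
     (if 0 < w i \<and> 0 < p i \<and> (\<Sum>j<N. if p j < p i then 0 else w j) \<le> 3 * \<epsilon> * real N then p i else 0)"

definition filter_score ::
  "nat \<Rightarrow> nat \<Rightarrow> nat \<Rightarrow> real \<Rightarrow> (nat \<Rightarrow> nat \<Rightarrow> real) \<Rightarrow> (nat \<Rightarrow> real) \<Rightarrow> nat \<Rightarrow> real" where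
  "filter_score d N k \<epsilon> y w =
     tail_score N \<epsilon> w (\<lambda>i. score d (selected d k (excess_cov N w y)) (wmean N w y) (y i))"

definition maxval :: "nat \<Rightarrow> (nat \<Rightarrow> real) \<Rightarrow> real" where
  "maxval N g = (\<Sum>i<N. topmask N 1 g i * g i)"

text \<open>Normalising by the maximum is what sends one weight to exactly 0. If no score is
  positive, the quotient is \<open>0 / 0 = 0\<close> and the weights stay as they are.\<close>

definition filter_step ::
  "nat \<Rightarrow> nat \<Rightarrow> nat \<Rightarrow> real \<Rightarrow> (nat \<Rightarrow> nat \<Rightarrow> real) \<Rightarrow> (nat \<Rightarrow> real) \<Rightarrow> nat \<Rightarrow> real" where
  "filter_step d N k \<epsilon> y w i =
     w i * (1 - filter_score d N k \<epsilon> y w i / maxval N (filter_score d N k \<epsilon> y w))"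

definition weights ::
  "nat \<Rightarrow> nat \<Rightarrow> nat \<Rightarrow> real \<Rightarrow> (nat \<Rightarrow> nat \<Rightarrow> real) \<Rightarrow> nat \<Rightarrow> nat \<Rightarrow> real" where
  "weights d N k \<epsilon> y t = (filter_step d N k \<epsilon> y ^^ t) (\<lambda>_. 1)"

text \<open>A decreasing positive function of \<open>sqnorm\<close>, so the default 0 ranks iterates
  with too much removed weight below all the others, and a single maximisation handles both
  criteria.\<close>

definition quality :: "nat \<Rightarrow> nat \<Rightarrow> nat \<Rightarrow> real \<Rightarrow> (nat \<Rightarrow> nat \<Rightarrow> real) \<Rightarrow> nat \<Rightarrow> real" where
  "quality d N k \<epsilon> y t = (let w = weights d N k \<epsilon> y t in
     if (\<Sum>i<N. 1 - w i) \<le> 2 * \<epsilon> * real N then 1 / (1 + sqnorm d k (excess_cov N w y)) else 0)"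

definition filter_mean :: "nat \<Rightarrow> nat \<Rightarrow> nat \<Rightarrow> real \<Rightarrow> (nat \<Rightarrow> nat \<Rightarrow> real) \<Rightarrow> nat \<Rightarrow> real" where
  "filter_mean d N k \<epsilon> y j =
     (\<Sum>t<N. topmask N 1 (quality d N k \<epsilon> y) t * wmean N (weights d N k \<epsilon> y t) y j)"

text \<open>More than \<open>2 * \<epsilon> * N\<close> points on each side leave more than
  \<open>\<epsilon> * N\<close> uncorrupted ones there, which ties a surviving corrupted value to
  the uncorrupted tails.\<close>

definition central :: "nat \<Rightarrow> real \<Rightarrow> (nat \<Rightarrow> real) \<Rightarrow> nat \<Rightarrow> real" where
  "central N \<epsilon> x i =
     (if 2 * \<epsilon> * real N < (\<Sum>j<N. if x j < x i then 0 else 1) \<and>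
         2 * \<epsilon> * real N < (\<Sum>j<N. if x i < x j then 0 else 1) then 1 else 0)"

text \<open>In dimension 1, filtering fails for the few samples that suffice when \<open>\<tau>\<close> is close to 1.\<close>

definition dense_estimate :: "nat \<Rightarrow> nat \<Rightarrow> nat \<Rightarrow> real \<Rightarrow> (nat \<Rightarrow> nat \<Rightarrow> real) \<Rightarrow> nat \<Rightarrow> real" where
  "dense_estimate d N k \<epsilon> y j =
     (if d < 2 then wmean N (central N \<epsilon> (\<lambda>i. y i 0)) y j else filter_mean d N k \<epsilon> y j)"

definition estimate :: "nat \<Rightarrow> nat \<Rightarrow> nat \<Rightarrow> real \<Rightarrow> (nat \<Rightarrow> nat \<Rightarrow> real) \<Rightarrow> nat \<Rightarrow> real" where
  "estimate d N k \<epsilon> y j =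
     topmask d k (\<lambda>j. (dense_estimate d N k \<epsilon> y j)\<^sup>2) j * dense_estimate d N k \<epsilon> y j"

section \<open>Selecting the largest entries\<close>

lemma topmask_cases: "topmask n k f j = 0 \<or> topmask n k f j = 1"
  by (simp add: topmask_def)

lemma topmask_sum: "(\<Sum>j<n. topmask n k f j * h j) = (\<Sum>j | j < n \<and> topmask n k f j = 1. h j)"
proof -
  have "(\<Sum>j<n. topmask n k f j * h j) = (\<Sum>j<n. if topmask n k f j = 1 then h j else 0)"
    using topmask_cases[of n k f] by (intro sum.cong) auto
  also have "\<dots> = (\<Sum>j\<in>{..<n} \<inter> {j. topmask n k f j = 1}. h j)"
    by (simp add: sum.If_cases)
  also have "{..<n} \<inter> {j. topmask n k f j = 1} = {j. j < n \<and> topmask n k f j = 1}" by auto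
  finally show ?thesis .
qed

text \<open>The order \<open>before\<close> is strict and total, so \<open>rk\<close> is injective
  from \<open>{..<n}\<close> into itself and hence a bijection of it. The selected set is the
  preimage of \<open>{..<min k n}\<close>, and comparing ranks compares values.\<close>

lemma topmask_top:
  fixes f :: "nat \<Rightarrow> real" and n k :: nat
  defines "H \<equiv> {j. j < n \<and> topmask n k f j = 1}"
  shows "card H = min k n" "\<And>j l. j \<in> H \<Longrightarrow> l < n \<Longrightarrow> l \<notin> H \<Longrightarrow> f l \<le> f j"
proof -
  define before where "before l j \<longleftrightarrow> f j < f l \<or> (f l = f j \<and> l < j)" for l j
  define rk where "rk j = card {l. l < n \<and> before l j}" for j
  have rank: "rank n f j = real (rk j)" for j
  proof -
    have "rank n f j = (\<Sum>l<n. if before l j then 1 else 0)"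
      unfolding rank_def before_def by (intro sum.cong) auto
    also have "\<dots> = real (card ({..<n} \<inter> {l. before l j}))" by (simp add: sum.If_cases)
    also have "{..<n} \<inter> {l. before l j} = {l. l < n \<and> before l j}" by auto
    finally show ?thesis by (simp add: rk_def)
  qed
  have less: "rk l < rk j" if "before l j" "l < n" for l j
    unfolding rk_def
  proof (rule psubset_card_mono)
    show "{m. m < n \<and> before m l} \<subset> {m. m < n \<and> before m j}"
      using that unfolding before_def by fastforce
  qed simp
  have total: "l = j \<or> before l j \<or> before j l" for l j
    unfolding before_def by (metis linorder_neqE_nat linorder_less_linear)
  have inj: "inj_on rk {..<n}"
    using less total by (intro inj_onI) (metis less_irrefl lessThan_iff)
  have "rk j < n" if "j < n" for j
  proof -
    have "{l. l < n \<and> before l j} \<subset> {..<n}" using that by (auto simp: before_def)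
    from psubset_card_mono[OF _ this] show ?thesis by (simp add: rk_def)
  qed
  then have im: "rk ` {..<n} = {..<n}"
    using inj by (intro card_subset_eq) (auto simp: card_image)
  have H: "H = {j. j < n \<and> rk j < k}"
    unfolding H_def topmask_def rank by auto
  have "rk ` H = {..<min k n}"
  proof -
    have "rk ` H = rk ` {..<n} \<inter> {..<k}" unfolding H by auto
    then show ?thesis unfolding im by auto
  qed
  moreover have "inj_on rk H" using inj by (rule inj_on_subset) (auto simp: H)
  ultimately show "card H = min k n" by (metis card_image card_lessThan)
  show "f l \<le> f j" if "j \<in> H" "l < n" "l \<notin> H" for j l
  proof -
    have "rk j < rk l" using that unfolding H by auto
    then have "\<not> before l j" using less that(2) by (meson order.asym)
    then show ?thesis unfolding before_def by auto
  qed
qed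

lemma sum_le_sum_dominating:
  fixes f :: "'a \<Rightarrow> real"
  assumes "finite A" "finite B" "card A \<le> card B" "\<And>a b. a \<in> A \<Longrightarrow> b \<in> B \<Longrightarrow> f a \<le> f b"
    and "\<And>b. b \<in> B \<Longrightarrow> 0 \<le> f b"
  shows "sum f A \<le> sum f B"
proof -
  obtain h where h: "h ` A \<subseteq> B" "inj_on h A"
    using card_le_inj[OF assms(1-3)] by blast
  have "sum f A \<le> (\<Sum>a\<in>A. f (h a))"
    using h assms(4) by (intro sum_mono) auto
  also have "\<dots> = sum f (h ` A)" using h by (simp add: sum.reindex)
  also have "\<dots> \<le> sum f B" using h assms(2,5) by (intro sum_mono2) auto
  finally show ?thesis .
qed

text \<open>When \<open>k \<le> n\<close> the selected set has exactly \<open>k\<close> elements, so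
  \<open>S - H\<close> has at most as many elements as \<open>H - S\<close>, and no value outside
  \<open>H\<close> exceeds a value inside. When \<open>k > n\<close> everything is selected and
  \<open>S - H\<close> is empty.\<close>

lemma topset_exchange:
  fixes f :: "nat \<Rightarrow> real" and n k :: nat
  defines "H \<equiv> {j. j < n \<and> topmask n k f j = 1}"
  assumes "S \<subseteq> {..<n}" "card S \<le> k" "\<And>j. j < n \<Longrightarrow> 0 \<le> f j"
  shows "sum f (S - H) \<le> sum f (H - S)"
proof (cases "k \<le> n")
  case True
  have fin: "finite S" "finite H" using assms(2) by (auto simp: H_def intro: finite_subset)
  have "card H = k" using topmask_top(1)[of n k f] True by (simp add: H_def)
  then have "card (S - H) \<le> card (H - S)"
    using assms(3) fin by (simp add: card_Diff_subset_Int Int_commute)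
  moreover have "f a \<le> f b" if "a \<in> S - H" "b \<in> H - S" for a b
    using topmask_top(2)[of b n k f a] that assms(2) by (auto simp: H_def)
  ultimately show ?thesis
    using fin assms(4) by (intro sum_le_sum_dominating) (auto simp: H_def)
next
  case False
  then have "card H = n" using topmask_top(1)[of n k f] by (simp add: H_def)
  then have "H = {..<n}" by (intro card_subset_eq) (auto simp: H_def)
  then have "S - H = {}" using assms(2) by auto
  then have "sum f (S - H) = 0" by (simp only: sum.empty)
  moreover have "0 \<le> sum f (H - S)" using assms(4) by (intro sum_nonneg) (auto simp: H_def)
  ultimately show ?thesis by simp
qed

lemma topmask_sum_ge:
  fixes f :: "nat \<Rightarrow> real"
  assumes "S \<subseteq> {..<n}" "card S \<le> k" "\<And>j. j < n \<Longrightarrow> 0 \<le> f j"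
  shows "sum f S \<le> (\<Sum>j<n. topmask n k f j * f j)"
proof -
  define H where "H = {j. j < n \<and> topmask n k f j = 1}"
  have fin: "finite S" "finite H" using assms(1) by (auto simp: H_def intro: finite_subset)
  have "sum f S = sum f (S \<inter> H) + sum f (S - H)" using fin by (simp add: sum.Int_Diff)
  also have "\<dots> \<le> sum f (S \<inter> H) + sum f (H - S)"
    using topset_exchange[OF assms] by (simp add: H_def)
  also have "\<dots> = sum f H" using fin sum.Int_Diff[of H f S] by (simp add: Int_commute)
  finally show ?thesis by (simp add: topmask_sum H_def)
qed

lemma topmask_one:
  assumes "0 < n"
  obtains j where "j < n" "\<And>l. l < n \<Longrightarrow> f l \<le> f j" "\<And>h. (\<Sum>l<n. topmask n 1 f l * h l) = h j"
proof -
  define H where "H = {j. j < n \<and> topmask n 1 f j = 1}"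
  have "card H = 1" using topmask_top(1)[of n 1 f] assms by (simp add: H_def)
  then obtain j where j: "H = {j}" by (auto simp: card_1_singleton_iff)
  show ?thesis
  proof (rule that[of j])
    show "j < n" using j by (auto simp: H_def)
    show "f l \<le> f j" if "l < n" for l
      using topmask_top(2)[of j n 1 f l] that j by (cases "l = j") (auto simp: H_def)
    show "(\<Sum>l<n. topmask n 1 f l * h l) = h j" for h
      using j by (simp add: topmask_sum H_def)
  qed
qed

text \<open>The difference splits into the error on the kept set \<open>H\<close>, the error on
  \<open>S - H\<close>, and the discarded entries \<open>- u\<close> on \<open>S - H\<close>. The
  last are dominated by the kept entries on \<open>H - S\<close>, where \<open>\<mu>\<close>
  vanishes and \<open>u\<close> is itself an error. Each piece costs one
  \<open>\<beta>\<close>.\<close>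

lemma truncation_error:
  fixes u \<mu> :: "nat \<Rightarrow> real"
  assumes sparse: "card {j. j < n \<and> \<mu> j \<noteq> 0} \<le> k"
    and err: "\<And>S. S \<subseteq> {..<n} \<Longrightarrow> card S \<le> k \<Longrightarrow> L2_set (\<lambda>j. u j - \<mu> j) S \<le> \<beta>"
  shows "L2_set (\<lambda>j. topmask n k (\<lambda>j. (u j)\<^sup>2) j * u j - \<mu> j) {..<n} \<le> 3 * \<beta>"
proof -
  define H where "H = {j. j < n \<and> topmask n k (\<lambda>j. (u j)\<^sup>2) j = 1}"
  define S where "S = {j. j < n \<and> \<mu> j \<noteq> 0}"
  have fin: "finite S" "finite H" by (auto simp: H_def S_def)
  have sub: "S \<subseteq> {..<n}" "H \<subseteq> {..<n}" by (auto simp: H_def S_def)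
  have cH: "card H \<le> k" using topmask_top(1)[of n k "\<lambda>j. (u j)\<^sup>2"] by (simp add: H_def)
  have cS: "card S \<le> k" using sparse by (simp add: S_def)
  let ?e = "\<lambda>j. u j - \<mu> j"
  let ?g = "\<lambda>j. topmask n k (\<lambda>j. (u j)\<^sup>2) j * u j - \<mu> j"
  have g: "?g j = (if j \<in> H then ?e j else 0) + (if j \<in> S - H then ?e j else 0) + (if j \<in> S - H then - u j else 0)"
    if "j < n" for j
    using that topmask_cases[of n k "\<lambda>j. (u j)\<^sup>2" j] by (auto simp: H_def S_def)
  have restr: "L2_set (\<lambda>j. if j \<in> A then h j else 0) {..<n} = L2_set h A" if "A \<subseteq> {..<n}" for A h
  proof -
    have "(\<Sum>j<n. (if j \<in> A then h j else 0)\<^sup>2) = (\<Sum>j<n. if j \<in> A then (h j)\<^sup>2 else 0)"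
      by (intro sum.cong) auto
    also have "\<dots> = (\<Sum>j\<in>A. (h j)\<^sup>2)" using that by (simp add: sum.If_cases Int_absorb1)
    finally show ?thesis by (simp add: L2_set_def)
  qed
  have "(\<Sum>j\<in>S - H. (u j)\<^sup>2) \<le> (\<Sum>j\<in>H - S. (u j)\<^sup>2)"
    unfolding H_def by (rule topset_exchange) (use sub cS in auto)
  also have "\<dots> = (\<Sum>j\<in>H - S. (?e j)\<^sup>2)" by (intro sum.cong) (auto simp: S_def H_def)
  finally have "L2_set u (S - H) \<le> L2_set ?e (H - S)" by (simp add: L2_set_def)
  also have "\<dots> \<le> \<beta>" using sub cH card_mono[of H "H - S"] fin by (intro err) auto
  finally have 3: "L2_set (\<lambda>j. - u j) (S - H) \<le> \<beta>" by (simp add: L2_set_def)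
  have 1: "L2_set ?e H \<le> \<beta>" using sub cH by (intro err) auto
  have 2: "L2_set ?e (S - H) \<le> \<beta>" using sub cS card_mono[of S "S - H"] fin by (intro err) auto
  have "L2_set ?g {..<n} = L2_set (\<lambda>j. ((if j \<in> H then ?e j else 0) + (if j \<in> S - H then ?e j else 0)) + (if j \<in> S - H then - u j else 0)) {..<n}"
    using g by (intro L2_set_cong) auto
  also have "\<dots> \<le> L2_set (\<lambda>j. (if j \<in> H then ?e j else 0)) {..<n} +
      L2_set (\<lambda>j. (if j \<in> S - H then ?e j else 0)) {..<n} + L2_set (\<lambda>j. if j \<in> S - H then - u j else 0) {..<n}"
    by (intro order.trans[OF L2_set_triangle_ineq] add_right_mono L2_set_triangle_ineq)
  also have "\<dots> = L2_set ?e H + L2_set ?e (S - H) + L2_set (\<lambda>j. - u j) (S - H)"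
    using sub by (subst (1 2 3) restr) auto
  finally show ?thesis using 1 2 3 by linarith
qed

lemma rownorm_nonneg: "0 \<le> rownorm d k M r"
  unfolding rownorm_def using topmask_cases[of d k] by (intro sum_nonneg) (metis mult_nonneg_nonneg zero_le_one order_refl zero_le_power2)

text \<open>A square block on at most \<open>k\<close> indices competes with the greedy choice, once
  inside each row and once among the rows. The empty block later supplies nonnegativity of
  \<open>sqnorm\<close>.\<close>

lemma sqnorm_ge:
  assumes "S \<subseteq> {..<d}" "card S \<le> k"
  shows "(\<Sum>r\<in>S. \<Sum>c\<in>S. (M r c)\<^sup>2) \<le> sqnorm d k M"
proof -
  have "(\<Sum>r\<in>S. \<Sum>c\<in>S. (M r c)\<^sup>2) \<le> (\<Sum>r\<in>S. rownorm d k M r)"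
    unfolding rownorm_def by (intro sum_mono topmask_sum_ge assms) auto
  also have "\<dots> \<le> sqnorm d k M"
    unfolding sqnorm_def by (intro topmask_sum_ge assms rownorm_nonneg)
  finally show ?thesis .
qed

text \<open>Replaces the masks by support sets once and for all. Leaving \<open>F\<close> arbitrary
  lets the same supports serve for the scores and for each term of their expansion.\<close>

lemma selected_sparse:
  obtains H S where "H \<subseteq> {..<d}" "card H \<le> k" "\<And>r. S r \<subseteq> {..<d}" "\<And>r. card (S r) \<le> k"
    "\<And>F. (\<Sum>r<d. \<Sum>c<d. selected d k M r c * F r c) = (\<Sum>r\<in>H. \<Sum>c\<in>S r. M r c * F r c)"
    "sqnorm d k M = (\<Sum>r\<in>H. \<Sum>c\<in>S r. (M r c)\<^sup>2)"
proof -
  define H where "H = {j. j < d \<and> topmask d k (rownorm d k M) j = 1}"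
  define S where "S r = {c. c < d \<and> topmask d k (\<lambda>c. (M r c)\<^sup>2) c = 1}" for r
  have row: "(\<Sum>c<d. topmask d k (\<lambda>c. (M r c)\<^sup>2) c * h c) = (\<Sum>c\<in>S r. h c)" for r h
    by (simp add: topmask_sum S_def)
  show ?thesis
  proof (rule that[of H S])
    show "card H \<le> k" "\<And>r. card (S r) \<le> k"
      using topmask_top(1) by (simp_all add: H_def S_def)
    show "(\<Sum>r<d. \<Sum>c<d. selected d k M r c * F r c) = (\<Sum>r\<in>H. \<Sum>c\<in>S r. M r c * F r c)" for F
    proof -
      have "(\<Sum>r<d. \<Sum>c<d. selected d k M r c * F r c) =
        (\<Sum>r<d. topmask d k (rownorm d k M) r * (\<Sum>c<d. topmask d k (\<lambda>c. (M r c)\<^sup>2) c * (M r c * F r c)))"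
        by (simp add: selected_def sum_distrib_left mult.assoc)
      also have "\<dots> = (\<Sum>r\<in>H. \<Sum>c\<in>S r. M r c * F r c)"
        by (simp only: row) (simp add: topmask_sum H_def)
      finally show ?thesis .
    qed
    show "sqnorm d k M = (\<Sum>r\<in>H. \<Sum>c\<in>S r. (M r c)\<^sup>2)"
      by (simp only: sqnorm_def rownorm_def row) (simp add: topmask_sum H_def row rownorm_def)
  qed (auto simp: H_def S_def)
qed

lemma maxval_props:
  assumes "0 < N" "\<And>i. i < N \<Longrightarrow> 0 \<le> g i"
  obtains i where "i < N" "g i = maxval N g" "\<And>l. l < N \<Longrightarrow> g l \<le> maxval N g"
  using topmask_one[OF assms(1), of g] unfolding maxval_def by metis

section \<open>Deterministic analysis of the filter\<close>

text \<open>The case of a rank-one coefficient matrix, through which bounds on quadratic forms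
  become bounds on second moments of linear forms.\<close>

lemma centered_square_expand:
  fixes a :: "nat \<Rightarrow> real"
  assumes "finite S"
  shows "(\<Sum>r\<in>S. \<Sum>c\<in>S. a r * a c * (x r * x c - (if r = c then 1 else 0))) =
    (\<Sum>j\<in>S. a j * x j)\<^sup>2 - (\<Sum>j\<in>S. (a j)\<^sup>2)"
proof -
  have "(\<Sum>r\<in>S. \<Sum>c\<in>S. a r * a c * (x r * x c - (if r = c then 1 else 0))) =
    (\<Sum>r\<in>S. \<Sum>c\<in>S. (a r * x r) * (a c * x c)) - (\<Sum>r\<in>S. \<Sum>c\<in>S. if r = c then a r * a c else 0)"
    by (simp add: sum_subtractf[symmetric] algebra_simps) (intro sum.cong, auto simp: algebra_simps)
  also have "(\<Sum>r\<in>S. \<Sum>c\<in>S. (a r * x r) * (a c * x c)) = (\<Sum>j\<in>S. a j * x j)\<^sup>2"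
    by (simp add: power2_eq_square sum_product)
  also have "(\<Sum>r\<in>S. \<Sum>c\<in>S. if r = c then a r * a c else 0) = (\<Sum>j\<in>S. (a j)\<^sup>2)"
    using assms by (simp add: power2_eq_square)
  finally show ?thesis .
qed

lemma sum_swap3:
  "(\<Sum>i\<in>G. \<Sum>r\<in>H. \<Sum>c\<in>S r. f i r c) = (\<Sum>r\<in>H. \<Sum>c\<in>S r. \<Sum>i\<in>G. f i r c)"
  by (subst sum.swap, intro sum.cong refl, rule sum.swap)

lemma weighted_Cauchy_Schwarz:
  fixes c f :: "'a \<Rightarrow> real"
  assumes "\<And>i. i \<in> A \<Longrightarrow> 0 \<le> c i"
  shows "(\<Sum>i\<in>A. c i * f i)\<^sup>2 \<le> (\<Sum>i\<in>A. c i) * (\<Sum>i\<in>A. c i * (f i)\<^sup>2)"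
proof -
  have "(\<Sum>i\<in>A. c i * f i) = (\<Sum>i\<in>A. sqrt (c i) * (sqrt (c i) * f i))"
    using assms by (intro sum.cong) (auto simp: mult.assoc[symmetric])
  moreover have "(\<Sum>i\<in>A. (sqrt (c i))\<^sup>2) = (\<Sum>i\<in>A. c i)" "(\<Sum>i\<in>A. (sqrt (c i) * f i)\<^sup>2) = (\<Sum>i\<in>A. c i * (f i)\<^sup>2)"
    using assms by (auto intro!: sum.cong simp: power_mult_distrib)
  ultimately show ?thesis
    using Cauchy_Schwarz_ineq_sum[of "\<lambda>i. sqrt (c i)" "\<lambda>i. sqrt (c i) * f i" A] by simp
qed

lemma abs_sum_Cauchy_Schwarz:
  fixes a b :: "'a \<Rightarrow> real"
  shows "\<bar>\<Sum>i\<in>A. a i * b i\<bar> \<le> sqrt (\<Sum>i\<in>A. (a i)\<^sup>2) * sqrt (\<Sum>i\<in>A. (b i)\<^sup>2)"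
  using Cauchy_Schwarz_ineq_sum[of a b A]
  by (metis real_sqrt_abs real_sqrt_le_iff real_sqrt_mult)

text \<open>
  Here \<open>z i\<close> is the \<open>i\<close>th original point minus \<open>\<mu>\<close>, \<open>y\<close> is the corrupted sample, and \<open>G\<close> is the set of
  indices of points that were not replaced.
\<close>

locale good_sample =
  fixes d N k :: nat and \<epsilon> \<eta> :: real and \<mu> :: "nat \<Rightarrow> real" and y z :: "nat \<Rightarrow> nat \<Rightarrow> real"
    and G :: "nat set"
  assumes N_pos: "0 < N" and k_pos: "0 < k" and eps_pos: "0 < \<epsilon>" and eps_small: "\<epsilon> \<le> 1 / 20000"
    and eta: "5 * \<epsilon> \<le> \<eta>"
    and G: "G \<subseteq> {..<N}" and bad: "real (card ({..<N} - G)) \<le> \<epsilon> * real N"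
    and y_good: "\<And>i j. i \<in> G \<Longrightarrow> j < d \<Longrightarrow> y i j = \<mu> j + z i j"
    and mean: "\<And>j. j < d \<Longrightarrow> \<bar>\<Sum>i<N. z i j\<bar> \<le> real N * (\<epsilon> / real k)"
    and cov: "\<And>r c. r < d \<Longrightarrow> c < d \<Longrightarrow> \<bar>\<Sum>i<N. z i r * z i c - (if r = c then 1 else 0)\<bar> \<le> real N * (\<epsilon> / real k)"
    and tail: "\<And>c U. (\<And>i. i < N \<Longrightarrow> 0 \<le> c i \<and> c i \<le> 1) \<Longrightarrow> (\<Sum>i<N. c i) \<le> 5 * \<epsilon> * real N \<Longrightarrow>
      U \<subseteq> {..<d} \<times> {..<d} \<Longrightarrow> card U \<le> k * k \<Longrightarrow>
      (\<Sum>u\<in>U. (\<Sum>i<N. c i * (z i (fst u) * z i (snd u) - (if fst u = snd u then 1 else 0)))\<^sup>2) \<le> (real N * \<eta>)\<^sup>2"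
begin

section \<open>Weighted sums over the uncorrupted points\<close>

abbreviation "quad U a x \<equiv> (\<Sum>u\<in>U. a u * (x (fst u) * x (snd u) - (if fst u = snd u then 1 else (0::real))))"

abbreviation "lin S v x \<equiv> (\<Sum>j\<in>S. v j * x j :: real)"

abbreviation "Bad \<equiv> {..<N} - G"

text \<open>The error scale: for \<open>\<eta>\<close> of order
  \<open>\<epsilon> * ln (1 / \<epsilon>)\<close> this is of order
  \<open>\<epsilon> * sqrt (ln (1 / \<epsilon>))\<close>.\<close>

definition "\<xi> = sqrt (\<epsilon> * \<eta>)"

lemma eta_pos: "0 < \<eta>" using eta eps_pos by linarith

lemma xi_sq: "\<xi>\<^sup>2 = \<epsilon> * \<eta>" using eta_pos eps_pos by (simp add: \<xi>_def)

lemma xi_nonneg: "0 \<le> \<xi>" using eta_pos eps_pos by (simp add: \<xi>_def)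

lemma fin_G [simp]: "finite G" using G finite_subset by blast

lemma sum_split: "(\<Sum>i<N. f i) = (\<Sum>i\<in>G. f i) + (\<Sum>i\<in>Bad. f i :: real)"
  using sum.subset_diff[OF G, of f] by simp

text \<open>The hypothesis \<open>tail\<close> bounds the Euclidean norm of the vector of weighted
  entries. Pairing that vector with \<open>a\<close> by Cauchy-Schwarz turns it into a bound for
  every coefficient matrix on \<open>U\<close>.\<close>

lemma quad_tail:
  assumes "\<And>i. i < N \<Longrightarrow> 0 \<le> c i \<and> c i \<le> 1" "(\<Sum>i<N. c i) \<le> 5 * \<epsilon> * real N"
    "U \<subseteq> {..<d} \<times> {..<d}" "card U \<le> k * k"
  shows "\<bar>\<Sum>i<N. c i * quad U a (z i)\<bar> \<le> real N * \<eta> * sqrt (\<Sum>u\<in>U. (a u)\<^sup>2)"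
proof -
  let ?m = "\<lambda>u. \<Sum>i<N. c i * (z i (fst u) * z i (snd u) - (if fst u = snd u then 1 else 0))"
  have "(\<Sum>i<N. c i * quad U a (z i)) = (\<Sum>i<N. \<Sum>u\<in>U. a u * (c i * (z i (fst u) * z i (snd u) - (if fst u = snd u then 1 else 0))))"
    by (simp add: sum_distrib_left mult_ac)
  also have "\<dots> = (\<Sum>u\<in>U. a u * ?m u)"
    by (subst sum.swap) (simp add: sum_distrib_left)
  finally have "\<bar>\<Sum>i<N. c i * quad U a (z i)\<bar> \<le> sqrt (\<Sum>u\<in>U. (a u)\<^sup>2) * sqrt (\<Sum>u\<in>U. (?m u)\<^sup>2)"
    using abs_sum_Cauchy_Schwarz[of a ?m U] by simp
  also have "\<dots> \<le> sqrt (\<Sum>u\<in>U. (a u)\<^sup>2) * sqrt ((real N * \<eta>)\<^sup>2)"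
    using tail[OF assms] by (intro mult_left_mono real_sqrt_le_mono) (auto intro: sum_nonneg)
  finally show ?thesis using eta_pos by (simp add: mult_ac)
qed

text \<open>At most \<open>k^2\<close> entries, each off by at most \<open>\<epsilon> / k\<close> on
  average, have norm at most \<open>\<epsilon>\<close>. This step dictates the accuracy per
  entry.\<close>

lemma quad_full:
  assumes "U \<subseteq> {..<d} \<times> {..<d}" "card U \<le> k * k"
  shows "\<bar>\<Sum>i<N. quad U a (z i)\<bar> \<le> real N * \<epsilon> * sqrt (\<Sum>u\<in>U. (a u)\<^sup>2)"
proof -
  let ?m = "\<lambda>u. \<Sum>i<N. z i (fst u) * z i (snd u) - (if fst u = snd u then 1 else 0)"
  have fin: "finite U" using assms(1) finite_subset by blast
  have "(\<Sum>i<N. quad U a (z i)) = (\<Sum>u\<in>U. a u * ?m u)"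
    by (subst sum.swap) (simp add: sum_distrib_left)
  then have "\<bar>\<Sum>i<N. quad U a (z i)\<bar> \<le> sqrt (\<Sum>u\<in>U. (a u)\<^sup>2) * sqrt (\<Sum>u\<in>U. (?m u)\<^sup>2)"
    using abs_sum_Cauchy_Schwarz[of a ?m U] by simp
  also have "\<dots> \<le> sqrt (\<Sum>u\<in>U. (a u)\<^sup>2) * sqrt ((real N * \<epsilon>)\<^sup>2)"
  proof (intro mult_left_mono real_sqrt_le_mono)
    have "(\<Sum>u\<in>U. (?m u)\<^sup>2) \<le> (\<Sum>u\<in>U. (real N * (\<epsilon> / real k))\<^sup>2)"
    proof (rule sum_mono)
      fix u assume "u \<in> U"
      then have "\<bar>?m u\<bar> \<le> real N * (\<epsilon> / real k)" using assms(1) by (intro cov) auto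
      then show "(?m u)\<^sup>2 \<le> (real N * (\<epsilon> / real k))\<^sup>2" by (rule power2_le_iff_abs_le[THEN iffD2, rotated]) (use eps_pos in auto)
    qed
    also have "\<dots> = real (card U) * (real N * (\<epsilon> / real k))\<^sup>2" by simp
    also have "\<dots> \<le> real (k * k) * (real N * (\<epsilon> / real k))\<^sup>2"
      using assms(2) by (intro mult_right_mono) (auto simp del: of_nat_mult)
    also have "\<dots> = (real N * \<epsilon>)\<^sup>2" using k_pos by (simp add: field_simps power2_eq_square)
    finally show "(\<Sum>u\<in>U. (?m u)\<^sup>2) \<le> (real N * \<epsilon>)\<^sup>2" .
  qed (auto intro: sum_nonneg)
  finally show ?thesis using eps_pos by (simp add: mult_ac)
qed

text \<open>The corrupted points can lose at most \<open>\<epsilon> * N\<close> weight, and the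
  filter is shown to take no more than that from the others; hence the factor 2.\<close>

definition admissible :: "(nat \<Rightarrow> real) \<Rightarrow> bool" where
  "admissible w \<longleftrightarrow> (\<forall>i<N. 0 \<le> w i \<and> w i \<le> 1) \<and> (\<Sum>i<N. 1 - w i) \<le> 2 * \<epsilon> * real N"

text \<open>An uncorrupted weighted sum is the full unweighted sum, which concentrates, minus a sum
  with small weights \<open>c\<close>, which falls under \<open>tail\<close>. The budget of
  \<open>c\<close> is \<open>2 * \<epsilon> * N\<close> for removed weight plus
  \<open>\<epsilon> * N\<close> for the corrupted indices.\<close>

lemma good_deficit:
  assumes "admissible w"
  defines "c \<equiv> \<lambda>i. if i \<in> G then 1 - w i else 1"
  shows "\<And>i. i < N \<Longrightarrow> 0 \<le> c i \<and> c i \<le> 1" "(\<Sum>i<N. c i) \<le> 3 * \<epsilon> * real N"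
    "\<And>f. (\<Sum>i\<in>G. w i * f i) = (\<Sum>i<N. f i) - (\<Sum>i<N. c i * f i)"
proof -
  show "0 \<le> c i \<and> c i \<le> 1" if "i < N" for i using assms that by (auto simp: admissible_def)
  have "(\<Sum>i<N. c i) = (\<Sum>i\<in>G. 1 - w i) + real (card Bad)"
    unfolding sum_split by (simp add: c_def)
  also have "(\<Sum>i\<in>G. 1 - w i) \<le> (\<Sum>i<N. 1 - w i)"
    using assms G by (intro sum_mono2) (auto simp: admissible_def)
  finally show "(\<Sum>i<N. c i) \<le> 3 * \<epsilon> * real N" using assms(1) bad by (simp add: admissible_def)
  show "(\<Sum>i\<in>G. w i * f i) = (\<Sum>i<N. f i) - (\<Sum>i<N. c i * f i)" for f
    unfolding sum_split by (simp add: c_def sum_subtractf algebra_simps)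
qed

lemma quad_good:
  assumes "admissible w" "U \<subseteq> {..<d} \<times> {..<d}" "card U \<le> k * k"
  shows "\<bar>\<Sum>i\<in>G. w i * quad U a (z i)\<bar> \<le> 2 * real N * \<eta> * sqrt (\<Sum>u\<in>U. (a u)\<^sup>2)"
proof -
  let ?c = "\<lambda>i. if i \<in> G then 1 - w i else 1"
  let ?s = "sqrt (\<Sum>u\<in>U. (a u)\<^sup>2)"
  have "\<bar>\<Sum>i<N. ?c i * quad U a (z i)\<bar> \<le> real N * \<eta> * ?s"
    using good_deficit(1,2)[OF assms(1)] eps_pos
    by (intro quad_tail[OF _ _ assms(2,3)]) (auto intro: order.trans)
  moreover have "\<bar>\<Sum>i<N. quad U a (z i)\<bar> \<le> real N * \<eta> * ?s"
    by (rule order.trans[OF quad_full[OF assms(2,3), of a]])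
       (use eta eps_pos in \<open>auto intro!: mult_right_mono mult_left_mono sum_nonneg\<close>)
  ultimately show ?thesis unfolding good_deficit(3)[OF assms(1)] by linarith
qed

definition unit_on :: "nat set \<Rightarrow> (nat \<Rightarrow> real) \<Rightarrow> bool" where
  "unit_on S v \<longleftrightarrow> S \<subseteq> {..<d} \<and> card S \<le> k \<and> (\<Sum>j\<in>S. (v j)\<^sup>2) = 1"

text \<open>The outer square of a \<open>k\<close>-sparse unit vector has Frobenius norm 1 and at
  most \<open>k^2\<close> positions, so the tail hypothesis on matrices also governs linear
  forms.\<close>

lemma unit_quad:
  assumes "unit_on S v"
  defines "a \<equiv> \<lambda>u. v (fst u) * v (snd u)"
  shows "quad (S \<times> S) a x = (lin S v x)\<^sup>2 - 1" "(\<Sum>u\<in>S \<times> S. (a u)\<^sup>2) = 1"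
    "S \<times> S \<subseteq> {..<d} \<times> {..<d}" "card (S \<times> S) \<le> k * k" "finite S"
proof -
  show fin: "finite S" using assms(1) finite_subset by (auto simp: unit_on_def)
  show "quad (S \<times> S) a x = (lin S v x)\<^sup>2 - 1"
    using centered_square_expand[OF fin, of v x] assms(1)
    by (simp add: a_def unit_on_def sum.cartesian_product case_prod_beta)
  have "(\<Sum>u\<in>S \<times> S. (a u)\<^sup>2) = (\<Sum>j\<in>S. (v j)\<^sup>2) * (\<Sum>j\<in>S. (v j)\<^sup>2)"
    by (simp add: a_def sum_product sum.cartesian_product case_prod_beta power_mult_distrib)
  then show "(\<Sum>u\<in>S \<times> S. (a u)\<^sup>2) = 1" using assms(1) by (simp add: unit_on_def)
  show "S \<times> S \<subseteq> {..<d} \<times> {..<d}" "card (S \<times> S) \<le> k * k"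
    using assms(1) by (auto simp: unit_on_def card_cartesian_product mult_le_mono)
qed

text \<open>The second moment under \<open>c\<close> is its centred part, at most
  \<open>N * \<eta>\<close>, plus the total weight, at most
  \<open>5 * \<epsilon> * N \<le> N * \<eta>\<close>. Cauchy-Schwarz against the total weight then
  gives \<open>sqrt 10 * N * \<xi>\<close>, rounded up to \<open>4 * N * \<xi>\<close>.\<close>

lemma lin_tail:
  assumes "unit_on S v" "\<And>i. i < N \<Longrightarrow> 0 \<le> c i \<and> c i \<le> 1" "(\<Sum>i<N. c i) \<le> 5 * \<epsilon> * real N"
  shows "(\<Sum>i<N. c i * (lin S v (z i))\<^sup>2) \<le> 2 * real N * \<eta>"
    "\<bar>\<Sum>i<N. c i * lin S v (z i)\<bar> \<le> 4 * real N * \<xi>"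
proof -
  note u = unit_quad[OF assms(1)]
  have "\<bar>\<Sum>i<N. c i * ((lin S v (z i))\<^sup>2 - 1)\<bar> \<le> real N * \<eta>"
    using quad_tail[OF assms(2,3) u(3,4), of "\<lambda>u. v (fst u) * v (snd u)"] by (simp only: u(1,2)) simp
  then have "(\<Sum>i<N. c i * (lin S v (z i))\<^sup>2) \<le> real N * \<eta> + (\<Sum>i<N. c i)"
    by (simp add: algebra_simps sum_subtractf)
  also have "\<dots> \<le> real N * \<eta> + 5 * \<epsilon> * real N" using assms(3) by simp
  also have "5 * \<epsilon> * real N \<le> \<eta> * real N" using eta by (intro mult_right_mono) auto
  finally show sq: "(\<Sum>i<N. c i * (lin S v (z i))\<^sup>2) \<le> 2 * real N * \<eta>" by (simp add: mult_ac)
  have "(\<Sum>i<N. c i * lin S v (z i))\<^sup>2 \<le> (\<Sum>i<N. c i) * (\<Sum>i<N. c i * (lin S v (z i))\<^sup>2)"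
    using assms(2) by (intro weighted_Cauchy_Schwarz) auto
  also have "\<dots> \<le> (5 * \<epsilon> * real N) * (2 * real N * \<eta>)"
    using sq assms(2,3) eps_pos by (intro mult_mono) (auto intro!: sum_nonneg)
  also have "\<dots> \<le> (4 * real N * \<xi>)\<^sup>2"
  proof -
    have "(4 * real N * \<xi>)\<^sup>2 = 16 * (real N)\<^sup>2 * (\<epsilon> * \<eta>)" by (simp only: power_mult_distrib xi_sq) simp
    moreover have "(5 * \<epsilon> * real N) * (2 * real N * \<eta>) = 10 * (real N)\<^sup>2 * (\<epsilon> * \<eta>)" by (simp add: power2_eq_square)
    moreover have "0 \<le> (real N)\<^sup>2 * (\<epsilon> * \<eta>)" using eps_pos eta_pos by simp
    ultimately show ?thesis by linarith
  qed
  finally show "\<bar>\<Sum>i<N. c i * lin S v (z i)\<bar> \<le> 4 * real N * \<xi>"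
    using xi_nonneg by (intro power2_le_iff_abs_le[THEN iffD1]) auto
qed

lemma lin_good:
  assumes "unit_on S v" "admissible w"
  shows "\<bar>\<Sum>i\<in>G. w i * lin S v (z i)\<bar> \<le> 5 * real N * \<xi>"
proof -
  let ?c = "\<lambda>i. if i \<in> G then 1 - w i else 1"
  have S: "S \<subseteq> {..<d}" "card S \<le> k" "(\<Sum>j\<in>S. (v j)\<^sup>2) = 1" using assms(1) by (auto simp: unit_on_def)
  have 1: "\<bar>\<Sum>i<N. ?c i * lin S v (z i)\<bar> \<le> 4 * real N * \<xi>"
    using good_deficit(1,2)[OF assms(2)] eps_pos
    by (intro lin_tail[OF assms(1)]) (auto intro: order.trans)
  have "(\<Sum>i<N. lin S v (z i)) = (\<Sum>j\<in>S. v j * (\<Sum>i<N. z i j))"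
    by (subst sum.swap) (simp add: sum_distrib_left)
  then have "\<bar>\<Sum>i<N. lin S v (z i)\<bar> \<le> sqrt 1 * sqrt (\<Sum>j\<in>S. (\<Sum>i<N. z i j)\<^sup>2)"
    using abs_sum_Cauchy_Schwarz[of v "\<lambda>j. \<Sum>i<N. z i j" S] S(3) by simp
  also have "(\<Sum>j\<in>S. (\<Sum>i<N. z i j)\<^sup>2) \<le> (\<Sum>j\<in>S. (real N * (\<epsilon> / real k))\<^sup>2)"
  proof (rule sum_mono)
    fix j assume "j \<in> S"
    then have "\<bar>\<Sum>i<N. z i j\<bar> \<le> real N * (\<epsilon> / real k)" using S by (intro mean) auto
    then show "(\<Sum>i<N. z i j)\<^sup>2 \<le> (real N * (\<epsilon> / real k))\<^sup>2"
      by (rule power2_le_iff_abs_le[THEN iffD2, rotated]) (use eps_pos in auto)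
  qed
  also have "\<dots> = real (card S) * (real N * (\<epsilon> / real k))\<^sup>2" by simp
  also have "\<dots> \<le> real (k * k) * (real N * (\<epsilon> / real k))\<^sup>2"
  proof (rule mult_right_mono)
    have "card S \<le> k * k" using S(2) k_pos by (metis le_square order.trans)
    then show "real (card S) \<le> real (k * k)" by (simp only: of_nat_le_iff)
  qed simp
  also have "\<dots> = (real N * \<epsilon>)\<^sup>2" using k_pos by (simp add: field_simps power2_eq_square)
  finally have "\<bar>\<Sum>i<N. lin S v (z i)\<bar> \<le> real N * \<epsilon>" using eps_pos by simp
  also have "\<dots> \<le> real N * \<xi>"
  proof -
    have "\<epsilon> * \<epsilon> \<le> \<epsilon> * \<eta>" using eta eps_pos by (intro mult_left_mono) auto
    then have "\<epsilon> \<le> \<xi>" unfolding \<xi>_def using eps_pos by (metis real_sqrt_le_mono real_sqrt_mult_self abs_of_pos real_sqrt_mult)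
    then show ?thesis by (intro mult_left_mono) auto
  qed
  finally show ?thesis using 1 unfolding good_deficit(3)[OF assms(2)] by linarith
qed

lemma total_weight:
  assumes "admissible w"
  shows "real N / 2 \<le> (\<Sum>i<N. w i)" "(\<Sum>i<N. w i) \<le> real N" "(1 - 2 * \<epsilon>) * real N \<le> (\<Sum>i<N. w i)"
    "(\<Sum>i\<in>Bad. w i) \<le> \<epsilon> * real N" "\<And>i. i < N \<Longrightarrow> 0 \<le> w i" "\<And>i. i < N \<Longrightarrow> w i \<le> 1"
proof -
  show w: "0 \<le> w i" "w i \<le> 1" if "i < N" for i using assms that by (auto simp: admissible_def)
  have "real N - (\<Sum>i<N. w i) \<le> 2 * \<epsilon> * real N" using assms by (simp add: admissible_def sum_subtractf)
  then show 3: "(1 - 2 * \<epsilon>) * real N \<le> (\<Sum>i<N. w i)" by (simp add: algebra_simps)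
  have "1 / 2 * real N \<le> (1 - 2 * \<epsilon>) * real N" using eps_small by (intro mult_right_mono) auto
  then show "real N / 2 \<le> (\<Sum>i<N. w i)" using 3 by simp
  show "(\<Sum>i<N. w i) \<le> real N" using sum_mono[of "{..<N}" w "\<lambda>_. 1"] w by simp
  have "(\<Sum>i\<in>Bad. w i) \<le> (\<Sum>i\<in>Bad. 1)" using w by (intro sum_mono) auto
  then show "(\<Sum>i\<in>Bad. w i) \<le> \<epsilon> * real N" using bad by simp
qed

section \<open>Displacement of the weighted mean\<close>

lemma wmean_shift:
  assumes "0 < (\<Sum>i<N. w i)"
  shows "(\<Sum>i<N. w i * (y i j - \<mu> j)) = (\<Sum>i<N. w i) * (wmean N w y j - \<mu> j)"
proof -
  have "(\<Sum>i<N. w i * (y i j - \<mu> j)) = (\<Sum>i<N. w i * y i j) - (\<Sum>i<N. w i) * \<mu> j"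
    by (simp add: right_diff_distrib sum_subtractf sum_distrib_right)
  also have "(\<Sum>i<N. w i * y i j) = (\<Sum>i<N. w i) * wmean N w y j"
    using assms by (simp add: wmean_def)
  finally show ?thesis by (simp add: right_diff_distrib)
qed

lemma wmean_lin:
  assumes "0 < (\<Sum>i<N. w i)"
  shows "(\<Sum>i<N. w i * lin S v (\<lambda>j. y i j - \<mu> j)) = (\<Sum>i<N. w i) * lin S v (\<lambda>j. wmean N w y j - \<mu> j)"
proof -
  have "(\<Sum>i<N. w i * lin S v (\<lambda>j. y i j - \<mu> j)) = (\<Sum>j\<in>S. v j * (\<Sum>i<N. w i * (y i j - \<mu> j)))"
    unfolding sum_distrib_left by (subst sum.swap) (simp add: mult_ac)
  then show ?thesis by (simp add: wmean_shift[OF assms] sum_distrib_left mult_ac)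
qed

text \<open>Second moment about \<open>\<mu>\<close> equals variance plus squared displacement. The
  variance in the unit direction \<open>v\<close> is the quadratic form of \<open>M\<close> plus 1,
  as \<open>M\<close> is the covariance minus the identity.\<close>

lemma second_moment:
  assumes "unit_on S v" "0 < (\<Sum>i<N. w i)"
  defines "M \<equiv> excess_cov N w y" and "\<beta> \<equiv> lin S v (\<lambda>j. wmean N w y j - \<mu> j)"
  shows "(\<Sum>i<N. w i * (lin S v (\<lambda>j. y i j - \<mu> j))\<^sup>2) =
    (\<Sum>i<N. w i) * ((\<Sum>r\<in>S. \<Sum>c\<in>S. v r * v c * M r c) + 1 + \<beta>\<^sup>2)"
proof -
  define W where "W = (\<Sum>i<N. w i)"
  define u where "u = wmean N w y"
  have W: "0 < W" using assms by (simp add: W_def)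
  have fin: "finite S" using unit_quad(5)[OF assms(1)] .
  have "W * (v r * v c * M r c) =
      (\<Sum>i<N. w i * ((v r * (y i r - u r)) * (v c * (y i c - u c)))) - W * (v r * v c * (if r = c then 1 else 0))" for r c
  proof -
    have "W * M r c = (\<Sum>i<N. w i * ((y i r - u r) * (y i c - u c))) - W * (if r = c then 1 else 0)"
      using W by (simp add: M_def excess_cov_def W_def[symmetric] u_def right_diff_distrib)
    then have "v r * v c * (W * M r c) = v r * v c * (\<Sum>i<N. w i * ((y i r - u r) * (y i c - u c))) - W * (v r * v c * (if r = c then 1 else 0))"
      by (simp only: right_diff_distrib) simp
    then show ?thesis by (simp add: sum_distrib_left mult_ac)
  qed
  then have "W * (\<Sum>r\<in>S. \<Sum>c\<in>S. v r * v c * M r c) =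
     (\<Sum>r\<in>S. \<Sum>c\<in>S. \<Sum>i<N. w i * ((v r * (y i r - u r)) * (v c * (y i c - u c)))) - W * (\<Sum>r\<in>S. \<Sum>c\<in>S. v r * v c * (if r = c then 1 else 0))"
    by (simp only: sum_distrib_left sum_subtractf)
  also have "(\<Sum>r\<in>S. \<Sum>c\<in>S. \<Sum>i<N. w i * ((v r * (y i r - u r)) * (v c * (y i c - u c)))) =
      (\<Sum>i<N. w i * (\<Sum>r\<in>S. \<Sum>c\<in>S. (v r * (y i r - u r)) * (v c * (y i c - u c))))"
    by (subst sum.swap, subst (2) sum.swap) (subst sum.swap, simp add: sum_distrib_left sum.swap[of _ S "{..<N}"])
  also have "(\<Sum>r\<in>S. \<Sum>c\<in>S. v r * v c * (if r = c then 1 else 0)) = 1"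
    using assms(1) fin by (simp add: unit_on_def power2_eq_square if_distrib[of "\<lambda>x. _ * x"] cong: if_cong)
  also have "(\<Sum>i<N. w i * (\<Sum>r\<in>S. \<Sum>c\<in>S. (v r * (y i r - u r)) * (v c * (y i c - u c)))) =
      (\<Sum>i<N. w i * (lin S v (\<lambda>j. y i j - \<mu> j) - \<beta>)\<^sup>2)"
  proof (rule sum.cong[OF refl])
    fix i
    have "lin S v (\<lambda>j. y i j - \<mu> j) - \<beta> = (\<Sum>r\<in>S. v r * (y i r - u r))"
      by (simp add: \<beta>_def u_def sum_subtractf[symmetric] algebra_simps)
    then show "w i * (\<Sum>r\<in>S. \<Sum>c\<in>S. (v r * (y i r - u r)) * (v c * (y i c - u c))) = w i * (lin S v (\<lambda>j. y i j - \<mu> j) - \<beta>)\<^sup>2"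
      by (simp add: power2_eq_square sum_product)
  qed
  also have "\<dots> = (\<Sum>i<N. w i * (lin S v (\<lambda>j. y i j - \<mu> j))\<^sup>2) - 2 * \<beta> * (\<Sum>i<N. w i * lin S v (\<lambda>j. y i j - \<mu> j)) + W * \<beta>\<^sup>2"
    by (simp add: W_def power2_eq_square algebra_simps sum.distrib sum_subtractf sum_distrib_left)
  also have "(\<Sum>i<N. w i * lin S v (\<lambda>j. y i j - \<mu> j)) = W * \<beta>"
    using wmean_lin[OF assms(2)] by (simp add: W_def \<beta>_def)
  finally show ?thesis by (simp add: W_def[symmetric] algebra_simps power2_eq_square)
qed

text \<open>The solution for \<open>\<beta>\<close> of \<open>\<beta> / 2 \<le> 7 * \<xi> + sqrt
  (\<epsilon> * \<kappa>) + \<beta> / 4\<close>, the inequality reached at the end of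
  \<open>certificate\<close>.\<close>

definition err_bound :: "real \<Rightarrow> real" where
  "err_bound \<kappa> = 28 * \<xi> + 4 * sqrt (\<epsilon> * \<kappa>)"

lemma err_bound_nonneg: "0 \<le> \<kappa> \<Longrightarrow> 0 \<le> err_bound \<kappa>"
  using xi_nonneg eps_pos by (simp add: err_bound_def)

lemma err_bound_sq:
  assumes "0 \<le> \<kappa>" shows "(err_bound \<kappa>)\<^sup>2 \<le> \<epsilon> * (1568 * \<eta> + 32 * \<kappa>)"
proof -
  have "(a + b)\<^sup>2 \<le> 2 * a\<^sup>2 + 2 * b\<^sup>2" for a b :: real
    using sum_squares_bound[of a b] by (simp add: power2_sum)
  from this[of "28 * \<xi>" "4 * sqrt (\<epsilon> * \<kappa>)"] show ?thesis
    using assms eps_pos by (simp add: err_bound_def power_mult_distrib xi_sq algebra_simps)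
qed

text \<open>The displacement is tested in its own direction \<open>v\<close> on \<open>S\<close>.
  The second moment of all points is at most about \<open>1 + \<kappa> + \<beta>\<^sup>2\<close> per
  unit weight, while the uncorrupted points already account for almost 1. So the corrupted ones have
  a small second moment and, weighing at most \<open>\<epsilon> * N\<close>, by Cauchy-Schwarz can
  hardly move the mean.\<close>

lemma certificate:
  assumes w: "admissible w" and S: "S \<subseteq> {..<d}" "card S \<le> k"
  defines "\<kappa> \<equiv> sqrt (sqnorm d k (excess_cov N w y))"
  shows "L2_set (\<lambda>j. wmean N w y j - \<mu> j) S \<le> err_bound \<kappa>"
proof (cases "L2_set (\<lambda>j. wmean N w y j - \<mu> j) S = 0")
  case True
  have "0 \<le> \<kappa>" using sqnorm_ge[of "{}" d k "excess_cov N w y"] by (simp add: \<kappa>_def)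
  then show ?thesis using True err_bound_nonneg by simp
next
  case False
  define W where "W = (\<Sum>i<N. w i)"
  define b where "b j = wmean N w y j - \<mu> j" for j
  define \<beta> where "\<beta> = L2_set b S"
  define v where "v j = b j / \<beta>" for j
  define M where "M = excess_cov N w y"
  define l where "l i = lin S v (\<lambda>j. y i j - \<mu> j)" for i
  note tw = total_weight[OF w, folded W_def]
  have \<kappa>0: "0 \<le> \<kappa>" using sqnorm_ge[of "{}" d k M] by (simp add: \<kappa>_def M_def)
  have \<beta>: "0 < \<beta>" "\<beta>\<^sup>2 = (\<Sum>j\<in>S. (b j)\<^sup>2)"
    using False L2_set_nonneg[of b S] unfolding \<beta>_def b_def[abs_def]
    by (simp_all add: less_le) (simp_all add: L2_set_def sum_nonneg)
  have unit: "unit_on S v"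
    using S \<beta>(1) by (simp add: unit_on_def v_def power_divide flip: sum_divide_distrib \<beta>(2))
  have vb: "lin S v b = \<beta>"
  proof -
    have "lin S v b = (\<Sum>j\<in>S. (b j)\<^sup>2) / \<beta>"
      by (simp add: v_def power2_eq_square sum_divide_distrib)
    then show ?thesis unfolding \<beta>(2)[symmetric] using \<beta>(1) by (simp add: power2_eq_square)
  qed
  have Wpos: "0 < W" using tw(1) N_pos by (smt (verit) divide_pos_pos of_nat_0_less_iff)
  have vMv: "(\<Sum>r\<in>S. \<Sum>c\<in>S. v r * v c * M r c) \<le> \<kappa>"
  proof -
    note u = unit_quad[OF unit]
    have "(\<Sum>r\<in>S. \<Sum>c\<in>S. v r * v c * M r c) = (\<Sum>u\<in>S \<times> S. (v (fst u) * v (snd u)) * M (fst u) (snd u))"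
      by (simp add: sum.cartesian_product case_prod_beta)
    also have "\<dots> \<le> sqrt (\<Sum>u\<in>S \<times> S. (v (fst u) * v (snd u))\<^sup>2) * sqrt (\<Sum>u\<in>S \<times> S. (M (fst u) (snd u))\<^sup>2)"
      using abs_sum_Cauchy_Schwarz by (rule order.trans[OF abs_ge_self])
    also have "\<dots> = sqrt (\<Sum>r\<in>S. \<Sum>c\<in>S. (M r c)\<^sup>2)"
      by (simp only: u(2)) (simp add: sum.cartesian_product case_prod_beta)
    also have "\<dots> \<le> \<kappa>" unfolding \<kappa>_def M_def by (intro real_sqrt_le_mono sqnorm_ge S)
    finally show ?thesis .
  qed
  have lG: "l i = lin S v (z i)" if "i \<in> G" for i
    unfolding l_def using that S y_good by (intro sum.cong) auto
  have sq: "(\<Sum>i<N. w i * (l i)\<^sup>2) \<le> W * (\<kappa> + 1 + \<beta>\<^sup>2)"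
    using second_moment[OF unit Wpos[unfolded W_def]] vMv Wpos vb
    unfolding l_def b_def[abs_def] W_def[symmetric] M_def by (simp add: mult_left_mono)
  have good: "(\<Sum>i\<in>G. w i) - 2 * real N * \<eta> \<le> (\<Sum>i\<in>G. w i * (l i)\<^sup>2)"
  proof -
    note u = unit_quad[OF unit]
    have "\<bar>\<Sum>i\<in>G. w i * ((lin S v (z i))\<^sup>2 - 1)\<bar> \<le> 2 * real N * \<eta>"
      using quad_good[OF w u(3,4), of "\<lambda>u. v (fst u) * v (snd u)"] by (simp only: u(1,2)) simp
    moreover have "(\<Sum>i\<in>G. w i * ((lin S v (z i))\<^sup>2 - 1)) = (\<Sum>i\<in>G. w i * (l i)\<^sup>2) - (\<Sum>i\<in>G. w i)"
      by (simp add: lG algebra_simps sum_subtractf)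
    ultimately show ?thesis by linarith
  qed
  \<comment> \<open>\<open>Q\<close> is the share of the second moment left to the corrupted points,
    per sample: the excess \<open>\<kappa>\<close>, the shift \<open>\<beta>\<^sup>2\<close> from
    centring at \<open>\<mu>\<close>, and \<open>3 * \<eta>\<close>, of which
    \<open>2 * \<eta>\<close> is the possible deficit of the uncorrupted part and
    \<open>\<eta>\<close> covers the corrupted weight.\<close>
  define Q where "Q = \<kappa> + \<beta>\<^sup>2 + 3 * \<eta>"
  have Q: "0 \<le> Q" using \<kappa>0 eta_pos by (simp add: Q_def)
  have badsq: "(\<Sum>i\<in>Bad. w i * (l i)\<^sup>2) \<le> real N * Q"
  proof -
    have "(\<Sum>i\<in>Bad. w i * (l i)\<^sup>2) \<le> W * (\<kappa> + 1 + \<beta>\<^sup>2) - (\<Sum>i\<in>G. w i) + 2 * real N * \<eta>"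
      using sq good sum_split[of "\<lambda>i. w i * (l i)\<^sup>2"] by linarith
    also have "\<dots> = W * (\<kappa> + \<beta>\<^sup>2) + (\<Sum>i\<in>Bad. w i) + 2 * real N * \<eta>"
      using sum_split[of w] by (simp add: W_def algebra_simps)
    also have "W * (\<kappa> + \<beta>\<^sup>2) \<le> real N * (\<kappa> + \<beta>\<^sup>2)" using tw(2) \<kappa>0 by (intro mult_right_mono) auto
    also have "(\<Sum>i\<in>Bad. w i) \<le> real N * \<eta>"
    proof -
      have "\<epsilon> * real N \<le> \<eta> * real N" using eta eps_pos by (intro mult_right_mono) auto
      then show ?thesis using tw(4) by (simp add: mult_ac)
    qed
    finally show ?thesis by (simp add: Q_def algebra_simps)
  qed
  have badlin: "\<bar>\<Sum>i\<in>Bad. w i * l i\<bar> \<le> real N * sqrt (\<epsilon> * Q)"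
  proof -
    have "(\<Sum>i\<in>Bad. w i * l i)\<^sup>2 \<le> (\<Sum>i\<in>Bad. w i) * (\<Sum>i\<in>Bad. w i * (l i)\<^sup>2)"
      using tw(5) by (intro weighted_Cauchy_Schwarz) auto
    also have "\<dots> \<le> (\<epsilon> * real N) * (real N * Q)"
      using tw(4,5) badsq eps_pos by (intro mult_mono) (auto intro!: sum_nonneg)
    also have "\<dots> = (real N * sqrt (\<epsilon> * Q))\<^sup>2"
      using eps_pos Q by (simp add: power_mult_distrib power2_eq_square)
    finally show ?thesis using eps_pos Q by (intro power2_le_iff_abs_le[THEN iffD1]) auto
  qed
  have "W * \<beta> = (\<Sum>i<N. w i * l i)"
    using wmean_lin[OF Wpos[unfolded W_def], where S = S and v = v] vb by (simp add: l_def W_def b_def[abs_def])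
  also have "\<dots> = (\<Sum>i\<in>G. w i * lin S v (z i)) + (\<Sum>i\<in>Bad. w i * l i)"
    unfolding sum_split using lG by simp
  also have "\<dots> \<le> real N * (5 * \<xi> + sqrt (\<epsilon> * Q))"
    using lin_good[OF unit w] badlin by (simp add: algebra_simps)
  finally have "real N / 2 * \<beta> \<le> real N * (5 * \<xi> + sqrt (\<epsilon> * Q))"
    using mult_right_mono[OF tw(1), of \<beta>] \<beta> by linarith
  then have "real N * (\<beta> / 2) \<le> real N * (5 * \<xi> + sqrt (\<epsilon> * Q))" by simp
  then have 1: "\<beta> / 2 \<le> 5 * \<xi> + sqrt (\<epsilon> * Q)" using N_pos by (simp only: mult_le_cancel_left_pos of_nat_0_less_iff)
  \<comment> \<open>The bound is implicit, since \<open>\<beta>\<close> occurs in \<open>Q\<close>.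
    Its contribution is only \<open>sqrt \<epsilon> * \<beta> \<le> \<beta> / 4\<close>, which the
    left side \<open>\<beta> / 2\<close> absorbs.\<close>
  have "sqrt (\<epsilon> * Q) \<le> sqrt (\<epsilon> * \<kappa>) + sqrt \<epsilon> * \<beta> + 2 * \<xi>"
  proof (rule real_le_lsqrt)
    have e: "(sqrt (\<epsilon> * \<kappa>))\<^sup>2 = \<epsilon> * \<kappa>" "(sqrt \<epsilon>)\<^sup>2 = \<epsilon>" using eps_pos \<kappa>0 by auto
    let ?a = "sqrt (\<epsilon> * \<kappa>)" and ?b = "sqrt \<epsilon> * \<beta>" and ?c = "2 * \<xi>"
    have nn: "0 \<le> ?a" "0 \<le> ?b" "0 \<le> ?c" using eps_pos \<kappa>0 \<beta> xi_nonneg by auto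
    show "0 \<le> ?a + ?b + ?c" using nn by linarith
    have "\<epsilon> * Q \<le> ?a\<^sup>2 + ?b\<^sup>2 + ?c\<^sup>2"
      unfolding power_mult_distrib e xi_sq Q_def using eps_pos eta_pos by (simp add: algebra_simps)
    also have "\<dots> \<le> (?a + ?b + ?c)\<^sup>2"
    proof -
      have "x\<^sup>2 + y\<^sup>2 + z\<^sup>2 \<le> (x + y + z)\<^sup>2" if "0 \<le> x" "0 \<le> y" "0 \<le> z" for x y z :: real
        using mult_nonneg_nonneg[of x y] mult_nonneg_nonneg[of x z] mult_nonneg_nonneg[of y z] that
        by (simp add: power2_eq_square algebra_simps)
      then show ?thesis using nn by blast
    qed
    finally show "\<epsilon> * Q \<le> (?a + ?b + ?c)\<^sup>2" .
  qed
  moreover have "sqrt \<epsilon> \<le> 1 / 4" using eps_small by (intro real_le_lsqrt) (auto simp: power2_eq_square)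
  then have "sqrt \<epsilon> * \<beta> \<le> 1 / 4 * \<beta>" using \<beta> by (intro mult_right_mono) auto
  ultimately show ?thesis using 1 unfolding err_bound_def \<beta>_def b_def[abs_def] by linarith
qed

text \<open>
  The support pattern of the selected matrix, at most \<open>k\<close> rows with at most \<open>k\<close> entries each, makes
  its bilinear form controllable by sparse norms of both arguments.
\<close>

lemma bilinear_sparse:
  fixes M :: "nat \<Rightarrow> nat \<Rightarrow> real"
  assumes "finite H" "\<And>r. L2_set t (S r) \<le> \<tau>" "L2_set s H \<le> \<sigma>" "0 \<le> \<tau>"
  shows "\<bar>\<Sum>r\<in>H. \<Sum>c\<in>S r. M r c * (s r * t c)\<bar> \<le> sqrt (\<Sum>r\<in>H. \<Sum>c\<in>S r. (M r c)\<^sup>2) * \<sigma> * \<tau>"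
proof -
  let ?m = "\<lambda>r. sqrt (\<Sum>c\<in>S r. (M r c)\<^sup>2)"
  have "\<bar>\<Sum>c\<in>S r. M r c * (s r * t c)\<bar> \<le> \<bar>s r\<bar> * (?m r * \<tau>)" for r
  proof -
    have "\<bar>\<Sum>c\<in>S r. M r c * t c\<bar> \<le> ?m r * \<tau>"
      by (rule order.trans[OF abs_sum_Cauchy_Schwarz])
         (use assms(2)[of r] in \<open>auto simp: L2_set_def intro!: mult_left_mono sum_nonneg\<close>)
    moreover have "(\<Sum>c\<in>S r. M r c * (s r * t c)) = s r * (\<Sum>c\<in>S r. M r c * t c)"
      by (simp add: sum_distrib_left mult_ac)
    ultimately show ?thesis by (simp add: abs_mult mult_left_mono)
  qed
  then have "\<bar>\<Sum>r\<in>H. \<Sum>c\<in>S r. M r c * (s r * t c)\<bar> \<le> (\<Sum>r\<in>H. \<bar>s r\<bar> * (?m r * \<tau>))"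
    by (rule_tac order.trans[OF sum_abs], intro sum_mono)
  also have "\<dots> = (\<Sum>r\<in>H. \<bar>s r\<bar> * ?m r) * \<tau>" by (simp only: sum_distrib_right mult.assoc)
  also have "(\<Sum>r\<in>H. \<bar>s r\<bar> * ?m r) \<le> L2_set s H * sqrt (\<Sum>r\<in>H. (?m r)\<^sup>2)"
    using abs_sum_Cauchy_Schwarz[of "\<lambda>r. \<bar>s r\<bar>" ?m H] by (simp add: L2_set_def)
  also have "(\<Sum>r\<in>H. (?m r)\<^sup>2) = (\<Sum>r\<in>H. \<Sum>c\<in>S r. (M r c)\<^sup>2)"
    by (simp add: sum_nonneg)
  also have "L2_set s H * sqrt (\<Sum>r\<in>H. \<Sum>c\<in>S r. (M r c)\<^sup>2) \<le> \<sigma> * sqrt (\<Sum>r\<in>H. \<Sum>c\<in>S r. (M r c)\<^sup>2)"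
    using assms(3) by (intro mult_right_mono) (auto intro!: sum_nonneg)
  finally show ?thesis using assms(4) by (simp add: mult_ac mult_right_mono)
qed

text \<open>Duality: the vector of sums, normalised on \<open>S\<close>, is itself a unit direction
  to which the hypothesis applies, and its pairing with the sums is the norm.\<close>

lemma sparse_norm_of_sum:
  assumes lin: "\<And>S v. unit_on S v \<Longrightarrow> \<bar>\<Sum>i\<in>A. c i * lin S v (z i)\<bar> \<le> B" and "0 \<le> B"
    and S: "S \<subseteq> {..<d}" "card S \<le> k"
  shows "L2_set (\<lambda>j. \<Sum>i\<in>A. c i * z i j) S \<le> B"
proof (cases "L2_set (\<lambda>j. \<Sum>i\<in>A. c i * z i j) S = 0")
  case False
  define s where "s j = (\<Sum>i\<in>A. c i * z i j)" for j
  define \<sigma> where "\<sigma> = L2_set s S"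
  define v where "v j = s j / \<sigma>" for j
  have \<sigma>: "0 < \<sigma>" "\<sigma>\<^sup>2 = (\<Sum>j\<in>S. (s j)\<^sup>2)"
    using False L2_set_nonneg[of s S] unfolding \<sigma>_def s_def[abs_def]
    by (simp_all add: less_le) (simp_all add: L2_set_def sum_nonneg)
  have "unit_on S v"
    using S \<sigma>(1) by (simp add: unit_on_def v_def power_divide flip: sum_divide_distrib \<sigma>(2))
  moreover have "(\<Sum>i\<in>A. c i * lin S v (z i)) = (\<Sum>j\<in>S. v j * s j)"
    unfolding s_def sum_distrib_left by (subst sum.swap) (simp add: mult_ac)
  moreover have "(\<Sum>j\<in>S. v j * s j) = (\<Sum>j\<in>S. (s j)\<^sup>2) / \<sigma>"
    by (simp add: v_def power2_eq_square sum_divide_distrib)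
  moreover have "\<dots> = \<sigma>" unfolding \<sigma>(2)[symmetric] using \<sigma>(1) by (simp add: power2_eq_square)
  ultimately show ?thesis using lin[of S v] unfolding \<sigma>_def s_def[abs_def] by simp
qed (use assms in simp)

text \<open>With \<open>b = u - \<mu>\<close> an uncorrupted point satisfies
  \<open>y i - u = z i - b\<close>. Hence the score splits into one quadratic, two cross terms and
  one constant term, all with the sparse support of the selected matrix.\<close>

lemma score_sum:
  fixes c u :: "nat \<Rightarrow> real"
  assumes "finite H" "\<And>r. finite (S r)"
    and F: "\<And>F. (\<Sum>r<d. \<Sum>c<d. A r c * F r c) = (\<Sum>r\<in>H. \<Sum>c\<in>S r. M r c * F r c)"
  defines "s \<equiv> \<lambda>j. \<Sum>i\<in>G. c i * z i j" and "b \<equiv> \<lambda>j. u j - \<mu> j"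
  shows "(\<Sum>i\<in>G. c i * score d A u (y i)) =
    (\<Sum>i\<in>G. c i * quad (Sigma H S) (\<lambda>x. M (fst x) (snd x)) (z i))
    - (\<Sum>r\<in>H. \<Sum>c\<in>S r. M r c * (s r * b c)) - (\<Sum>r\<in>H. \<Sum>c\<in>S r. M r c * (b r * s c))
    + (\<Sum>i\<in>G. c i) * (\<Sum>r\<in>H. \<Sum>c\<in>S r. M r c * (b r * b c))"
proof -
  let ?\<delta> = "\<lambda>r c. if r = c then 1 else (0::real)"
  have "score d A u (y i) = (\<Sum>r\<in>H. \<Sum>c\<in>S r. M r c * (z i r * z i c - ?\<delta> r c))
     - (\<Sum>r\<in>H. \<Sum>c\<in>S r. M r c * (z i r * b c)) - (\<Sum>r\<in>H. \<Sum>c\<in>S r. M r c * (b r * z i c))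
     + (\<Sum>r\<in>H. \<Sum>c\<in>S r. M r c * (b r * b c))" if "i \<in> G" for i
  proof -
    have "score d A u (y i) = (\<Sum>r<d. \<Sum>c<d. A r c * ((z i r - b r) * (z i c - b c) - ?\<delta> r c))"
      unfolding score_def b_def using y_good[OF that] by (intro sum.cong) (auto simp: algebra_simps)
    also have "\<dots> = (\<Sum>r\<in>H. \<Sum>c\<in>S r. M r c * (z i r * z i c - ?\<delta> r c) - M r c * (z i r * b c)
       - M r c * (b r * z i c) + M r c * (b r * b c))"
      unfolding F by (intro sum.cong refl) (simp add: algebra_simps)
    finally show ?thesis by (simp only: sum.distrib sum_subtractf)
  qed
  moreover have "(\<Sum>i\<in>G. c i * (\<Sum>r\<in>H. \<Sum>c\<in>S r. M r c * (z i r * b c))) = (\<Sum>r\<in>H. \<Sum>c\<in>S r. M r c * (s r * b c))"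
    unfolding s_def sum_distrib_left sum_distrib_right sum_swap3 by (simp add: mult_ac)
  moreover have "(\<Sum>i\<in>G. c i * (\<Sum>r\<in>H. \<Sum>c\<in>S r. M r c * (b r * z i c))) = (\<Sum>r\<in>H. \<Sum>c\<in>S r. M r c * (b r * s c))"
    unfolding s_def sum_distrib_left sum_distrib_right sum_swap3 by (simp add: mult_ac)
  moreover have "quad (Sigma H S) (\<lambda>x. M (fst x) (snd x)) x = (\<Sum>r\<in>H. \<Sum>c\<in>S r. M r c * (x r * x c - ?\<delta> r c))" for x
    using assms(1,2) by (subst sum.Sigma) (auto simp: case_prod_beta)
  ultimately show ?thesis
    by (simp add: right_diff_distrib distrib_left sum.distrib sum_subtractf sum_distrib_right)
qed

text \<open>The scores have weighted total exactly \<open>W * \<kappa>\<^sup>2\<close>. Uncorrupted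
  points contribute at most \<open>\<kappa> * N * \<Gamma>\<close>, both in full and when restricted
  to the scored tail, and \<open>\<Gamma>\<close> is well below \<open>\<kappa>\<close> when
  \<open>\<kappa> > 10 * \<eta>\<close>. The corrupted points must supply the rest, and cutting
  their scores down to the tail loses only \<open>\<kappa> * N * \<Gamma> / 2\<close>.\<close>

lemma filter_progress:
  assumes w: "admissible w"
  defines "M \<equiv> excess_cov N w y" and "g \<equiv> filter_score d N k \<epsilon> y w"
  defines "\<kappa> \<equiv> sqrt (sqnorm d k M)"
  assumes large: "10 * \<eta> < \<kappa>"
  shows "(\<Sum>i\<in>G. w i * g i) \<le> (\<Sum>i\<in>Bad. w i * g i)" "\<exists>i<N. 0 < g i"
proof -
  define W where "W = (\<Sum>i<N. w i)"
  define u where "u = wmean N w y"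
  define b where "b j = u j - \<mu> j" for j
  define A where "A = selected d k M"
  define p where "p i = score d A u (y i)" for i
  define \<beta> where "\<beta> = err_bound \<kappa>"
  define \<Gamma> where "\<Gamma> = 3 * \<eta> + \<kappa> / 100"
  note tw = total_weight[OF w, folded W_def]
  have \<kappa>: "0 < \<kappa>" using large eta_pos by linarith
  have \<kappa>2: "\<kappa>\<^sup>2 = sqnorm d k M" using sqnorm_ge[of "{}" d k M] by (simp add: \<kappa>_def)
  have \<beta>: "0 \<le> \<beta>" using err_bound_nonneg \<kappa> by (simp add: \<beta>_def)
  obtain H S where HS: "H \<subseteq> {..<d}" "card H \<le> k" "\<And>r. S r \<subseteq> {..<d}" "\<And>r. card (S r) \<le> k"
    and F: "\<And>F. (\<Sum>r<d. \<Sum>c<d. A r c * F r c) = (\<Sum>r\<in>H. \<Sum>c\<in>S r. M r c * F r c)"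
    and nM: "sqnorm d k M = (\<Sum>r\<in>H. \<Sum>c\<in>S r. (M r c)\<^sup>2)"
    unfolding A_def using selected_sparse[of d k M] by blast
  have fin: "finite H" "\<And>r. finite (S r)" using HS finite_subset by blast+
  let ?U = "Sigma H S" and ?a = "\<lambda>x. M (fst x) (snd x)"
  have U: "?U \<subseteq> {..<d} \<times> {..<d}" using HS by auto
  have "card ?U = (\<Sum>r\<in>H. card (S r))" using fin by simp
  also have "\<dots> \<le> card H * k" using sum_bounded_above[of H "\<lambda>r. card (S r)" k] HS(4) by simp
  finally have cU: "card ?U \<le> k * k" using HS(2) by (meson mult_le_mono1 order.trans)
  have nU: "sqrt (\<Sum>x\<in>?U. (?a x)\<^sup>2) = \<kappa>"
    using fin by (simp add: \<kappa>_def nM sum.Sigma case_prod_beta)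
  have nb: "L2_set b S' \<le> \<beta>" if "S' \<subseteq> {..<d}" "card S' \<le> k" for S'
    using certificate[OF w that] by (simp add: \<beta>_def \<kappa>_def b_def[abs_def] u_def M_def)
  \<comment> \<open>Used twice: with light weights of total at most
    \<open>5 * \<epsilon> * N\<close>, and with \<open>w\<close> itself. The parameters bound the
    quadratic part, the linear part and the total weight.\<close>
  have cross: "\<bar>\<Sum>i\<in>G. c i * p i\<bar> \<le> \<kappa> * (Q + 2 * B * \<beta> + C * \<beta>\<^sup>2)"
    if Q: "\<bar>\<Sum>i\<in>G. c i * quad ?U ?a (z i)\<bar> \<le> \<kappa> * Q"
      and B: "\<And>S v. unit_on S v \<Longrightarrow> \<bar>\<Sum>i\<in>G. c i * lin S v (z i)\<bar> \<le> B" "0 \<le> B"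
      and C: "0 \<le> (\<Sum>i\<in>G. c i)" "(\<Sum>i\<in>G. c i) \<le> C" for c Q B C
  proof -
    let ?s = "\<lambda>j. \<Sum>i\<in>G. c i * z i j"
    have ns: "L2_set ?s S' \<le> B" if "S' \<subseteq> {..<d}" "card S' \<le> k" for S'
      by (rule sparse_norm_of_sum[OF B that])
    have 1: "\<bar>\<Sum>r\<in>H. \<Sum>c\<in>S r. M r c * (?s r * b c)\<bar> \<le> \<kappa> * B * \<beta>"
      unfolding \<kappa>_def nM using HS by (intro bilinear_sparse fin nb ns \<beta>) auto
    have 2: "\<bar>\<Sum>r\<in>H. \<Sum>c\<in>S r. M r c * (b r * ?s c)\<bar> \<le> \<kappa> * \<beta> * B"
      unfolding \<kappa>_def nM using HS by (intro bilinear_sparse fin nb ns B(2)) auto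
    have 3: "\<bar>\<Sum>r\<in>H. \<Sum>c\<in>S r. M r c * (b r * b c)\<bar> \<le> \<kappa> * \<beta> * \<beta>"
      unfolding \<kappa>_def nM using HS by (intro bilinear_sparse fin nb \<beta>) auto
    have 4: "\<bar>(\<Sum>i\<in>G. c i) * (\<Sum>r\<in>H. \<Sum>c\<in>S r. M r c * (b r * b c))\<bar> \<le> C * (\<kappa> * \<beta> * \<beta>)"
      unfolding abs_mult using C 3 by (intro mult_mono) auto
    have "(\<Sum>i\<in>G. c i * p i) = (\<Sum>i\<in>G. c i * quad ?U ?a (z i))
      - (\<Sum>r\<in>H. \<Sum>c\<in>S r. M r c * (?s r * b c)) - (\<Sum>r\<in>H. \<Sum>c\<in>S r. M r c * (b r * ?s c))
      + (\<Sum>i\<in>G. c i) * (\<Sum>r\<in>H. \<Sum>c\<in>S r. M r c * (b r * b c))"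
      unfolding p_def b_def by (rule score_sum[OF fin F])
    then have "\<bar>\<Sum>i\<in>G. c i * p i\<bar> \<le> \<kappa> * Q + \<kappa> * B * \<beta> + \<kappa> * \<beta> * B + C * (\<kappa> * \<beta> * \<beta>)"
      using Q 1 2 4 by linarith
    then show ?thesis by (simp add: algebra_simps power2_eq_square)
  qed
  \<comment> \<open>Here the threshold on \<open>\<epsilon>\<close> is spent. By
    \<open>err_bound_sq\<close> the terms beyond \<open>2 * \<eta>\<close> are at most
    \<open>\<epsilon> * (9413 * \<eta> + 192 * \<kappa>)\<close>, where
    \<open>9413 = 6 * 1568 + 5\<close> and \<open>192 = 6 * 32\<close>; with
    \<open>\<epsilon> \<le> 1 / 20000\<close> this is below
    \<open>\<eta> + \<kappa> / 100\<close>.\<close>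
  have small: "2 * \<eta> + 6 * \<beta>\<^sup>2 + 5 * \<xi>\<^sup>2 \<le> \<Gamma>"
  proof -
    have "6 * \<beta>\<^sup>2 + 5 * \<xi>\<^sup>2 \<le> \<epsilon> * (9413 * \<eta> + 192 * \<kappa>)"
      using err_bound_sq[of \<kappa>] \<kappa> unfolding \<beta>_def xi_sq by (simp add: algebra_simps)
    also have "\<dots> \<le> 1 / 20000 * (9413 * \<eta> + 192 * \<kappa>)"
      using eps_small eta_pos \<kappa> by (intro mult_right_mono) auto
    also have "\<dots> \<le> \<eta> + \<kappa> / 100" using eta_pos \<kappa> by simp
    finally show ?thesis by (simp add: \<Gamma>_def)
  qed
  have \<beta>\<xi>: "2 * \<beta> * \<xi> \<le> \<beta>\<^sup>2 + \<xi>\<^sup>2" using sum_squares_bound[of \<beta> \<xi>] .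
  have tailG: "\<bar>\<Sum>i\<in>G. c i * p i\<bar> \<le> \<kappa> * real N * \<Gamma>"
    if c: "\<And>i. i \<in> G \<Longrightarrow> 0 \<le> c i \<and> c i \<le> 1" "(\<Sum>i\<in>G. c i) \<le> 5 * \<epsilon> * real N" for c
  proof -
    let ?c = "\<lambda>i. if i \<in> G then c i else 0"
    have ext: "(\<Sum>i<N. ?c i * f i) = (\<Sum>i\<in>G. c i * f i)" for f unfolding sum_split by simp
    have c': "\<And>i. i < N \<Longrightarrow> 0 \<le> ?c i \<and> ?c i \<le> 1" "(\<Sum>i<N. ?c i) \<le> 5 * \<epsilon> * real N"
      using c ext[of "\<lambda>_. 1"] by auto
    have "\<bar>\<Sum>i\<in>G. c i * p i\<bar> \<le> \<kappa> * (real N * \<eta> + 2 * (4 * real N * \<xi>) * \<beta> + 5 * \<epsilon> * real N * \<beta>\<^sup>2)"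
    proof (rule cross)
      show "\<bar>\<Sum>i\<in>G. c i * quad ?U ?a (z i)\<bar> \<le> \<kappa> * (real N * \<eta>)"
        using quad_tail[OF c' U cU, of ?a] unfolding ext nU by (simp add: mult_ac)
      show "\<bar>\<Sum>i\<in>G. c i * lin S v (z i)\<bar> \<le> 4 * real N * \<xi>" if "unit_on S v" for S v
        using lin_tail(2)[OF that c'] unfolding ext .
      show "0 \<le> (\<Sum>i\<in>G. c i)" using c by (intro sum_nonneg) auto
    qed (use c xi_nonneg in auto)
    also have "\<dots> = \<kappa> * real N * (\<eta> + 4 * (2 * \<beta> * \<xi>) + 5 * \<epsilon> * \<beta>\<^sup>2)" by (simp add: algebra_simps)
    also have "\<dots> \<le> \<kappa> * real N * \<Gamma>"
    proof (rule mult_left_mono)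
      have "5 * \<epsilon> * \<beta>\<^sup>2 \<le> 1 * \<beta>\<^sup>2" using eps_small by (intro mult_right_mono) auto
      then show "\<eta> + 4 * (2 * \<beta> * \<xi>) + 5 * \<epsilon> * \<beta>\<^sup>2 \<le> \<Gamma>" using small \<beta>\<xi> eta_pos by (smt (verit) zero_le_power2)
    qed (use \<kappa> in auto)
    finally show ?thesis .
  qed
  have fullG: "\<bar>\<Sum>i\<in>G. w i * p i\<bar> \<le> \<kappa> * real N * \<Gamma>"
  proof -
    have "\<bar>\<Sum>i\<in>G. w i * p i\<bar> \<le> \<kappa> * (2 * real N * \<eta> + 2 * (5 * real N * \<xi>) * \<beta> + real N * \<beta>\<^sup>2)"
    proof (rule cross)
      show "\<bar>\<Sum>i\<in>G. w i * quad ?U ?a (z i)\<bar> \<le> \<kappa> * (2 * real N * \<eta>)"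
        using quad_good[OF w U cU, of ?a] unfolding nU by (simp add: mult_ac)
      show "\<bar>\<Sum>i\<in>G. w i * lin S v (z i)\<bar> \<le> 5 * real N * \<xi>" if "unit_on S v" for S v
        by (rule lin_good[OF that w])
      show "0 \<le> (\<Sum>i\<in>G. w i)" using tw(5) G by (intro sum_nonneg) auto
      have "0 \<le> (\<Sum>i\<in>Bad. w i)" using tw(5) by (intro sum_nonneg) auto
      then show "(\<Sum>i\<in>G. w i) \<le> real N" using tw(2) sum_split[of w] by (simp add: W_def)
    qed (use xi_nonneg in auto)
    also have "\<dots> = \<kappa> * real N * (2 * \<eta> + 5 * (2 * \<beta> * \<xi>) + \<beta>\<^sup>2)" by (simp add: algebra_simps)
    also have "\<dots> \<le> \<kappa> * real N * \<Gamma>"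
      using small \<beta>\<xi> \<kappa> by (intro mult_left_mono) auto
    finally show ?thesis .
  qed
  \<comment> \<open>Averaging the scores pairs the selected matrix with \<open>M\<close>, and the
    two agree on its support, so the result is a sum of squares of selected entries.\<close>
  have total: "(\<Sum>i<N. w i * p i) = W * \<kappa>\<^sup>2"
  proof -
    have W: "0 < W" using tw(1) N_pos by (smt (verit) divide_pos_pos of_nat_0_less_iff)
    have "(\<Sum>i<N. w i * p i) = (\<Sum>r<d. \<Sum>c<d. A r c * (\<Sum>i<N. w i * ((y i r - u r) * (y i c - u c) - (if r = c then 1 else 0))))"
      unfolding p_def score_def sum_distrib_left by (subst sum_swap3) (simp add: mult_ac)
    moreover have "(\<Sum>i<N. w i * ((y i r - u r) * (y i c - u c) - (if r = c then 1 else 0))) = W * M r c" for r c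
    proof -
      have "W * M r c = (\<Sum>i<N. w i * ((y i r - u r) * (y i c - u c))) - W * (if r = c then 1 else 0)"
        using W by (simp add: M_def excess_cov_def u_def W_def[symmetric] right_diff_distrib)
      then show ?thesis by (simp only: right_diff_distrib[of "w _" "_ * _"] sum_subtractf W_def sum_distrib_right)
    qed
    moreover have "(\<Sum>r<d. \<Sum>c<d. A r c * (W * M r c)) = W * (\<Sum>r\<in>H. \<Sum>c\<in>S r. (M r c)\<^sup>2)"
      unfolding F by (simp add: sum_distrib_left power2_eq_square mult_ac)
    ultimately show ?thesis by (simp add: \<kappa>2 nM)
  qed
  have g: "g i = tail_score N \<epsilon> w p i" for i
    by (simp add: g_def filter_score_def p_def[abs_def] A_def M_def u_def)
  have g0: "0 \<le> g i" for i by (simp add: g tail_score_def)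
  let ?r = "\<lambda>i. \<Sum>j<N. if p j < p i then 0 else w j"
  \<comment> \<open>The scored points are a set of the form \<open>p j \<ge> p i\<close>, so their weight is at most \<open>3 \<epsilon> N\<close>.\<close>
  have upG: "(\<Sum>i\<in>G. w i * g i) \<le> \<kappa> * real N * \<Gamma>"
  proof (cases "\<exists>i<N. g i \<noteq> 0")
    case False
    then have "(\<Sum>i\<in>G. w i * g i) = 0" using G by (intro sum.neutral) auto
    then show ?thesis using \<kappa> eta_pos by (simp add: \<Gamma>_def)
  next
    case True
    define L where "L = {i. i < N \<and> g i \<noteq> 0}"
    have "finite L" "L \<noteq> {}" using True by (auto simp: L_def)
    then obtain i0 where i0: "i0 \<in> L" "\<And>i. i \<in> L \<Longrightarrow> p i0 \<le> p i"
      using ex_is_arg_min_if_finite[of L p] by (auto simp: is_arg_min_linorder)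
    let ?c = "\<lambda>i. if i \<in> L then w i else 0"
    have gL: "g i = p i" "0 < w i" if "i \<in> L" for i using that by (auto simp: L_def g tail_score_def split: if_splits)
    have "(\<Sum>i\<in>G. ?c i) \<le> (\<Sum>i<N. ?c i)" using G tw(5) by (intro sum_mono2) auto
    also have "\<dots> \<le> ?r i0"
    proof (rule sum_mono)
      fix i assume "i \<in> {..<N}"
      then show "?c i \<le> (if p i < p i0 then 0 else w i)" using i0(2)[of i] tw(5)[of i] by auto
    qed
    also have "\<dots> \<le> 3 * \<epsilon> * real N" using i0(1) by (auto simp: L_def g tail_score_def split: if_splits)
    also have "\<dots> \<le> 5 * \<epsilon> * real N" using eps_pos by simp
    finally have "\<bar>\<Sum>i\<in>G. ?c i * p i\<bar> \<le> \<kappa> * real N * \<Gamma>" using tw(5,6) G by (intro tailG) auto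
    moreover have "(\<Sum>i\<in>G. w i * g i) = (\<Sum>i\<in>G. ?c i * p i)"
      using gL G by (intro sum.cong) (auto simp: L_def)
    ultimately show ?thesis by simp
  qed
  \<comment> \<open>A positive value cut off by \<open>tail_score\<close> has more than
    \<open>2 * \<epsilon> * N\<close> uncorrupted weight at or above it. The factor \<open>q\<close>
    scales that weight to exactly \<open>2 * \<epsilon> * N\<close>, so the value is at most an
    average of uncorrupted scores that \<open>tailG\<close> controls.\<close>
  have missed: "w i * p i \<le> w i * g i + \<kappa> * \<Gamma> / (2 * \<epsilon>)" if i: "i \<in> Bad" for i
  proof (cases "0 < w i \<and> 0 < p i \<and> \<not> ?r i \<le> 3 * \<epsilon> * real N")
    case False
    then have "w i * p i \<le> w i * g i"
      using i tw(5)[of i] by (auto simp: g tail_score_def not_less intro: mult_nonneg_nonpos)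
    moreover have "0 \<le> \<kappa> * \<Gamma> / (2 * \<epsilon>)" using \<kappa> eta_pos eps_pos by (simp add: \<Gamma>_def)
    ultimately show ?thesis by linarith
  next
    case True
    let ?h = "\<lambda>j. if p j < p i then 0 else w j"
    define m where "m = (\<Sum>j\<in>G. ?h j)"
    have "(\<Sum>j\<in>Bad. ?h j) \<le> (\<Sum>j\<in>Bad. w j)" using tw(5) by (intro sum_mono) auto
    then have m: "2 * \<epsilon> * real N < m" using True sum_split[of ?h] tw(4) by (simp add: m_def)
    define q where "q = 2 * \<epsilon> * real N / m"
    have mpos: "0 < m" using m eps_pos by (smt (verit) mult_nonneg_nonneg of_nat_0_le_iff)
    have q: "0 \<le> q" "q \<le> 1" "q * m = 2 * \<epsilon> * real N" using m mpos eps_pos by (auto simp: q_def field_simps)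
    have "2 * \<epsilon> * real N * p i = (\<Sum>j\<in>G. q * ?h j * p i)"
      by (simp only: q(3)[symmetric] m_def sum_distrib_left sum_distrib_right)
    also have "\<dots> \<le> (\<Sum>j\<in>G. q * ?h j * p j)"
      using q tw(5) G by (intro sum_mono) (auto simp: not_less intro!: mult_left_mono)
    also have "\<dots> \<le> \<kappa> * real N * \<Gamma>"
    proof -
      have "(\<Sum>j\<in>G. q * ?h j) = 2 * \<epsilon> * real N" by (simp only: q(3)[symmetric] m_def sum_distrib_left)
      then have "\<bar>\<Sum>j\<in>G. q * ?h j * p j\<bar> \<le> \<kappa> * real N * \<Gamma>"
        using q tw(5,6) G eps_pos by (intro tailG) (auto intro: mult_le_one)
      then show ?thesis by linarith
    qed
    finally have "p i \<le> \<kappa> * \<Gamma> / (2 * \<epsilon>)" using eps_pos N_pos by (simp add: field_simps)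
    moreover have "w i * p i \<le> p i" using True tw(6)[of i] i by (intro mult_left_le_one_le) auto
    moreover have "0 \<le> w i * g i" using g0 True by simp
    ultimately show ?thesis by linarith
  qed
  have "(\<Sum>i\<in>Bad. w i * p i) \<le> (\<Sum>i\<in>Bad. w i * g i) + real (card Bad) * (\<kappa> * \<Gamma> / (2 * \<epsilon>))"
    using sum_mono[OF missed, of Bad] by (simp add: sum.distrib)
  also have "real (card Bad) * (\<kappa> * \<Gamma> / (2 * \<epsilon>)) \<le> (\<epsilon> * real N) * (\<kappa> * \<Gamma> / (2 * \<epsilon>))"
    using bad \<kappa> eta_pos eps_pos by (intro mult_right_mono) (auto simp: \<Gamma>_def)
  also have "\<dots> = \<kappa> * real N * \<Gamma> / 2" using eps_pos by simp
  finally have "W * \<kappa>\<^sup>2 - \<kappa> * real N * \<Gamma> - \<kappa> * real N * \<Gamma> / 2 \<le> (\<Sum>i\<in>Bad. w i * g i)"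
    using fullG total sum_split[of "\<lambda>i. w i * p i"] by linarith
  moreover have "\<kappa> * real N * (99 / 100 * \<kappa>) \<le> W * \<kappa>\<^sup>2"
  proof -
    have "99 / 100 * real N \<le> (1 - 2 * \<epsilon>) * real N" using eps_small by (intro mult_right_mono) auto
    then have "99 / 100 * real N * \<kappa>\<^sup>2 \<le> W * \<kappa>\<^sup>2" using tw(3) by (intro mult_right_mono) auto
    then show ?thesis by (simp add: power2_eq_square mult_ac)
  qed
  moreover have "\<kappa> * real N * (99 / 100 * \<kappa>) - \<kappa> * real N * \<Gamma> - \<kappa> * real N * \<Gamma> / 2 - \<kappa> * real N * \<Gamma> =
     \<kappa> * real N * (99 / 100 * \<kappa> - 5 / 2 * \<Gamma>)" by (simp add: algebra_simps)
  \<comment> \<open>The coefficient 5/2 counts \<open>\<Gamma>\<close> once for the uncorrupted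
    scores, one half for the missed ones, and once more so that the corrupted side exceeds the bound
    in \<open>upG\<close>. As \<open>\<eta> < \<kappa> / 10\<close>, the subtracted term is below
    \<open>0.775 * \<kappa>\<close>.\<close>
  moreover have "0 < \<kappa> * real N * (99 / 100 * \<kappa> - 5 / 2 * \<Gamma>)"
    using \<kappa> N_pos large eta_pos by (intro mult_pos_pos) (auto simp: \<Gamma>_def)
  ultimately have *: "\<kappa> * real N * \<Gamma> < (\<Sum>i\<in>Bad. w i * g i)" by linarith
  then show "(\<Sum>i\<in>G. w i * g i) \<le> (\<Sum>i\<in>Bad. w i * g i)" using upG by linarith
  show "\<exists>i<N. 0 < g i"
  proof (rule ccontr)
    assume "\<not> ?thesis"
    then have "g i = 0" if "i \<in> Bad" for i using that g0[of i] by force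
    then have "(\<Sum>i\<in>Bad. w i * g i) = 0" by simp
    moreover have "0 \<le> \<kappa> * real N * \<Gamma>" using \<kappa> eta_pos by (simp add: \<Gamma>_def)
    ultimately show False using * by simp
  qed
qed

end

section \<open>The filter iteration\<close>

lemma filter_score_nonneg: "0 \<le> filter_score d N k \<epsilon> y w i"
  by (simp add: filter_score_def tail_score_def)

lemma filter_score_pos: "0 < filter_score d N k \<epsilon> y w i \<Longrightarrow> 0 < w i"
  by (auto simp: filter_score_def tail_score_def split: if_splits)

text \<open>For the last claim: a maximiser of a somewhere positive score has positive weight, by
  the guard in \<open>tail_score\<close>, and its factor in the update is exactly 0.\<close>

lemma filter_step_props:
  assumes "0 < N" "\<And>i. i < N \<Longrightarrow> 0 \<le> w i"
  shows "i < N \<Longrightarrow> 0 \<le> filter_step d N k \<epsilon> y w i" "i < N \<Longrightarrow> filter_step d N k \<epsilon> y w i \<le> w i"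
    "\<exists>i<N. 0 < filter_score d N k \<epsilon> y w i \<Longrightarrow> 0 < maxval N (filter_score d N k \<epsilon> y w) \<and>
       (\<exists>i<N. 0 < w i \<and> filter_step d N k \<epsilon> y w i = 0)"
proof -
  let ?g = "filter_score d N k \<epsilon> y w"
  obtain m where m: "m < N" "?g m = maxval N ?g" "\<And>l. l < N \<Longrightarrow> ?g l \<le> maxval N ?g"
    using maxval_props[OF assms(1), of ?g] filter_score_nonneg by blast
  have max0: "0 \<le> maxval N ?g" using m(2) filter_score_nonneg by metis
  have q: "0 \<le> ?g i / maxval N ?g" "?g i / maxval N ?g \<le> 1" if "i < N" for i
    using m(3)[OF that] max0 filter_score_nonneg[of d N k \<epsilon> y w i] by (auto intro: divide_nonneg_nonneg simp: divide_le_eq_1)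
  show "0 \<le> filter_step d N k \<epsilon> y w i" if "i < N"
    unfolding filter_step_def using q[OF that] assms(2)[OF that] by simp
  show "filter_step d N k \<epsilon> y w i \<le> w i" if "i < N"
    unfolding filter_step_def using q[OF that] assms(2)[OF that] by (intro mult_left_le) auto
  assume "\<exists>i<N. 0 < ?g i"
  then have "0 < maxval N ?g" using m(3) by (meson less_le_trans)
  moreover have "filter_step d N k \<epsilon> y w m = 0" "0 < w m"
    using m(2) calculation filter_score_pos[of d N k \<epsilon> y w m] by (auto simp: filter_step_def)
  ultimately show "0 < maxval N ?g \<and> (\<exists>i<N. 0 < w i \<and> filter_step d N k \<epsilon> y w i = 0)" using m(1) by blast
qed

lemma weights_simps:
  "weights d N k \<epsilon> y 0 = (\<lambda>_. 1)"
  "weights d N k \<epsilon> y (Suc t) = filter_step d N k \<epsilon> y (weights d N k \<epsilon> y t)"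
  by (simp_all add: weights_def)

lemma weights_bounds:
  assumes "0 < N" "i < N"
  shows "0 \<le> weights d N k \<epsilon> y t i \<and> weights d N k \<epsilon> y t i \<le> 1"
  using assms(2)
proof (induction t arbitrary: i)
  case (Suc t)
  then show ?case
    using filter_step_props(1,2)[of N "weights d N k \<epsilon> y t" i d k \<epsilon> y] assms(1)
    by (simp add: weights_simps) (meson order.trans)
qed (simp add: weights_simps)

context good_sample
begin

abbreviation "wt \<equiv> weights d N k \<epsilon> y"

text \<open>The loop invariant. \<open>filter_progress\<close> preserves it as long as the norm is
  large, and since there are at most \<open>\<epsilon> * N\<close> corrupted indices it implies
  \<open>admissible\<close>.\<close>

definition bad_heavier :: "(nat \<Rightarrow> real) \<Rightarrow> bool" where
  "bad_heavier w \<longleftrightarrow> (\<forall>i<N. 0 \<le> w i \<and> w i \<le> 1) \<and> (\<Sum>i\<in>G. 1 - w i) \<le> (\<Sum>i\<in>Bad. 1 - w i)"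

lemma bad_heavier_admissible:
  assumes "bad_heavier w" shows "admissible w"
proof -
  have "(\<Sum>i\<in>Bad. 1 - w i) \<le> (\<Sum>i\<in>Bad. 1)" using assms by (intro sum_mono) (auto simp: bad_heavier_def)
  then show ?thesis using assms bad sum_split[of "\<lambda>i. 1 - w i"] by (simp add: bad_heavier_def admissible_def)
qed

text \<open>If the norm stayed large for \<open>N\<close> steps, each step would annihilate a
  further weight, so all weights would vanish. That contradicts the invariant, which keeps the
  removed weight below \<open>2 * \<epsilon> * N < N\<close>.\<close>

lemma filter_reaches:
  "\<exists>t<N. admissible (wt t) \<and> sqrt (sqnorm d k (excess_cov N (wt t) y)) \<le> 10 * \<eta>"
proof (rule ccontr)
  assume "\<not> ?thesis"
  then have large: "10 * \<eta> < sqrt (sqnorm d k (excess_cov N (wt t) y))" if "t < N" "admissible (wt t)" for t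
    using that by force
  have "bad_heavier (wt t) \<and> t \<le> card {i. i < N \<and> wt t i = 0}" if "t \<le> N" for t
    using that
  proof (induction t)
    case 0
    then show ?case by (simp add: weights_simps bad_heavier_def)
  next
    case (Suc t)
    define w where "w = wt t"
    define g where "g = filter_score d N k \<epsilon> y w"
    define w' where "w' = filter_step d N k \<epsilon> y w"
    have bh: "bad_heavier w" "t \<le> card {i. i < N \<and> w i = 0}" using Suc by (simp_all add: w_def)
    have w0: "\<And>i. i < N \<Longrightarrow> 0 \<le> w i" "\<And>i. i < N \<Longrightarrow> w i \<le> 1" using bh(1) by (auto simp: bad_heavier_def)
    have "10 * \<eta> < sqrt (sqnorm d k (excess_cov N w y))"
      using large[of t] Suc.prems bad_heavier_admissible[OF bh(1)] by (simp add: w_def)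
    note pr = filter_progress[OF bad_heavier_admissible[OF bh(1)] this, folded g_def]
    note st = filter_step_props[where N = N and w = w, OF N_pos w0(1), where d = d and k = k and \<epsilon> = \<epsilon> and y = y, folded w'_def g_def]
    obtain m where m: "0 < maxval N g" "m < N" "0 < w m" "w' m = 0" using st(3)[OF _ pr(2)] by blast
    have "w' i = w i - w i * g i / maxval N g" for i
      by (simp add: w'_def filter_step_def g_def right_diff_distrib)
    then have "(\<Sum>i\<in>A. 1 - w' i) = (\<Sum>i\<in>A. (1 - w i) + w i * g i / maxval N g)" for A
      by (intro sum.cong) auto
    then have "(\<Sum>i\<in>A. 1 - w' i) = (\<Sum>i\<in>A. 1 - w i) + (\<Sum>i\<in>A. w i * g i) / maxval N g" for A
      by (simp only: sum.distrib sum_divide_distrib)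
    moreover have "w' i \<le> 1" if "i < N" for i by (rule order.trans[OF st(2) w0(2)]) (use that in auto)
    ultimately have "bad_heavier w'"
      using bh(1) pr(1) m(1) st(1,2) w0 unfolding bad_heavier_def
      by (auto intro!: add_mono divide_right_mono)
    moreover have "Suc t \<le> card {i. i < N \<and> w' i = 0}"
    proof -
      \<comment> \<open>The update is multiplicative, so zeros persist and \<open>m\<close> is a new
        one.\<close>
      have "w' i = 0" if "w i = 0" for i using that by (simp add: w'_def filter_step_def)
      then have "insert m {i. i < N \<and> w i = 0} \<subseteq> {i. i < N \<and> w' i = 0}" using m by auto
      then have "card (insert m {i. i < N \<and> w i = 0}) \<le> card {i. i < N \<and> w' i = 0}" by (intro card_mono) auto
      then show ?thesis using m(3) bh(2) by simp
    qed
    ultimately show ?case by (simp add: weights_simps w'_def w_def)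
  qed
  from this[of N] have bh: "bad_heavier (wt N)" and N: "N \<le> card {i. i < N \<and> wt N i = 0}" by auto
  have "{i. i < N \<and> wt N i = 0} = {..<N}" using N by (intro card_subset_eq) (auto intro: order.antisym card_mono[of "{..<N}", simplified])
  then have "(\<Sum>i<N. 1 - wt N i) = (\<Sum>i<N. 1)" by (intro sum.cong) auto
  then have "real N \<le> 2 * \<epsilon> * real N" using bad_heavier_admissible[OF bh] by (simp add: admissible_def)
  then have "1 * real N \<le> (2 * \<epsilon>) * real N" by simp
  then have "1 \<le> 2 * \<epsilon>" using N_pos by (simp only: mult_le_cancel_right_pos of_nat_0_less_iff)
  then show False using eps_small by linarith
qed

text \<open>The best iterate has positive quality, hence is admissible, and its norm is at most that
  of the iterate from \<open>filter_reaches\<close>; thus the bound \<open>10 * \<eta>\<close> holds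
  although the program never compares with \<open>\<eta>\<close>. The constant is
  \<open>28 + 4 * 13 / 4\<close>, using \<open>sqrt 10 \<le> 13 / 4\<close>.\<close>

lemma filter_mean_error:
  assumes "S \<subseteq> {..<d}" "card S \<le> k"
  shows "L2_set (\<lambda>j. filter_mean d N k \<epsilon> y j - \<mu> j) S \<le> 41 * \<xi>"
proof -
  let ?q = "quality d N k \<epsilon> y"
  let ?n = "\<lambda>t. sqnorm d k (excess_cov N (wt t) y)"
  have n0: "0 \<le> ?n t" for t using sqnorm_ge[of "{}" d k "excess_cov N (wt t) y"] by simp
  have adm: "admissible (wt t) \<longleftrightarrow> (\<Sum>i<N. 1 - wt t i) \<le> 2 * \<epsilon> * real N" for t
    unfolding admissible_def using weights_bounds[OF N_pos] by auto
  have q: "?q t = (if admissible (wt t) then 1 / (1 + ?n t) else 0)" for t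
    by (simp add: quality_def Let_def adm)
  obtain t where t: "t < N" "\<And>l. l < N \<Longrightarrow> ?q l \<le> ?q t"
      "\<And>h. (\<Sum>l<N. topmask N 1 ?q l * h l) = h t"
    using topmask_one[OF N_pos, of ?q] by blast
  obtain t0 where t0: "t0 < N" "admissible (wt t0)" "sqrt (?n t0) \<le> 10 * \<eta>" using filter_reaches by blast
  have le: "1 / (1 + ?n t0) \<le> ?q t" using t(2)[OF t0(1)] t0(2) by (simp add: q)
  have "0 < 1 / (1 + ?n t0)" using n0[of t0] by simp
  then have at: "admissible (wt t)" using le by (auto simp: q split: if_splits)
  then have "?n t \<le> ?n t0" using le n0[of t] n0[of t0] by (simp add: q field_simps)
  then have "sqrt (?n t) \<le> 10 * \<eta>" using t0(3) by (meson order.trans real_sqrt_le_mono)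
  then have "err_bound (sqrt (?n t)) \<le> err_bound (10 * \<eta>)"
    using eps_pos by (simp add: err_bound_def)
  also have "\<dots> \<le> 41 * \<xi>"
  proof -
    have "sqrt (\<epsilon> * (10 * \<eta>)) = sqrt 10 * \<xi>" by (simp add: \<xi>_def flip: real_sqrt_mult)
    moreover have "sqrt 10 \<le> 13 / 4" by (intro real_le_lsqrt) (auto simp: power2_eq_square)
    then have "sqrt 10 * \<xi> \<le> 13 / 4 * \<xi>" using xi_nonneg by (intro mult_right_mono) auto
    ultimately show ?thesis by (simp add: err_bound_def)
  qed
  finally have "err_bound (sqrt (?n t)) \<le> 41 * \<xi>" .
  moreover have "filter_mean d N k \<epsilon> y j = wmean N (wt t) y j" for j
    unfolding filter_mean_def by (rule t(3))
  ultimately show ?thesis using certificate[OF at assms] by simp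
qed

lemma estimate_error:
  assumes "2 \<le> d" "card {j. j < d \<and> \<mu> j \<noteq> 0} \<le> k"
  shows "L2_set (\<lambda>j. estimate d N k \<epsilon> y j - \<mu> j) {..<d} \<le> 123 * \<xi>"
proof -
  have "dense_estimate d N k \<epsilon> y = filter_mean d N k \<epsilon> y"
    using assms(1) by (simp add: dense_estimate_def fun_eq_iff)
  then show ?thesis
    using truncation_error[OF assms(2), of "filter_mean d N k \<epsilon> y" "41 * \<xi>"] filter_mean_error
    by (simp add: estimate_def)
qed

end

section \<open>The trimmed mean in dimension one\<close>

lemma card_upper_set:
  fixes f :: "nat \<Rightarrow> real"
  assumes "0 \<le> \<delta>"
  shows "real (card {i. i < N \<and> (\<Sum>j<N. if f j < f i then 0 else 1) \<le> \<delta>}) \<le> \<delta>"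
proof (cases "{i. i < N \<and> (\<Sum>j<N. if f j < f i then 0 else 1) \<le> \<delta>} = {}")
  case False
  let ?L = "{i. i < N \<and> (\<Sum>j<N. if f j < f i then 0 else 1) \<le> \<delta>}"
  have "finite ?L" by simp
  \<comment> \<open>The lowest member \<open>m\<close> has the whole set at or above it, so its own
    count bounds the cardinality.\<close>
  then obtain m where m: "m \<in> ?L" "\<And>i. i \<in> ?L \<Longrightarrow> f m \<le> f i"
    using ex_is_arg_min_if_finite[of ?L f] False by (auto simp: is_arg_min_linorder)
  have "real (card ?L) = (\<Sum>j\<in>?L. 1)" by simp
  also have "\<dots> = (\<Sum>j\<in>?L. if f j < f m then 0 else 1)" using m(2) by (intro sum.cong) (auto simp: not_less)
  also have "\<dots> \<le> (\<Sum>j<N. if f j < f m then 0 else 1)" by (intro sum_mono2) auto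
  finally show ?thesis using m(1) by simp
next
  case True
  show ?thesis unfolding True using assms by simp
qed

text \<open>A kept value at distance \<open>t\<close> from \<open>m\<close> has more than
  \<open>\<epsilon> * N\<close> uncorrupted values at least as far out on its side, so
  \<open>\<epsilon> * t\<^sup>2 \<le> \<eta>\<close>. At most \<open>\<epsilon> * N\<close> kept
  values are corrupted, hence together they shift the sum by at most
  \<open>N * sqrt (\<epsilon> * \<eta>)\<close>. For the uncorrupted values, the missing weights are
  \<open>4 * \<epsilon> * N\<close> for trimming plus \<open>\<epsilon> * N\<close> for corruption,
  which explains the 5 in \<open>tail\<close>.\<close>

lemma trimmed_mean_error:
  fixes x z :: "nat \<Rightarrow> real"
  assumes N: "0 < N" and \<epsilon>: "0 < \<epsilon>" "\<epsilon> \<le> 1 / 8" "\<epsilon> \<le> \<eta>"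
    and G: "G \<subseteq> {..<N}" and bad: "real (card ({..<N} - G)) \<le> \<epsilon> * real N"
    and x: "\<And>i. i \<in> G \<Longrightarrow> x i = m + z i"
    and mean: "\<bar>\<Sum>i<N. z i\<bar> \<le> real N * \<epsilon>"
    and tail: "\<And>c. (\<And>i. i < N \<Longrightarrow> 0 \<le> c i \<and> c i \<le> 1) \<Longrightarrow> (\<Sum>i<N. c i) \<le> 5 * \<epsilon> * real N \<Longrightarrow>
       (\<Sum>i<N. c i * (z i)\<^sup>2) \<le> real N * \<eta>"
  shows "\<bar>(\<Sum>i<N. central N \<epsilon> x i * x i) / (\<Sum>i<N. central N \<epsilon> x i) - m\<bar> \<le> 10 * sqrt (\<epsilon> * \<eta>)"
proof -
  define w where "w = central N \<epsilon> x"
  define W where "W = (\<Sum>i<N. w i)"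
  define \<xi> where "\<xi> = sqrt (\<epsilon> * \<eta>)"
  have w01: "w i = 0 \<or> w i = 1" for i by (simp add: w_def central_def)
  have finG: "finite G" using G finite_subset by blast
  have split: "(\<Sum>i<N. f i) = (\<Sum>i\<in>G. f i) + (\<Sum>i\<in>{..<N} - G. f i)" for f :: "nat \<Rightarrow> real"
    using sum.subset_diff[OF G, of f] by simp
  have "{i. i < N \<and> w i = 0} \<subseteq> {i. i < N \<and> (\<Sum>j<N. if x j < x i then 0 else 1) \<le> 2 * \<epsilon> * real N} \<union>
      {i. i < N \<and> (\<Sum>j<N. if - x j < - x i then 0 else 1) \<le> 2 * \<epsilon> * real N}"
    by (auto simp: w_def central_def)
  then have "card {i. i < N \<and> w i = 0} \<le> card {i. i < N \<and> (\<Sum>j<N. if x j < x i then 0 else 1) \<le> 2 * \<epsilon> * real N} +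
      card {i. i < N \<and> (\<Sum>j<N. if - x j < - x i then 0 else 1) \<le> 2 * \<epsilon> * real N}"
    by (rule order.trans[OF card_mono card_Un_le, rotated]) auto
  then have "real (card {i. i < N \<and> w i = 0}) \<le> real (card {i. i < N \<and> (\<Sum>j<N. if x j < x i then 0 else 1) \<le> 2 * \<epsilon> * real N}) +
      real (card {i. i < N \<and> (\<Sum>j<N. if - x j < - x i then 0 else 1) \<le> 2 * \<epsilon> * real N})"
    by (simp only: of_nat_add[symmetric] of_nat_le_iff)
  also have "\<dots> \<le> 2 * \<epsilon> * real N + 2 * \<epsilon> * real N"
    using \<epsilon> by (intro add_mono card_upper_set) auto
  finally have trimmed: "real (card {i. i < N \<and> w i = 0}) \<le> 4 * \<epsilon> * real N" by simp
  have deficit: "(\<Sum>i<N. 1 - w i) \<le> 4 * \<epsilon> * real N"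
  proof -
    have "(\<Sum>i<N. 1 - w i) = (\<Sum>i<N. if w i = 0 then 1 else 0)" using w01 by (intro sum.cong) auto
    also have "\<dots> = real (card ({..<N} \<inter> {i. w i = 0}))" by (simp add: sum.If_cases)
    also have "{..<N} \<inter> {i. w i = 0} = {i. i < N \<and> w i = 0}" by auto
    finally show ?thesis using trimmed by simp
  qed
  have W: "real N / 2 \<le> W"
  proof -
    have "1 / 2 * real N \<le> (1 - 4 * \<epsilon>) * real N" using \<epsilon> by (intro mult_right_mono) auto
    then show ?thesis using deficit by (simp add: W_def sum_subtractf algebra_simps)
  qed
  then have Wpos: "0 < W" using N by (smt (verit) divide_pos_pos of_nat_0_less_iff)
  have \<xi>: "0 \<le> \<xi>" "\<xi>\<^sup>2 = \<epsilon> * \<eta>" "\<epsilon> \<le> \<xi>"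
  proof -
    show "0 \<le> \<xi>" "\<xi>\<^sup>2 = \<epsilon> * \<eta>" using \<epsilon> by (auto simp: \<xi>_def)
    have "\<epsilon> * \<epsilon> \<le> \<epsilon> * \<eta>" using \<epsilon> by (intro mult_left_mono) auto
    then show "\<epsilon> \<le> \<xi>" unfolding \<xi>_def by (intro real_le_rsqrt) (simp add: power2_eq_square)
  qed
  have good: "\<bar>\<Sum>i\<in>G. w i * z i\<bar> \<le> 4 * real N * \<xi>"
  proof -
    define c where "c i = (if i \<in> G then 1 - w i else 1)" for i
    have c01: "0 \<le> c i \<and> c i \<le> 1" for i using w01[of i] by (auto simp: c_def)
    have "(\<Sum>i<N. c i) = (\<Sum>i\<in>G. 1 - w i) + real (card ({..<N} - G))"
      unfolding split by (simp add: c_def)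
    also have "(\<Sum>i\<in>G. 1 - w i) \<le> (\<Sum>i<N. 1 - w i)"
    proof (rule sum_mono2)
      show "0 \<le> 1 - w b" for b using w01[of b] by auto
    qed (use G in auto)
    finally have c: "(\<Sum>i<N. c i) \<le> 5 * \<epsilon> * real N" using deficit bad by simp
    have "(\<Sum>i<N. c i * z i)\<^sup>2 \<le> (\<Sum>i<N. c i) * (\<Sum>i<N. c i * (z i)\<^sup>2)"
      using c01 by (intro weighted_Cauchy_Schwarz) auto
    also have "\<dots> \<le> (5 * \<epsilon> * real N) * (real N * \<eta>)"
      using c01 c tail[of c] \<epsilon> by (intro mult_mono) (auto intro!: sum_nonneg)
    also have "\<dots> = 5 * (real N)\<^sup>2 * \<xi>\<^sup>2" by (simp only: \<xi>(2)) (simp add: power2_eq_square)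
    also have "\<dots> \<le> (3 * real N * \<xi>)\<^sup>2" by (simp add: power_mult_distrib)
    finally have "\<bar>\<Sum>i<N. c i * z i\<bar> \<le> 3 * real N * \<xi>" using \<xi> by (intro power2_le_iff_abs_le[THEN iffD1]) auto
    moreover have "(\<Sum>i\<in>G. w i * z i) = (\<Sum>i<N. z i) - (\<Sum>i<N. c i * z i)"
      unfolding split by (simp add: c_def sum_subtractf algebra_simps)
    moreover have "real N * \<epsilon> \<le> real N * \<xi>" using \<xi> by (intro mult_left_mono) auto
    ultimately show ?thesis using mean by linarith
  qed
  \<comment> \<open>The sign \<open>s\<close> treats values above and below \<open>m\<close> alike.
    The factor \<open>q\<close> rescales the uncorrupted weight beyond \<open>x i\<close> to exactly
    \<open>\<epsilon> * N\<close>, so that \<open>tail\<close> applies and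
    \<open>\<epsilon> * N\<close> can be divided out.\<close>
  have kept: "s * (x i - m) \<le> sqrt (\<eta> / \<epsilon>)"
    if s: "s = 1 \<or> s = -1" and i: "2 * \<epsilon> * real N < (\<Sum>j<N. if s * x j < s * x i then 0 else 1)" for s i
  proof (cases "0 < s * (x i - m)")
    case True
    let ?t = "s * (x i - m)"
    let ?h = "\<lambda>j. if s * x j < s * x i then 0 else (1::real)"
    define n where "n = (\<Sum>j\<in>G. ?h j)"
    have "(\<Sum>j\<in>{..<N} - G. ?h j) \<le> (\<Sum>j\<in>{..<N} - G. 1)" by (intro sum_mono) auto
    then have n: "\<epsilon> * real N < n" using i split[of ?h] bad by (simp add: n_def)
    define q where "q = \<epsilon> * real N / n"
    have npos: "0 < n" using n \<epsilon> by (smt (verit) mult_nonneg_nonneg of_nat_0_le_iff)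
    have q: "0 \<le> q" "q \<le> 1" "q * n = \<epsilon> * real N" using n npos \<epsilon> by (auto simp: q_def field_simps)
    let ?c = "\<lambda>j. if j \<in> G then q * ?h j else 0"
    have ext: "(\<Sum>j<N. ?c j * f j) = (\<Sum>j\<in>G. q * ?h j * f j)" for f unfolding split by simp
    have "\<epsilon> * real N * ?t\<^sup>2 = (\<Sum>j\<in>G. q * ?h j * ?t\<^sup>2)"
      by (simp only: q(3)[symmetric] n_def sum_distrib_left sum_distrib_right)
    also have "\<dots> \<le> (\<Sum>j\<in>G. q * ?h j * (z j)\<^sup>2)"
    proof (rule sum_mono)
      fix j assume "j \<in> G"
      then have xj: "x j = m + z j" by (rule x)
      show "q * ?h j * ?t\<^sup>2 \<le> q * ?h j * (z j)\<^sup>2"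
      proof (cases "s * x j < s * x i")
        case False
        then have "?t \<le> s * z j" by (simp add: xj algebra_simps)
        then have "?t\<^sup>2 \<le> (s * z j)\<^sup>2" using True by (intro power_mono) auto
        moreover have "(s * z j)\<^sup>2 = (z j)\<^sup>2" using s by auto
        ultimately show ?thesis using q by (intro mult_left_mono) auto
      qed simp
    qed
    also have "\<dots> \<le> real N * \<eta>"
    proof -
      have "(\<Sum>j<N. ?c j) = \<epsilon> * real N"
        using ext[of "\<lambda>_. 1"] by (simp add: q(3)[symmetric] n_def sum_distrib_left)
      then have "(\<Sum>j<N. ?c j * (z j)\<^sup>2) \<le> real N * \<eta>" using q \<epsilon> by (intro tail) auto
      then show ?thesis unfolding ext .
    qed
    finally have "?t\<^sup>2 \<le> \<eta> / \<epsilon>" using \<epsilon> N by (simp add: field_simps)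
    then show ?thesis by (rule real_le_rsqrt)
  next
    case False
    moreover have "0 \<le> sqrt (\<eta> / \<epsilon>)" using \<epsilon> by simp
    ultimately show ?thesis by linarith
  qed
  have bad_dev: "\<bar>w i * (x i - m)\<bar> \<le> sqrt (\<eta> / \<epsilon>)" for i
  proof (cases "w i = 0")
    case False
    then have "w i = 1" and "2 * \<epsilon> * real N < (\<Sum>j<N. if x j < x i then 0 else 1)"
       "2 * \<epsilon> * real N < (\<Sum>j<N. if x i < x j then 0 else 1)"
      by (auto simp: w_def central_def split: if_splits)
    then show ?thesis using kept[of 1 i] kept[of "-1" i] by (simp add: abs_le_iff)
  qed (use \<epsilon> in simp)
  have "\<bar>\<Sum>i\<in>{..<N} - G. w i * (x i - m)\<bar> \<le> (\<Sum>i\<in>{..<N} - G. sqrt (\<eta> / \<epsilon>))"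
    by (rule order.trans[OF sum_abs sum_mono[OF bad_dev]])
  also have "\<dots> = real (card ({..<N} - G)) * sqrt (\<eta> / \<epsilon>)" by simp
  also have "\<dots> \<le> \<epsilon> * real N * sqrt (\<eta> / \<epsilon>)" using \<epsilon> by (intro mult_right_mono bad) auto
  also have "\<dots> = real N * \<xi>"
  proof -
    have "\<epsilon> * sqrt (\<eta> / \<epsilon>) = sqrt (\<epsilon>\<^sup>2 * (\<eta> / \<epsilon>))" using \<epsilon> by (simp only: real_sqrt_mult real_sqrt_power[symmetric]) simp
    also have "\<epsilon>\<^sup>2 * (\<eta> / \<epsilon>) = \<epsilon> * \<eta>" using \<epsilon> by (simp add: power2_eq_square)
    finally show ?thesis by (simp add: \<xi>_def mult_ac)
  qed
  finally have bd: "\<bar>\<Sum>i\<in>{..<N} - G. w i * (x i - m)\<bar> \<le> real N * \<xi>" .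
  have "(\<Sum>i<N. w i * x i) - W * m = (\<Sum>i<N. w i * (x i - m))"
    by (simp add: W_def right_diff_distrib sum_subtractf sum_distrib_right)
  also have "\<dots> = (\<Sum>i\<in>G. w i * z i) + (\<Sum>i\<in>{..<N} - G. w i * (x i - m))"
    unfolding split by (simp add: x)
  finally have "\<bar>(\<Sum>i<N. w i * x i) - W * m\<bar> \<le> 5 * (real N * \<xi>)" using good bd by linarith
  also have "\<dots> \<le> 10 * (W * \<xi>)" using mult_right_mono[OF W \<xi>(1)] by (simp add: mult_ac)
  finally have "\<bar>W * ((\<Sum>i<N. w i * x i) / W - m)\<bar> \<le> W * (10 * \<xi>)"
    using Wpos by (simp add: right_diff_distrib mult_ac)
  then have "W * \<bar>(\<Sum>i<N. w i * x i) / W - m\<bar> \<le> W * (10 * \<xi>)" using Wpos by (simp add: abs_mult)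
  then have "\<bar>(\<Sum>i<N. w i * x i) / W - m\<bar> \<le> 10 * \<xi>" using Wpos by (simp only: mult_le_cancel_left_pos)
  then show ?thesis by (simp add: w_def W_def \<xi>_def)
qed

section \<open>Exponential moments of quadratic forms in Gaussian variables\<close>

definition unit_normal :: "real \<Rightarrow> real measure" where
  "unit_normal m = density lborel (\<lambda>x. ennreal (normal_density m 1 x))"

lemma gaussian_eq: "gaussian d \<mu> = PiM {..<d} (\<lambda>j. unit_normal (\<mu> j))"
  by (simp add: gaussian_def unit_normal_def)

lemma prob_space_unit_normal: "prob_space (unit_normal m)"
  unfolding unit_normal_def by (rule prob_space_normal_density) simp

lemma sets_unit_normal [measurable_cong, simp]: "sets (unit_normal m) = sets borel"
  by (simp add: unit_normal_def)

lemma space_unit_normal [simp]: "space (unit_normal m) = UNIV"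
  by (simp add: unit_normal_def)

lemma nn_integral_normal_density:
  assumes "0 < \<sigma>" shows "(\<integral>\<^sup>+ x. ennreal (normal_density m \<sigma> x) \<partial>lborel) = 1"
  using prob_space.emeasure_space_1[OF prob_space_normal_density[OF assms, of m]]
  by (simp add: emeasure_density)

text \<open>Completing the square: with \<open>\<kappa> = 1 / (1 - 2 * a)\<close>, the integrand
  times the density is a constant multiple of the normal density with mean
  \<open>m + t * \<kappa>\<close> and variance \<open>\<kappa>\<close>.\<close>

lemma unit_normal_exp_quadratic:
  assumes "a < 1 / 2"
  shows "(\<integral>\<^sup>+ x. ennreal (exp (a * (x - m)\<^sup>2 + t * (x - m))) \<partial>unit_normal m) =
    ennreal (exp (t\<^sup>2 / (2 * (1 - 2 * a)) - ln (1 - 2 * a) / 2))"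
proof -
  define \<kappa> where "\<kappa> = 1 / (1 - 2 * a)"
  have \<kappa>: "0 < \<kappa>" and a: "1 - 2 * a = 1 / \<kappa>" "a = 1 / 2 - 1 / (2 * \<kappa>)" using assms by (auto simp: \<kappa>_def field_simps)
  let ?C = "exp (t\<^sup>2 * \<kappa> / 2 + ln \<kappa> / 2)"
  have "normal_density m 1 x * exp (a * (x - m)\<^sup>2 + t * (x - m)) = ?C * normal_density (m + t * \<kappa>) (sqrt \<kappa>) x" for x
  proof -
    have "- ((x - m)\<^sup>2 / 2) + (a * (x - m)\<^sup>2 + t * (x - m)) = t\<^sup>2 * \<kappa> / 2 - (x - (m + t * \<kappa>))\<^sup>2 / (2 * \<kappa>)"
      using \<kappa> unfolding a(2) by (simp add: field_simps power2_eq_square)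
    then have e1: "exp (- ((x - m)\<^sup>2 / 2)) * exp (a * (x - m)\<^sup>2 + t * (x - m)) =
        exp (t\<^sup>2 * \<kappa> / 2) * exp (- (x - (m + t * \<kappa>))\<^sup>2 / (2 * \<kappa>))"
      by (simp flip: exp_add)
    have e2: "exp (ln \<kappa> / 2) / sqrt (2 * pi * \<kappa>) = 1 / sqrt (2 * pi)"
    proof -
      have "exp (ln \<kappa> / 2) = sqrt \<kappa>" using \<kappa> by (simp add: ln_sqrt[symmetric])
      then show ?thesis using \<kappa> by (simp add: real_sqrt_mult)
    qed
    have nd: "normal_density m 1 x = 1 / sqrt (2 * pi) * exp (- ((x - m)\<^sup>2 / 2))"
      "normal_density (m + t * \<kappa>) (sqrt \<kappa>) x = 1 / sqrt (2 * pi * \<kappa>) * exp (- (x - (m + t * \<kappa>))\<^sup>2 / (2 * \<kappa>))"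
      using \<kappa> by (simp_all add: normal_density_def)
    have alg: "(1 / D1 * E1) * Q = (K * L) * (1 / D2 * E2)" if "E1 * Q = K * E2" "L / D2 = 1 / D1" for D1 D2 E1 E2 K L Q :: real
    proof -
      have "(1 / D1 * E1) * Q = (1 / D1) * (E1 * Q)" by simp
      also have "\<dots> = (L / D2) * (K * E2)" unfolding that ..
      finally show ?thesis by simp
    qed
    show ?thesis unfolding nd exp_add[of "t\<^sup>2 * \<kappa> / 2" "ln \<kappa> / 2"] by (rule alg[OF e1 e2])
  qed
  then have "(\<integral>\<^sup>+ x. ennreal (exp (a * (x - m)\<^sup>2 + t * (x - m))) \<partial>unit_normal m) =
      (\<integral>\<^sup>+ x. ennreal ?C * ennreal (normal_density (m + t * \<kappa>) (sqrt \<kappa>) x) \<partial>lborel)"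
    unfolding unit_normal_def by (subst nn_integral_density) (auto simp flip: ennreal_mult)
  also have "\<dots> = ennreal ?C" using \<kappa> by (simp add: nn_integral_cmult nn_integral_normal_density)
  also have "?C = exp (t\<^sup>2 / (2 * (1 - 2 * a)) - ln (1 - 2 * a) / 2)"
    unfolding a(1) using \<kappa> by (simp add: ln_div)
  finally show ?thesis .
qed

interpretation unit_normals: product_sigma_finite "\<lambda>j. unit_normal (\<mu> j)" for \<mu> :: "nat \<Rightarrow> real"
  by (intro product_sigma_finite.intro prob_space_imp_sigma_finite prob_space_unit_normal)

text \<open>
  Integrating out one coordinate adds a rank-one term to the matrix of the remaining quadratic form.
  For small matrices this does not increase the Frobenius norm, and the drift of the trace is paid for by the
  removed row and column.
\<close>

lemma schur_step:
  fixes A :: "nat \<Rightarrow> nat \<Rightarrow> real"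
  assumes I: "finite I" "n \<notin> I"
    and small: "(\<Sum>a\<in>insert n I. \<Sum>b\<in>insert n I. (A a b)\<^sup>2) \<le> 1 / 64"
  defines "s \<equiv> \<lambda>a. A a n + A n a"
  defines "\<kappa> \<equiv> 1 / (1 - 2 * A n n)"
  defines "B \<equiv> \<lambda>a b. A a b + \<kappa> / 2 * (s a * s b)"
  shows "A n n < 1 / 2" "(\<Sum>a\<in>I. \<Sum>b\<in>I. (B a b)\<^sup>2) \<le> 1 / 64"
    "4 * (\<Sum>a\<in>I. \<Sum>b\<in>I. (B a b)\<^sup>2) + \<kappa> / 2 * (\<Sum>a\<in>I. (s a)\<^sup>2) - A n n - ln (1 - 2 * A n n) / 2
      \<le> 4 * (\<Sum>a\<in>insert n I. \<Sum>b\<in>insert n I. (A a b)\<^sup>2)"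
proof -
  define \<alpha> where "\<alpha> = A n n"
  define \<rho> where "\<rho> = (\<Sum>a\<in>I. (A a n)\<^sup>2 + (A n a)\<^sup>2)"
  define F where "F = (\<Sum>a\<in>I. \<Sum>b\<in>I. (A a b)\<^sup>2)"
  define \<sigma> where "\<sigma> = (\<Sum>a\<in>I. (s a)\<^sup>2)"
  have full: "(\<Sum>a\<in>insert n I. \<Sum>b\<in>insert n I. (A a b)\<^sup>2) = F + \<rho> + \<alpha>\<^sup>2"
    using I by (simp add: F_def \<rho>_def \<alpha>_def sum.distrib)
  have nonneg: "0 \<le> F" "0 \<le> \<rho>" "0 \<le> \<sigma>" by (auto simp: F_def \<rho>_def \<sigma>_def intro!: sum_nonneg)
  have le: "F + \<rho> + \<alpha>\<^sup>2 \<le> 1 / 64" using small full by simp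
  then have "\<alpha>\<^sup>2 \<le> 1 / 64" "F \<le> 1 / 64" "\<rho> \<le> 1 / 64" using nonneg zero_le_power2[of \<alpha>] by linarith+
  then have "\<alpha>\<^sup>2 \<le> (1 / 8)\<^sup>2" "F \<le> (1 / 8)\<^sup>2" by (simp_all add: power2_eq_square)
  then have \<alpha>: "\<bar>\<alpha>\<bar> \<le> 1 / 8" and F: "sqrt F \<le> 1 / 8"
    using abs_le_square_iff[of \<alpha> "1 / 8"] real_sqrt_le_mono[of F "(1 / 8)\<^sup>2"] by simp_all
  show "A n n < 1 / 2" using \<alpha> by (simp add: \<alpha>_def abs_le_iff)
  have \<kappa>: "0 < \<kappa>" "\<kappa> \<le> 4 / 3" using \<alpha> by (auto simp: \<kappa>_def \<alpha>_def[symmetric] abs_le_iff field_simps)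
  have \<sigma>\<rho>: "\<sigma> \<le> 2 * \<rho>"
    unfolding \<sigma>_def \<rho>_def sum_distrib_left
  proof (rule sum_mono)
    fix a show "(s a)\<^sup>2 \<le> 2 * ((A a n)\<^sup>2 + (A n a)\<^sup>2)"
      using sum_squares_bound[of "A a n" "A n a"] by (simp add: s_def power2_sum)
  qed
  have ss: "(\<Sum>a\<in>I. \<Sum>b\<in>I. (s a * s b)\<^sup>2) = \<sigma>\<^sup>2"
    by (simp add: \<sigma>_def power_mult_distrib power2_eq_square[of "sum _ _"] sum_product)
  have sAs: "(\<Sum>a\<in>I. \<Sum>b\<in>I. A a b * (s a * s b)) \<le> \<sigma> / 8"
  proof -
    have "(\<Sum>a\<in>I. \<Sum>b\<in>I. A a b * (s a * s b))\<^sup>2 \<le> F * \<sigma>\<^sup>2"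
      using Cauchy_Schwarz_ineq_sum[of "\<lambda>x. A (fst x) (snd x)" "\<lambda>x. s (fst x) * s (snd x)" "I \<times> I"]
      unfolding ss[symmetric] F_def by (simp add: sum.cartesian_product case_prod_beta)
    then have "(\<Sum>a\<in>I. \<Sum>b\<in>I. A a b * (s a * s b)) \<le> sqrt (F * \<sigma>\<^sup>2)" by (rule real_le_rsqrt)
    also have "\<dots> = sqrt F * \<sigma>" using nonneg by (simp add: real_sqrt_mult)
    also have "\<dots> \<le> 1 / 8 * \<sigma>" using F nonneg by (intro mult_right_mono)
    finally show ?thesis by simp
  qed
  have "(\<Sum>a\<in>I. \<Sum>b\<in>I. (B a b)\<^sup>2) = F + \<kappa> * (\<Sum>a\<in>I. \<Sum>b\<in>I. A a b * (s a * s b)) + \<kappa>\<^sup>2 / 4 * \<sigma>\<^sup>2"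
    unfolding ss[symmetric] F_def B_def
    by (simp add: sum_distrib_left sum.distrib[symmetric] power2_eq_square algebra_simps)
  also have "\<dots> \<le> F + 4 / 3 * (\<sigma> / 8) + (4 / 3)\<^sup>2 / 4 * (\<sigma> / 32)"
  proof (intro add_mono order.refl)
    have "\<kappa> * (\<Sum>a\<in>I. \<Sum>b\<in>I. A a b * (s a * s b)) \<le> \<kappa> * (\<sigma> / 8)" using sAs \<kappa> by (intro mult_left_mono) auto
    also have "\<dots> \<le> 4 / 3 * (\<sigma> / 8)" using \<kappa> nonneg by (intro mult_right_mono) auto
    finally show "\<kappa> * (\<Sum>a\<in>I. \<Sum>b\<in>I. A a b * (s a * s b)) \<le> 4 / 3 * (\<sigma> / 8)" .
    have "\<sigma> * \<sigma> \<le> \<sigma> * (1 / 32)" using \<sigma>\<rho> \<open>\<rho> \<le> 1 / 64\<close> nonneg by (intro mult_left_mono) auto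
    then show "\<kappa>\<^sup>2 / 4 * \<sigma>\<^sup>2 \<le> (4 / 3)\<^sup>2 / 4 * (\<sigma> / 32)"
      using \<kappa> nonneg by (intro mult_mono divide_right_mono power_mono) (auto simp: power2_eq_square)
  qed
  \<comment> \<open>\<open>4 / 3 * 1 / 8 + 16 / 9 * 1 / 4 * 1 / 32 = 13 / 72\<close>. Since
    \<open>\<sigma> \<le> 2 * \<rho>\<close>, this growth is below the mass \<open>\<rho>\<close> of
    the removed row and column, and \<open>2 * (4 * 13 / 72 + 2 / 3) \<le> 4\<close> gives the bound
    on the exponent.\<close>
  finally have FB: "(\<Sum>a\<in>I. \<Sum>b\<in>I. (B a b)\<^sup>2) \<le> F + 13 / 72 * \<sigma>" by (simp add: power2_eq_square)
  then show "(\<Sum>a\<in>I. \<Sum>b\<in>I. (B a b)\<^sup>2) \<le> 1 / 64"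
    using \<sigma>\<rho> le nonneg zero_le_power2[of \<alpha>] by linarith
  have "\<bar>ln (1 + (- 2 * \<alpha>)) - (- 2 * \<alpha>)\<bar> \<le> 2 * (- 2 * \<alpha>)\<^sup>2"
    using \<alpha> by (intro abs_ln_one_plus_x_minus_x_bound) (auto simp: abs_mult)
  then have "- \<alpha> - ln (1 - 2 * \<alpha>) / 2 \<le> 4 * \<alpha>\<^sup>2" by (simp add: power_mult_distrib abs_le_iff)
  moreover have "\<kappa> / 2 * \<sigma> \<le> 2 / 3 * \<sigma>" using \<kappa> nonneg by (intro mult_right_mono) auto
  ultimately show "4 * (\<Sum>a\<in>I. \<Sum>b\<in>I. (B a b)\<^sup>2) + \<kappa> / 2 * (\<Sum>a\<in>I. (s a)\<^sup>2) - A n n - ln (1 - 2 * A n n) / 2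
      \<le> 4 * (\<Sum>a\<in>insert n I. \<Sum>b\<in>insert n I. (A a b)\<^sup>2)"
    unfolding full using FB \<sigma>\<rho> nonneg by (simp add: \<sigma>_def[symmetric] \<alpha>_def[symmetric])
qed

text \<open>Induction on the coordinates takes the place of diagonalisation. The product formula
  isolates coordinate \<open>n\<close>, the one-dimensional integral removes it, and
  \<open>schur_step\<close> shows that the remaining form \<open>B\<close> satisfies the same
  smallness condition and that the exponents add up within the claimed bound.\<close>

lemma exp_quadratic_form:
  fixes A :: "nat \<Rightarrow> nat \<Rightarrow> real" and \<mu> :: "nat \<Rightarrow> real"
  assumes "finite I" "(\<Sum>a\<in>I. \<Sum>b\<in>I. (A a b)\<^sup>2) \<le> 1 / 64"
  shows "(\<integral>\<^sup>+ x. ennreal (exp ((\<Sum>a\<in>I. \<Sum>b\<in>I. A a b * ((x a - \<mu> a) * (x b - \<mu> b))) - (\<Sum>a\<in>I. A a a)))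
      \<partial>PiM I (\<lambda>j. unit_normal (\<mu> j))) \<le> ennreal (exp (4 * (\<Sum>a\<in>I. \<Sum>b\<in>I. (A a b)\<^sup>2)))"
  using assms
proof (induction I arbitrary: A rule: finite_induct)
  case empty
  then show ?case
    using prob_space.emeasure_space_1[OF prob_space_PiM[of "{}" "\<lambda>j. unit_normal (\<mu> j)"]] prob_space_unit_normal by simp
next
  case (insert n I)
  define s where "s a = A a n + A n a" for a
  define \<kappa> where "\<kappa> = 1 / (1 - 2 * A n n)"
  define B where "B a b = A a b + \<kappa> / 2 * (s a * s b)" for a b
  note schur = schur_step[OF insert.hyps insert.prems, folded s_def \<kappa>_def, folded B_def]
  let ?M = "PiM I (\<lambda>j. unit_normal (\<mu> j))"
  let ?Q = "\<lambda>A x. (\<Sum>a\<in>I. \<Sum>b\<in>I. A a b * ((x a - \<mu> a) * (x b - \<mu> b)))"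
  let ?l = "\<lambda>x. \<Sum>a\<in>I. s a * (x a - \<mu> a)"
  let ?c = "\<kappa> / 2 * (\<Sum>a\<in>I. (s a)\<^sup>2) - A n n - ln (1 - 2 * A n n) / 2"
  have split: "(\<Sum>a\<in>insert n I. \<Sum>b\<in>insert n I. A a b * (((x(n := t)) a - \<mu> a) * ((x(n := t)) b - \<mu> b))) - (\<Sum>a\<in>insert n I. A a a)
     = (?Q A x - (\<Sum>a\<in>I. A a a) - A n n) + (A n n * (t - \<mu> n)\<^sup>2 + ?l x * (t - \<mu> n))" for x t
  proof -
    have ne: "(x(n := t)) a = x a" if "a \<in> I" for a using that insert.hyps by auto
    have "(\<Sum>a\<in>insert n I. \<Sum>b\<in>insert n I. A a b * (((x(n := t)) a - \<mu> a) * ((x(n := t)) b - \<mu> b))) =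
      A n n * ((t - \<mu> n) * (t - \<mu> n)) + (\<Sum>b\<in>I. A n b * ((t - \<mu> n) * (x b - \<mu> b))) +
      (\<Sum>a\<in>I. A a n * ((x a - \<mu> a) * (t - \<mu> n)) + (\<Sum>b\<in>I. A a b * ((x a - \<mu> a) * (x b - \<mu> b))))"
      using insert.hyps ne by (simp cong: sum.cong)
    also have "\<dots> = A n n * (t - \<mu> n)\<^sup>2 + ?l x * (t - \<mu> n) + ?Q A x"
    proof -
      have "(\<Sum>b\<in>I. A n b * ((t - \<mu> n) * (x b - \<mu> b))) + (\<Sum>a\<in>I. A a n * ((x a - \<mu> a) * (t - \<mu> n))) = ?l x * (t - \<mu> n)"
        unfolding sum.distrib[symmetric] sum_distrib_right
        by (intro sum.cong refl) (simp add: s_def algebra_simps)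
      then show ?thesis by (simp only: sum.distrib power2_eq_square)
    qed
    finally show ?thesis using insert.hyps by simp
  qed
  have lsq: "?l x * ?l x * (\<kappa> / 2) = ?Q (\<lambda>a b. \<kappa> / 2 * (s a * s b)) x" for x
    by (simp add: sum_product sum_distrib_left sum_distrib_right mult_ac)
  have inner: "(\<integral>\<^sup>+ t. ennreal (exp ((?Q A x - (\<Sum>a\<in>I. A a a) - A n n) + (A n n * (t - \<mu> n)\<^sup>2 + ?l x * (t - \<mu> n)))) \<partial>unit_normal (\<mu> n)) =
     ennreal (exp ?c) * ennreal (exp (?Q B x - (\<Sum>a\<in>I. B a a)))" for x
  proof -
    have "(\<integral>\<^sup>+ t. ennreal (exp ((?Q A x - (\<Sum>a\<in>I. A a a) - A n n) + (A n n * (t - \<mu> n)\<^sup>2 + ?l x * (t - \<mu> n)))) \<partial>unit_normal (\<mu> n)) =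
      (\<integral>\<^sup>+ t. ennreal (exp (?Q A x - (\<Sum>a\<in>I. A a a) - A n n)) * ennreal (exp (A n n * (t - \<mu> n)\<^sup>2 + ?l x * (t - \<mu> n))) \<partial>unit_normal (\<mu> n))"
      by (simp add: exp_add ennreal_mult)
    also have "\<dots> = ennreal (exp (?Q A x - (\<Sum>a\<in>I. A a a) - A n n)) * ennreal (exp ((?l x)\<^sup>2 / (2 * (1 - 2 * A n n)) - ln (1 - 2 * A n n) / 2))"
      by (subst nn_integral_cmult) (use schur(1) in \<open>simp_all add: unit_normal_exp_quadratic\<close>)
    also have "\<dots> = ennreal (exp ?c) * ennreal (exp (?Q B x - (\<Sum>a\<in>I. B a a)))"
    proof -
      have "(?l x)\<^sup>2 / (2 * (1 - 2 * A n n)) = ?l x * ?l x * (\<kappa> / 2)" by (simp add: \<kappa>_def power2_eq_square)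
      moreover have "?Q B x = ?Q A x + ?Q (\<lambda>a b. \<kappa> / 2 * (s a * s b)) x"
        by (simp only: B_def distrib_right sum.distrib)
      moreover have "(\<Sum>a\<in>I. B a a) = (\<Sum>a\<in>I. A a a) + \<kappa> / 2 * (\<Sum>a\<in>I. (s a)\<^sup>2)"
        by (simp add: B_def sum.distrib sum_distrib_left power2_eq_square)
      ultimately have e: "?Q A x - (\<Sum>a\<in>I. A a a) - A n n + ((?l x)\<^sup>2 / (2 * (1 - 2 * A n n)) - ln (1 - 2 * A n n) / 2) =
         ?c + (?Q B x - (\<Sum>a\<in>I. B a a))"
        using lsq[of x] by linarith
      show ?thesis by (simp only: ennreal_mult[symmetric] exp_ge_zero exp_add[symmetric] e)
    qed
    finally show ?thesis .
  qed
  have "(\<integral>\<^sup>+ x. ennreal (exp ((\<Sum>a\<in>insert n I. \<Sum>b\<in>insert n I. A a b * ((x a - \<mu> a) * (x b - \<mu> b))) - (\<Sum>a\<in>insert n I. A a a)))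
      \<partial>PiM (insert n I) (\<lambda>j. unit_normal (\<mu> j))) =
      (\<integral>\<^sup>+ x. ennreal (exp ?c) * ennreal (exp (?Q B x - (\<Sum>a\<in>I. B a a))) \<partial>?M)"
    by (subst unit_normals.product_nn_integral_insert[OF insert.hyps]) (measurable, simp only: split inner)
  also have "\<dots> = ennreal (exp ?c) * (\<integral>\<^sup>+ x. ennreal (exp (?Q B x - (\<Sum>a\<in>I. B a a))) \<partial>?M)"
    by (rule nn_integral_cmult) measurable
  also have "\<dots> \<le> ennreal (exp ?c) * ennreal (exp (4 * (\<Sum>a\<in>I. \<Sum>b\<in>I. (B a b)\<^sup>2)))"
    by (intro mult_left_mono insert.IH schur(2)) simp
  also have "\<dots> = ennreal (exp (?c + 4 * (\<Sum>a\<in>I. \<Sum>b\<in>I. (B a b)\<^sup>2)))"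
    by (simp only: ennreal_mult[symmetric] exp_ge_zero exp_add)
  also have "\<dots> \<le> ennreal (exp (4 * (\<Sum>a\<in>insert n I. \<Sum>b\<in>insert n I. (A a b)\<^sup>2)))"
    using schur(3) by (intro ennreal_leI) (simp only: exp_le_cancel_iff)
  finally show ?case .
qed

lemma gaussian_exp_quadratic:
  assumes "(\<Sum>a<d. \<Sum>b<d. (A a b)\<^sup>2) \<le> 1 / 64"
  shows "(\<integral>\<^sup>+ x. ennreal (exp (\<Sum>a<d. \<Sum>b<d. A a b * ((x a - \<mu> a) * (x b - \<mu> b) - (if a = b then 1 else 0)))) \<partial>gaussian d \<mu>)
    \<le> ennreal (exp (4 * (\<Sum>a<d. \<Sum>b<d. (A a b)\<^sup>2)))"
proof -
  have "(\<Sum>a<d. \<Sum>b<d. A a b * ((x a - \<mu> a) * (x b - \<mu> b) - (if a = b then 1 else 0))) =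
    (\<Sum>a<d. \<Sum>b<d. A a b * ((x a - \<mu> a) * (x b - \<mu> b))) - (\<Sum>a<d. A a a)" for x
    by (simp add: right_diff_distrib sum_subtractf if_distrib[of "(*) _"] cong: if_cong)
  then show ?thesis using exp_quadratic_form[OF _ assms, of \<mu>] by (simp add: gaussian_eq)
qed

lemma gaussian_coordinate:
  assumes "j < d" and [measurable]: "f \<in> borel_measurable borel"
  shows "(\<integral>\<^sup>+ x. f (x j) \<partial>gaussian d \<mu>) = (\<integral>\<^sup>+ t. f t \<partial>unit_normal (\<mu> j))"
proof -
  have "(\<integral>\<^sup>+ x. f (x j) \<partial>gaussian d \<mu>) = (\<integral>\<^sup>+ x. (\<Prod>i<d. (if i = j then f else (\<lambda>_. 1)) (x i)) \<partial>gaussian d \<mu>)"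
  proof (rule nn_integral_cong)
    fix x
    have "(\<Prod>i<d. (if i = j then f else (\<lambda>_. 1)) (x i)) = (\<Prod>i<d. if i = j then f (x i) else 1)"
      by (intro prod.cong) auto
    then show "f (x j) = (\<Prod>i<d. (if i = j then f else (\<lambda>_. 1)) (x i))"
      using assms(1) by simp
  qed
  also have "\<dots> = (\<Prod>i<d. integral\<^sup>N (unit_normal (\<mu> i)) (if i = j then f else (\<lambda>_. 1)))"
    unfolding gaussian_eq by (rule unit_normals.product_nn_integral_prod) auto
  also have "\<dots> = (\<Prod>i<d. if i = j then (\<integral>\<^sup>+ t. f t \<partial>unit_normal (\<mu> i)) else 1)"
  proof (rule prod.cong[OF refl])
    fix i
    show "integral\<^sup>N (unit_normal (\<mu> i)) (if i = j then f else (\<lambda>_. 1)) = (if i = j then (\<integral>\<^sup>+ t. f t \<partial>unit_normal (\<mu> i)) else 1)"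
      using prob_space.emeasure_space_1[OF prob_space_unit_normal, of "\<mu> i"] by simp
  qed
  finally show ?thesis using assms(1) by simp
qed

section \<open>Concentration of the Gaussian sample\<close>

lemma prob_space_gaussian: "prob_space (gaussian d \<mu>)"
  unfolding gaussian_eq by (intro prob_space_PiM prob_space_unit_normal)

lemma prob_space_samples: "prob_space (gaussian_samples N d \<mu>)"
  unfolding gaussian_samples_def by (intro prob_space_PiM prob_space_gaussian)

interpretation gaussians: product_sigma_finite "\<lambda>_ :: nat. gaussian d \<mu>" for d \<mu>
  by (intro product_sigma_finite.intro prob_space_imp_sigma_finite prob_space_gaussian)

lemma measurable_gaussian_coordinate [measurable]:
  "j < d \<Longrightarrow> (\<lambda>x. x j) \<in> borel_measurable (gaussian d \<mu>)"
  unfolding gaussian_eq by simp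

lemma measurable_sample [measurable]:
  "i < N \<Longrightarrow> (\<lambda>X. X i) \<in> gaussian_samples N d \<mu> \<rightarrow>\<^sub>M gaussian d \<mu>"
  unfolding gaussian_samples_def by simp

text \<open>Markov's inequality for the exponential of the sum, which factorises over the
  independent points. With nonnegative integrals no integrability has to be established.\<close>

lemma chernoff_samples:
  fixes f :: "(nat \<Rightarrow> real) \<Rightarrow> real" and N :: nat
  assumes f [measurable]: "f \<in> borel_measurable (gaussian d \<mu>)"
    and mgf: "(\<integral>\<^sup>+ x. ennreal (exp (f x)) \<partial>gaussian d \<mu>) \<le> ennreal (exp c)"
  defines "P \<equiv> gaussian_samples N d \<mu>"
  shows "{X \<in> space P. T \<le> (\<Sum>i<N. f (X i))} \<in> sets P"
    "measure P {X \<in> space P. T \<le> (\<Sum>i<N. f (X i))} \<le> exp (real N * c - T)"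
proof -
  interpret P: prob_space P unfolding P_def by (rule prob_space_samples)
  have [measurable]: "(\<lambda>X. f (X i)) \<in> borel_measurable P" if "i < N" for i
    using that unfolding P_def by measurable
  let ?S = "\<lambda>X. \<Sum>i<N. f (X i)"
  show "{X \<in> space P. T \<le> ?S X} \<in> sets P" by measurable
  have "1 \<le> ennreal (exp (- T)) * ennreal (exp (?S X)) \<longleftrightarrow> T \<le> ?S X" for X
    by (simp flip: ennreal_mult exp_add)
  then have "emeasure P {X \<in> space P. T \<le> ?S X} = emeasure P {X \<in> space P. 1 \<le> ennreal (exp (- T)) * ennreal (exp (?S X))}"
    by simp
  also have "\<dots> \<le> ennreal (exp (- T)) * (\<integral>\<^sup>+ X. ennreal (exp (?S X)) * indicator (space P) X \<partial>P)"
    by (rule nn_integral_Markov_inequality) auto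
  also have "(\<integral>\<^sup>+ X. ennreal (exp (?S X)) * indicator (space P) X \<partial>P) = (\<integral>\<^sup>+ X. (\<Prod>i<N. ennreal (exp (f (X i)))) \<partial>P)"
    by (intro nn_integral_cong) (simp add: exp_sum prod_ennreal)
  also have "\<dots> = (\<Prod>i<N. \<integral>\<^sup>+ x. ennreal (exp (f x)) \<partial>gaussian d \<mu>)"
    unfolding P_def gaussian_samples_def by (rule gaussians.product_nn_integral_prod) auto
  also have "\<dots> \<le> (\<Prod>i<N. ennreal (exp c))"
    by (simp only: prod_constant) (intro power_mono mgf, simp)
  also have "\<dots> = ennreal (exp (real N * c))" by (simp add: ennreal_power exp_of_nat_mult)
  finally have "emeasure P {X \<in> space P. T \<le> ?S X} \<le> ennreal (exp (- T)) * ennreal (exp (real N * c))"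
    by (simp add: mult_left_mono)
  also have "\<dots> = ennreal (exp (real N * c - T))" by (simp flip: ennreal_mult exp_add)
  finally show "measure P {X \<in> space P. T \<le> ?S X} \<le> exp (real N * c - T)"
    by (simp add: P.emeasure_eq_measure)
qed

lemma union_chernoff:
  fixes f :: "'j \<Rightarrow> (nat \<Rightarrow> real) \<Rightarrow> real" and N :: nat
  assumes "finite J" and f: "\<And>j. j \<in> J \<Longrightarrow> f j \<in> borel_measurable (gaussian d \<mu>)"
    and mgf: "\<And>j. j \<in> J \<Longrightarrow> (\<integral>\<^sup>+ x. ennreal (exp (f j x)) \<partial>gaussian d \<mu>) \<le> ennreal (exp c)"
  defines "P \<equiv> gaussian_samples N d \<mu>"
  shows "{X \<in> space P. \<exists>j\<in>J. T \<le> (\<Sum>i<N. f j (X i))} \<in> sets P"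
    "measure P {X \<in> space P. \<exists>j\<in>J. T \<le> (\<Sum>i<N. f j (X i))} \<le> real (card J) * exp (real N * c - T)"
proof -
  interpret P: prob_space P unfolding P_def by (rule prob_space_samples)
  let ?B = "\<lambda>j. {X \<in> space P. T \<le> (\<Sum>i<N. f j (X i))}"
  have eq: "{X \<in> space P. \<exists>j\<in>J. T \<le> (\<Sum>i<N. f j (X i))} = (\<Union>j\<in>J. ?B j)" by auto
  have B: "?B j \<in> sets P" "measure P (?B j) \<le> exp (real N * c - T)" if "j \<in> J" for j
    unfolding P_def by (rule chernoff_samples[OF f[OF that] mgf[OF that]])+
  show "{X \<in> space P. \<exists>j\<in>J. T \<le> (\<Sum>i<N. f j (X i))} \<in> sets P"
    unfolding eq by (intro sets.finite_UN assms(1) B(1))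
  have "measure P (\<Union>j\<in>J. ?B j) \<le> (\<Sum>j\<in>J. measure P (?B j))"
    using B by (intro P.finite_measure_subadditive_finite assms(1)) auto
  also have "\<dots> \<le> (\<Sum>j\<in>J. exp (real N * c - T))" using B by (intro sum_mono) auto
  finally show "measure P {X \<in> space P. \<exists>j\<in>J. T \<le> (\<Sum>i<N. f j (X i))} \<le> real (card J) * exp (real N * c - T)"
    unfolding eq by simp
qed

section \<open>Sparse quadratic forms, uniformly over a net\<close>

definition qform :: "nat \<Rightarrow> (nat \<Rightarrow> nat \<Rightarrow> real) \<Rightarrow> (nat \<Rightarrow> real) \<Rightarrow> real" where
  "qform d A x = (\<Sum>a<d. \<Sum>b<d. A a b * (x a * x b - (if a = b then 1 else 0)))"

text \<open>
  A net for the \<open>k\<^sup>2\<close>-sparse matrices in the Frobenius unit ball.  A matrix is encoded by \<open>k\<^sup>2\<close> positions and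
  multiples of \<open>1 / (2 k)\<close>; the encoding is redundant, which makes counting trivial.
\<close>

definition net_params :: "nat \<Rightarrow> nat \<Rightarrow> ((nat \<Rightarrow> nat \<times> nat) \<times> (nat \<Rightarrow> int)) set" where
  "net_params d k = ({..<k * k} \<rightarrow>\<^sub>E {..<d} \<times> {..<d}) \<times> ({..<k * k} \<rightarrow>\<^sub>E {- 2 * int k..2 * int k})"

definition net_matrix :: "nat \<Rightarrow> (nat \<Rightarrow> nat \<times> nat) \<times> (nat \<Rightarrow> int) \<Rightarrow> nat \<Rightarrow> nat \<Rightarrow> real" where
  "net_matrix k p r c = (\<Sum>l<k * k. if fst p l = (r, c) then real_of_int (snd p l) / (2 * real k) else 0)"

definition net :: "nat \<Rightarrow> nat \<Rightarrow> ((nat \<Rightarrow> nat \<times> nat) \<times> (nat \<Rightarrow> int)) set" where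
  "net d k = {p \<in> net_params d k. (\<Sum>a<d. \<Sum>b<d. (net_matrix k p a b)\<^sup>2) \<le> 1}"

lemma finite_net: "finite (net d k)"
  by (simp add: net_def net_params_def finite_PiE)

lemma card_net: "card (net d k) \<le> (d * d * (4 * k + 1)) ^ (k * k)"
proof -
  have "card (net d k) \<le> card (net_params d k)"
    unfolding net_def by (intro card_mono) (auto simp: net_params_def finite_PiE)
  also have "\<dots> = (d * d) ^ (k * k) * (4 * k + 1) ^ (k * k)"
    by (simp add: net_params_def card_cartesian_product card_PiE nat_add_distrib nat_mult_distrib)
  finally show ?thesis by (simp only: power_mult_distrib)
qed

text \<open>The third clause sums the excess over a fixed level and mentions no weights. It concerns
  finitely many matrices, hence suits a union bound, and yet later controls all weightings
  \<open>c\<close> at once.\<close>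

definition typical :: "nat \<Rightarrow> nat \<Rightarrow> nat \<Rightarrow> real \<Rightarrow> (nat \<Rightarrow> nat \<Rightarrow> real) \<Rightarrow> bool" where
  "typical d N k \<epsilon> z \<longleftrightarrow>
     (\<forall>j<d. \<bar>\<Sum>i<N. z i j\<bar> \<le> real N * (\<epsilon> / real k)) \<and>
     (\<forall>a<d. \<forall>b<d. \<bar>\<Sum>i<N. z i a * z i b - (if a = b then 1 else 0)\<bar> \<le> real N * (\<epsilon> / real k)) \<and>
     (\<forall>p\<in>net d k. (\<Sum>i<N. max 0 (qform d (net_matrix k p) (z i) - 16 * ln (1 / \<epsilon>))) \<le> \<epsilon> * real N)"

lemma mgf_linear:
  assumes "j < d" "s = 1 \<or> s = -1"
  shows "(\<integral>\<^sup>+ x. ennreal (exp (t * (s * (x j - \<mu> j)))) \<partial>gaussian d \<mu>) \<le> ennreal (exp (t\<^sup>2 / 2))"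
proof -
  have "(\<integral>\<^sup>+ x. ennreal (exp (t * (s * (x j - \<mu> j)))) \<partial>gaussian d \<mu>) = (\<integral>\<^sup>+ y. ennreal (exp (0 * (y - \<mu> j)\<^sup>2 + (t * s) * (y - \<mu> j))) \<partial>unit_normal (\<mu> j))"
    using gaussian_coordinate[OF assms(1), of "\<lambda>y. ennreal (exp (0 * (y - \<mu> j)\<^sup>2 + (t * s) * (y - \<mu> j)))" \<mu>]
    by (simp add: mult.assoc)
  then show ?thesis using assms(2) by (subst (asm) unit_normal_exp_quadratic) (auto simp: power_mult_distrib)
qed

text \<open>The matrix with the single entry \<open>t / 8 * s\<close> has squared norm
  \<open>t\<^sup>2 / 64\<close>, just within the range of \<open>gaussian_exp_quadratic\<close>;
  four times that is \<open>t\<^sup>2 / 16\<close>. The sign \<open>s\<close> gives both one-sided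
  deviations.\<close>

lemma mgf_entry:
  assumes "r < d" "c < d" "s = 1 \<or> s = -1" "0 \<le> t" "t \<le> 1"
  shows "(\<integral>\<^sup>+ x. ennreal (exp (t / 8 * (s * ((x r - \<mu> r) * (x c - \<mu> c) - (if r = c then 1 else 0))))) \<partial>gaussian d \<mu>)
    \<le> ennreal (exp (t\<^sup>2 / 16))"
proof -
  let ?A = "\<lambda>a b. if a = r \<and> b = c then t / 8 * s else 0"
  have pick: "(\<Sum>a<d. \<Sum>b<d. if a = r \<and> b = c then F a b else 0) = F r c" for F :: "nat \<Rightarrow> nat \<Rightarrow> real"
  proof -
    have "(\<Sum>a<d. \<Sum>b<d. if a = r \<and> b = c then F a b else 0) = (\<Sum>a<d. if a = r then F a c else 0)"
      using assms by (intro sum.cong) auto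
    then show ?thesis using assms by simp
  qed
  have "s * s = 1" using assms by auto
  then have F: "(\<Sum>a<d. \<Sum>b<d. (?A a b)\<^sup>2) = t\<^sup>2 / 64"
  proof -
    have "(\<Sum>a<d. \<Sum>b<d. (?A a b)\<^sup>2) = (\<Sum>a<d. \<Sum>b<d. if a = r \<and> b = c then (t / 8 * s)\<^sup>2 else 0)"
      by (intro sum.cong) auto
    also have "\<dots> = (t / 8 * s)\<^sup>2" by (rule pick)
    finally show ?thesis using \<open>s * s = 1\<close> by (simp add: power_mult_distrib power2_eq_square)
  qed
  have "t\<^sup>2 \<le> 1" using assms by (simp add: power_le_one)
  then have "(\<Sum>a<d. \<Sum>b<d. (?A a b)\<^sup>2) \<le> 1 / 64" unfolding F by simp
  from gaussian_exp_quadratic[OF this, of \<mu>]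
  have "(\<integral>\<^sup>+ x. ennreal (exp (\<Sum>a<d. \<Sum>b<d. ?A a b * ((x a - \<mu> a) * (x b - \<mu> b) - (if a = b then 1 else 0)))) \<partial>gaussian d \<mu>)
    \<le> ennreal (exp (t\<^sup>2 / 16))" unfolding F by simp
  moreover have "(\<Sum>a<d. \<Sum>b<d. ?A a b * ((x a - \<mu> a) * (x b - \<mu> b) - (if a = b then 1 else 0))) =
     t / 8 * (s * ((x r - \<mu> r) * (x c - \<mu> c) - (if r = c then 1 else 0)))" for x
    using pick[of "\<lambda>a b. t / 8 * s * ((x a - \<mu> a) * (x b - \<mu> b) - (if a = b then 1 else 0))"]
    by (simp only: if_distrib[of "\<lambda>u. u * _"] mult_zero_left mult.assoc cong: if_cong)
  ultimately show ?thesis by simp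
qed

text \<open>\<open>exp (max 0 a / 8) \<le> 1 + exp (a / 8)\<close>, and the level
  \<open>16 * ln (1 / \<epsilon>)\<close> divided by 8 turns into the factor
  \<open>\<epsilon>\<^sup>2\<close>. The remaining moment is at most 2, so the total is at most
  \<open>1 + 2 * \<epsilon>\<^sup>2\<close>.\<close>

lemma mgf_tail:
  assumes A: "(\<Sum>a<d. \<Sum>b<d. (A a b)\<^sup>2) \<le> 1" and \<epsilon>: "0 < \<epsilon>" "\<epsilon> < 1"
  shows "(\<integral>\<^sup>+ x. ennreal (exp (max 0 (qform d A (\<lambda>j. x j - \<mu> j) - 16 * ln (1 / \<epsilon>)) / 8)) \<partial>gaussian d \<mu>)
    \<le> ennreal (exp (2 * \<epsilon>\<^sup>2))"
proof -
  interpret prob_space "gaussian d \<mu>" by (rule prob_space_gaussian)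
  let ?q = "\<lambda>x. qform d (\<lambda>a b. A a b / 8) (\<lambda>j. x j - \<mu> j)"
  have q: "qform d A x / 8 = qform d (\<lambda>a b. A a b / 8) x" for x
    by (simp add: qform_def sum_divide_distrib)
  have [measurable]: "?q \<in> borel_measurable (gaussian d \<mu>)" unfolding qform_def by measurable
  have "exp (max 0 (qform d A (\<lambda>j. x j - \<mu> j) - 16 * ln (1 / \<epsilon>)) / 8) \<le> 1 + \<epsilon>\<^sup>2 * exp (?q x)" for x
  proof -
    have "\<epsilon>\<^sup>2 * exp (?q x) = exp (?q x - 2 * ln (1 / \<epsilon>))"
    proof -
      have "exp (- 2 * ln (1 / \<epsilon>)) = \<epsilon>\<^sup>2" using \<epsilon> by (simp add: ln_div exp_double)
      then show ?thesis by (simp add: exp_diff exp_minus field_simps)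
    qed
    moreover have m: "exp (max 0 a / 8) \<le> 1 + exp (a / 8)" for a :: real by (cases "0 \<le> a") (auto simp: add_increasing)
    ultimately show ?thesis
      using m[of "qform d A (\<lambda>j. x j - \<mu> j) - 16 * ln (1 / \<epsilon>)"] by (simp add: diff_divide_distrib q)
  qed
  then have "(\<integral>\<^sup>+ x. ennreal (exp (max 0 (qform d A (\<lambda>j. x j - \<mu> j) - 16 * ln (1 / \<epsilon>)) / 8)) \<partial>gaussian d \<mu>)
     \<le> (\<integral>\<^sup>+ x. 1 + ennreal (\<epsilon>\<^sup>2) * ennreal (exp (?q x)) \<partial>gaussian d \<mu>)"
    by (intro nn_integral_mono) (simp flip: ennreal_mult ennreal_1 ennreal_plus)
  also have "\<dots> = 1 + ennreal (\<epsilon>\<^sup>2) * (\<integral>\<^sup>+ x. ennreal (exp (?q x)) \<partial>gaussian d \<mu>)"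
    by (simp add: nn_integral_add nn_integral_cmult emeasure_space_1)
  also have "(\<integral>\<^sup>+ x. ennreal (exp (?q x)) \<partial>gaussian d \<mu>) \<le> ennreal 2"
  proof -
    have F: "(\<Sum>a<d. \<Sum>b<d. (A a b / 8)\<^sup>2) = (\<Sum>a<d. \<Sum>b<d. (A a b)\<^sup>2) / 64"
      by (simp add: sum_divide_distrib power_divide)
    have "(\<Sum>a<d. \<Sum>b<d. (A a b / 8)\<^sup>2) \<le> 1 / 64" unfolding F using A by simp
    from gaussian_exp_quadratic[OF this, of \<mu>]
    have "(\<integral>\<^sup>+ x. ennreal (exp (?q x)) \<partial>gaussian d \<mu>) \<le> ennreal (exp (4 * ((\<Sum>a<d. \<Sum>b<d. (A a b)\<^sup>2) / 64)))"
      unfolding F qform_def .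
    also have "exp (4 * ((\<Sum>a<d. \<Sum>b<d. (A a b)\<^sup>2) / 64)) \<le> exp (1 / 2)" using A by simp
    also have "exp (1 / 2 :: real) \<le> 2" using exp_bound_half[of "1/2 :: real"] by simp
    finally show ?thesis by (simp add: ennreal_leI)
  qed
  also have "1 + ennreal (\<epsilon>\<^sup>2) * ennreal 2 = ennreal (1 + 2 * \<epsilon>\<^sup>2)"
  proof -
    have "ennreal (1 + 2 * \<epsilon>\<^sup>2) = ennreal 1 + ennreal (2 * \<epsilon>\<^sup>2)" by (rule ennreal_plus) auto
    moreover have "ennreal (\<epsilon>\<^sup>2 * 2) = ennreal (\<epsilon>\<^sup>2) * ennreal 2" by (rule ennreal_mult) auto
    ultimately show ?thesis by (simp add: mult.commute)
  qed
  also have "\<dots> \<le> ennreal (exp (2 * \<epsilon>\<^sup>2))" by (intro ennreal_leI exp_ge_add_one_self)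
  finally show ?thesis by (simp add: add_left_mono mult_left_mono)
qed

text \<open>Three union bounds. With \<open>t = \<epsilon> / k\<close>, the first two families are
  scaled so that the Chernoff parameter is proportional to the deviation \<open>t\<close>, leaving
  exponents \<open>- N * t\<^sup>2 / 2\<close> and \<open>- N * t\<^sup>2 / 16\<close>; the third is
  scaled by the fixed factor 1/8.\<close>

lemma typical_probability:
  assumes \<epsilon>: "0 < \<epsilon>" "\<epsilon> \<le> 1 / 32" and k: "0 < k"
    and small: "2 * real d * exp (- (real N * (\<epsilon> / real k)\<^sup>2 / 2)) + 2 * (real d)\<^sup>2 * exp (- (real N * (\<epsilon> / real k)\<^sup>2 / 16))
      + real ((d * d * (4 * k + 1)) ^ (k * k)) * exp (- (real N * \<epsilon> / 16)) \<le> \<tau>"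
  shows "with_probability_at_least (gaussian_samples N d \<mu>) (1 - \<tau>) (\<lambda>X. typical d N k \<epsilon> (\<lambda>i j. X i j - \<mu> j))"
proof -
  define P where "P = gaussian_samples N d \<mu>"
  interpret P: prob_space P unfolding P_def by (rule prob_space_samples)
  define t where "t = \<epsilon> / real k"
  have t: "0 < t" "t \<le> 1" using \<epsilon> k by (auto simp: t_def divide_le_eq)
  define f1 :: "nat \<times> real \<Rightarrow> (nat \<Rightarrow> real) \<Rightarrow> real" where "f1 = (\<lambda>(j, s) x. t * (s * (x j - \<mu> j)))"
  define f2 :: "(nat \<times> nat) \<times> real \<Rightarrow> (nat \<Rightarrow> real) \<Rightarrow> real" where
    "f2 = (\<lambda>((r, c), s) x. t / 8 * (s * ((x r - \<mu> r) * (x c - \<mu> c) - (if r = c then 1 else 0))))"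
  define f3 where "f3 p x = max 0 (qform d (net_matrix k p) (\<lambda>j. x j - \<mu> j) - 16 * ln (1 / \<epsilon>)) / 8" for p x
  define J1 where "J1 = {..<d} \<times> {1, -1 :: real}"
  define J2 where "J2 = ({..<d} \<times> {..<d}) \<times> {1, -1 :: real}"
  define B1 where "B1 = {X \<in> space P. \<exists>j\<in>J1. real N * t\<^sup>2 \<le> (\<Sum>i<N. f1 j (X i))}"
  define B2 where "B2 = {X \<in> space P. \<exists>j\<in>J2. real N * t\<^sup>2 / 8 \<le> (\<Sum>i<N. f2 j (X i))}"
  define B3 where "B3 = {X \<in> space P. \<exists>j\<in>net d k. real N * \<epsilon> / 8 \<le> (\<Sum>i<N. f3 j (X i))}"
  have m1: "f1 q \<in> borel_measurable (gaussian d \<mu>)"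
    and g1: "(\<integral>\<^sup>+ x. ennreal (exp (f1 q x)) \<partial>gaussian d \<mu>) \<le> ennreal (exp (t\<^sup>2 / 2))" if qJ: "q \<in> J1" for q
  proof -
    obtain j s where q: "q = (j, s)" "j < d" "s = 1 \<or> s = -1"
      using qJ by (cases q) (auto simp: J1_def)
    show "f1 q \<in> borel_measurable (gaussian d \<mu>)" unfolding f1_def q(1) prod.case using q(2) by measurable
    show "(\<integral>\<^sup>+ x. ennreal (exp (f1 q x)) \<partial>gaussian d \<mu>) \<le> ennreal (exp (t\<^sup>2 / 2))"
      unfolding f1_def q(1) prod.case by (rule mgf_linear[OF q(2,3)])
  qed
  have m2: "f2 q \<in> borel_measurable (gaussian d \<mu>)"
    and g2: "(\<integral>\<^sup>+ x. ennreal (exp (f2 q x)) \<partial>gaussian d \<mu>) \<le> ennreal (exp (t\<^sup>2 / 16))" if qJ: "q \<in> J2" for q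
  proof -
    obtain r c s where q: "q = ((r, c), s)" "r < d" "c < d" "s = 1 \<or> s = -1"
      using qJ by (cases q) (auto simp: J2_def)
    show "f2 q \<in> borel_measurable (gaussian d \<mu>)" unfolding f2_def q(1) prod.case using q(2,3) by measurable
    show "(\<integral>\<^sup>+ x. ennreal (exp (f2 q x)) \<partial>gaussian d \<mu>) \<le> ennreal (exp (t\<^sup>2 / 16))"
      unfolding f2_def q(1) prod.case using t by (intro mgf_entry q(2-4)) auto
  qed
  have fin: "finite J1" "finite J2" by (simp_all add: J1_def J2_def)
  have 1: "B1 \<in> sets P" "measure P B1 \<le> real (card J1) * exp (real N * (t\<^sup>2 / 2) - real N * t\<^sup>2)"
    unfolding B1_def P_def
    by (rule union_chernoff[where J = J1 and f = f1 and c = "t\<^sup>2 / 2", OF fin(1) m1 g1]; assumption)+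
  have 2: "B2 \<in> sets P" "measure P B2 \<le> real (card J2) * exp (real N * (t\<^sup>2 / 16) - real N * t\<^sup>2 / 8)"
    unfolding B2_def P_def
    by (rule union_chernoff[where J = J2 and f = f2 and c = "t\<^sup>2 / 16", OF fin(2) m2 g2]; assumption)+
  have m3: "f3 p \<in> borel_measurable (gaussian d \<mu>)" for p unfolding f3_def qform_def by measurable
  have g3: "(\<integral>\<^sup>+ x. ennreal (exp (f3 p x)) \<partial>gaussian d \<mu>) \<le> ennreal (exp (2 * \<epsilon>\<^sup>2))" if "p \<in> net d k" for p
    unfolding f3_def using that \<epsilon> by (intro mgf_tail) (auto simp: net_def)
  have 3: "B3 \<in> sets P" "measure P B3 \<le> real (card (net d k)) * exp (real N * (2 * \<epsilon>\<^sup>2) - real N * \<epsilon> / 8)"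
    unfolding B3_def P_def
    by (rule union_chernoff[OF finite_net m3 g3], assumption)+
  let ?E = "space P - (B1 \<union> B2 \<union> B3)"
  have E: "?E \<in> sets P" using 1 2 3 by auto
  have "measure P (B1 \<union> B2 \<union> B3) \<le> measure P B1 + measure P B2 + measure P B3"
    using measure_Un_le[of "B1 \<union> B2" P B3] measure_Un_le[of B1 P B2] 1 2 3 by auto
  also have "measure P B1 \<le> 2 * real d * exp (- (real N * t\<^sup>2 / 2))"
    using 1(2) by (simp add: J1_def card_cartesian_product mult_ac)
  also have "measure P B2 \<le> 2 * (real d)\<^sup>2 * exp (- (real N * t\<^sup>2 / 16))"
    using 2(2) by (simp add: J2_def card_cartesian_product power2_eq_square mult_ac)
  also have "measure P B3 \<le> real ((d * d * (4 * k + 1)) ^ (k * k)) * exp (- (real N * \<epsilon> / 16))"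
  proof -
    \<comment> \<open>For \<open>\<epsilon> \<le> 1 / 32\<close> the moment cost
      \<open>2 * \<epsilon>\<^sup>2\<close> per point uses at most half of the threshold
      \<open>\<epsilon> / 8\<close>.\<close>
    have "\<epsilon>\<^sup>2 \<le> \<epsilon> * (1 / 32)" unfolding power2_eq_square using \<epsilon> by (intro mult_left_mono) auto
    then have "real N * \<epsilon>\<^sup>2 \<le> real N * (\<epsilon> * (1 / 32))" by (intro mult_left_mono) auto
    then have "real N * (2 * \<epsilon>\<^sup>2) - real N * \<epsilon> / 8 \<le> - (real N * \<epsilon> / 16)" by simp
    then have "real (card (net d k)) * exp (real N * (2 * \<epsilon>\<^sup>2) - real N * \<epsilon> / 8)
       \<le> real ((d * d * (4 * k + 1)) ^ (k * k)) * exp (- (real N * \<epsilon> / 16))"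
      using card_net by (intro mult_mono) (auto simp del: of_nat_power of_nat_mult)
    then show ?thesis using 3(2) by linarith
  qed
  finally have "measure P (B1 \<union> B2 \<union> B3) \<le> \<tau>" using small by (simp add: t_def)
  moreover have "measure P ?E = 1 - measure P (B1 \<union> B2 \<union> B3)"
    using 1 2 3 by (intro P.prob_compl) auto
  ultimately have meas: "1 - \<tau> \<le> measure P ?E" by linarith
  have "typical d N k \<epsilon> (\<lambda>i j. X i j - \<mu> j)" if X: "X \<in> ?E" for X
    unfolding typical_def t_def[symmetric]
  proof (intro conjI allI impI ballI)
    fix j assume j: "j < d"
    have "\<not> real N * t < s * (\<Sum>i<N. X i j - \<mu> j)" if "s \<in> {1, -1}" for s
    proof
      assume "real N * t < s * (\<Sum>i<N. X i j - \<mu> j)"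
      then have "t * (real N * t) \<le> t * (s * (\<Sum>i<N. X i j - \<mu> j))" using t by (intro mult_left_mono) auto
      then have "real N * t\<^sup>2 \<le> (\<Sum>i<N. f1 (j, s) (X i))"
        by (simp add: f1_def sum_distrib_left power2_eq_square mult_ac)
      then have "X \<in> B1" using X j that by (auto simp: B1_def J1_def)
      then show False using X by simp
    qed
    from this[of 1] this[of "-1"] show "\<bar>\<Sum>i<N. X i j - \<mu> j\<bar> \<le> real N * t" by (auto simp: abs_le_iff)
  next
    fix r c assume rc: "r < d" "c < d"
    let ?S = "\<Sum>i<N. (X i r - \<mu> r) * (X i c - \<mu> c) - (if r = c then 1 else 0)"
    have "\<not> real N * t < s * ?S" if "s \<in> {1, -1}" for s
    proof
      assume "real N * t < s * ?S"
      then have "t / 8 * (real N * t) \<le> t / 8 * (s * ?S)" using t by (intro mult_left_mono) auto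
      then have "real N * t\<^sup>2 / 8 \<le> (\<Sum>i<N. f2 ((r, c), s) (X i))"
        unfolding f2_def by (simp only: sum_distrib_left prod.case) (simp add: power2_eq_square mult_ac)
      then have "X \<in> B2" using X rc that by (auto simp: B2_def J2_def)
      then show False using X by simp
    qed
    from this[of 1] this[of "-1"] show "\<bar>?S\<bar> \<le> real N * t" by (auto simp: abs_le_iff)
  next
    fix p assume p: "p \<in> net d k"
    have "\<not> real N * \<epsilon> / 8 \<le> (\<Sum>i<N. f3 p (X i))" using X p by (auto simp: B3_def)
    then show "(\<Sum>i<N. max 0 (qform d (net_matrix k p) (\<lambda>j. X i j - \<mu> j) - 16 * ln (1 / \<epsilon>))) \<le> \<epsilon> * real N"
      by (simp add: f3_def mult.commute flip: sum_divide_distrib)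
  qed
  then show ?thesis using E meas unfolding with_probability_at_least_def P_def[symmetric] by blast
qed

text \<open>Rounding each coefficient towards 0 to a multiple of \<open>1 / (2 * k)\<close> keeps
  the matrix in the unit ball. At most \<open>k^2\<close> errors of size \<open>1 / (2 * k)\<close>
  have squared norm at most 1/4.\<close>

lemma round_to_net:
  assumes U: "U \<subseteq> {..<d} \<times> {..<d}" "card U \<le> k * k" "U \<noteq> {}" and k: "0 < k"
    and a: "(\<Sum>u\<in>U. (a u)\<^sup>2) \<le> (1 :: real)"
  obtains p b where "p \<in> net d k" "\<And>x. qform d (net_matrix k p) x = (\<Sum>u\<in>U. b u * (x (fst u) * x (snd u) - (if fst u = snd u then 1 else 0)))"
    "(\<Sum>u\<in>U. (a u - b u)\<^sup>2) \<le> 1 / 4"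
proof -
  have fin: "finite U" using U(1) finite_subset by blast
  define n where "n u = (if 0 \<le> a u then \<lfloor>2 * real k * a u\<rfloor> else - \<lfloor>2 * real k * - a u\<rfloor>)" for u
  define b where "b u = real_of_int (n u) / (2 * real k)" for u
  have key: "\<bar>b u\<bar> \<le> \<bar>a u\<bar> \<and> \<bar>a u - b u\<bar> \<le> 1 / (2 * real k)" for u
  proof -
    have pos: "0 \<le> real_of_int \<lfloor>2 * real k * v\<rfloor> / (2 * real k) \<and> real_of_int \<lfloor>2 * real k * v\<rfloor> / (2 * real k) \<le> v \<and>
        v - real_of_int \<lfloor>2 * real k * v\<rfloor> / (2 * real k) \<le> 1 / (2 * real k)" if "0 \<le> v" for v
    proof -
      have "real_of_int \<lfloor>2 * real k * v\<rfloor> \<le> 2 * real k * v" "2 * real k * v - real_of_int \<lfloor>2 * real k * v\<rfloor> \<le> 1" by linarith+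
      moreover have "0 \<le> \<lfloor>2 * real k * v\<rfloor>" using that by simp
      moreover from calculation(2) have "(2 * real k * v - real_of_int \<lfloor>2 * real k * v\<rfloor>) / (2 * real k) \<le> 1 / (2 * real k)"
        by (intro divide_right_mono) auto
      moreover from calculation(1) have "real_of_int \<lfloor>2 * real k * v\<rfloor> / (2 * real k) \<le> 2 * real k * v / (2 * real k)"
        by (intro divide_right_mono) auto
      ultimately show ?thesis using k by (simp add: diff_divide_distrib)
    qed
    show ?thesis
    proof (cases "0 \<le> a u")
      case True
      then show ?thesis using pos[OF True] by (simp add: b_def n_def)
    next
      case False
      then have "b u = - (real_of_int \<lfloor>2 * real k * - a u\<rfloor> / (2 * real k))" by (simp add: b_def n_def)
      then show ?thesis using pos[of "- a u"] False by linarith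
    qed
  qed
  have n: "n u \<in> {- 2 * int k..2 * int k}" if "u \<in> U" for u
  proof -
    have "(a u)\<^sup>2 \<le> (\<Sum>u\<in>U. (a u)\<^sup>2)" using fin that by (intro member_le_sum) auto
    then have "\<bar>a u\<bar> \<le> 1" using a by (simp add: abs_square_le_1[symmetric])
    then have "\<bar>b u\<bar> \<le> 1" using key[of u] by linarith
    then have "\<bar>real_of_int (n u)\<bar> \<le> 2 * real k" using k by (simp add: b_def divide_le_eq)
    then show ?thesis by (simp add: abs_le_iff)
  qed
  obtain h where h: "bij_betw h {0..<card U} U" using ex_bij_betw_nat_finite[OF fin] by blast
  \<comment> \<open>The first \<open>card U\<close> slots enumerate \<open>U\<close>; the others
    carry coefficient 0 at some arbitrary position of \<open>U\<close>, chosen only to stay inside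
    the index range.\<close>
  define p where "p = (restrict (\<lambda>l. if l < card U then h l else (SOME u. u \<in> U)) {..<k * k},
     restrict (\<lambda>l. if l < card U then n (h l) else 0) {..<k * k})"
  have mat: "net_matrix k p r c = (if (r, c) \<in> U then b (r, c) else 0)" for r c
  proof -
    have "net_matrix k p r c = (\<Sum>l<k * k. if l < card U \<and> h l = (r, c) then b (h l) else 0)"
      unfolding net_matrix_def p_def b_def by (intro sum.cong) auto
    also have "\<dots> = (\<Sum>l\<in>{0..<card U}. if h l = (r, c) then b (h l) else 0)"
      using U(2) by (intro sum.mono_neutral_cong_right) auto
    also have "\<dots> = (\<Sum>u\<in>U. if u = (r, c) then b u else 0)"
      by (rule sum.reindex_bij_betw[OF h])
    finally show ?thesis using fin by simp
  qed
  have restr: "(\<Sum>r<d. \<Sum>c<d. if (r, c) \<in> U then F (r, c) else 0) = (\<Sum>u\<in>U. F u)" for F :: "nat \<times> nat \<Rightarrow> real"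
  proof -
    have "(\<Sum>r<d. \<Sum>c<d. if (r, c) \<in> U then F (r, c) else 0) = (\<Sum>u\<in>{..<d} \<times> {..<d}. if u \<in> U then F u else 0)"
      unfolding sum.cartesian_product by (rule sum.cong) auto
    then show ?thesis using U(1) by (simp add: sum.If_cases Int_absorb1)
  qed
  have "(\<Sum>r<d. \<Sum>c<d. (net_matrix k p r c)\<^sup>2) = (\<Sum>u\<in>U. (b u)\<^sup>2)"
    unfolding mat using restr[of "\<lambda>u. (b u)\<^sup>2"] by (simp add: if_distrib[of "\<lambda>x. x\<^sup>2"] cong: if_cong)
  also have "\<dots> \<le> (\<Sum>u\<in>U. (a u)\<^sup>2)" using key by (intro sum_mono) (simp add: abs_le_square_iff[symmetric])
  finally have F: "(\<Sum>r<d. \<Sum>c<d. (net_matrix k p r c)\<^sup>2) \<le> 1" using a by linarith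
  have some: "(SOME u. u \<in> U) \<in> U" using U(3) by (simp add: some_in_eq)
  have hU: "h l \<in> U" if "l < card U" for l using h that by (auto simp: bij_betw_def)
  have "p \<in> net_params d k"
    unfolding p_def net_params_def mem_Times_iff fst_conv snd_conv
  proof (intro conjI restrict_PiE_iff[THEN iffD2] ballI)
    fix l
    have "(if l < card U then h l else (SOME u. u \<in> U)) \<in> U" using some hU by simp
    then show "(if l < card U then h l else (SOME u. u \<in> U)) \<in> {..<d} \<times> {..<d}" using U(1) by blast
    show "(if l < card U then n (h l) else 0) \<in> {- 2 * int k..2 * int k}" using n hU by auto
  qed
  then have "p \<in> net d k" using F by (simp add: net_def)
  moreover have "qform d (net_matrix k p) x = (\<Sum>u\<in>U. b u * (x (fst u) * x (snd u) - (if fst u = snd u then 1 else 0)))" for x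
    unfolding qform_def mat
    using restr[of "\<lambda>u. b u * (x (fst u) * x (snd u) - (if fst u = snd u then 1 else 0))"]
    by (simp add: if_distrib[of "\<lambda>y. y * _"] cong: if_cong)
  moreover have "(\<Sum>u\<in>U. (a u - b u)\<^sup>2) \<le> 1 / 4"
  proof -
    have "(\<Sum>u\<in>U. (a u - b u)\<^sup>2) \<le> (\<Sum>u\<in>U. (1 / (2 * real k))\<^sup>2)"
      using key by (intro sum_mono) (simp add: abs_le_square_iff[symmetric])
    also have "\<dots> = real (card U) * (1 / (2 * real k))\<^sup>2" by simp
    also have "\<dots> \<le> real (k * k) * (1 / (2 * real k))\<^sup>2" using U(2) by (intro mult_right_mono) (auto simp del: of_nat_mult)
    also have "\<dots> = 1 / 4" using k by (simp add: field_simps power2_eq_square)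
    finally show ?thesis .
  qed
  ultimately show ?thesis by (rule that)
qed

text \<open>Let \<open>a\<close> be the normalised vector \<open>m\<close> and \<open>b\<close> its
  rounding. Then \<open>\<sigma>\<close> is the pairing of \<open>a\<close> with \<open>m\<close>,
  and replacing \<open>a\<close> by \<open>b\<close> costs at most \<open>\<sigma> / 2\<close>. The
  pairing with \<open>b\<close> is at most the level times the weight, \<open>16 * 5\<close>, plus
  the excess, 1, in units of \<open>\<epsilon> * N * ln (1 / \<epsilon>)\<close>; solving for
  \<open>\<sigma>\<close> doubles 81 to 162.\<close>

lemma typical_tail:
  assumes ty: "typical d N k \<epsilon> z" and \<epsilon>: "0 < \<epsilon>" "1 \<le> ln (1 / \<epsilon>)" and k: "0 < k"
    and c: "\<And>i. i < N \<Longrightarrow> 0 \<le> c i \<and> c i \<le> 1" "(\<Sum>i<N. c i) \<le> 5 * \<epsilon> * real N"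
    and U: "U \<subseteq> {..<d} \<times> {..<d}" "card U \<le> k * k"
  shows "(\<Sum>u\<in>U. (\<Sum>i<N. c i * (z i (fst u) * z i (snd u) - (if fst u = snd u then 1 else 0)))\<^sup>2)
     \<le> (real N * (162 * \<epsilon> * ln (1 / \<epsilon>)))\<^sup>2"
proof -
  define m where "m u = (\<Sum>i<N. c i * (z i (fst u) * z i (snd u) - (if fst u = snd u then 1 else 0)))" for u
  define \<sigma> where "\<sigma> = sqrt (\<Sum>u\<in>U. (m u)\<^sup>2)"
  have \<sigma>2: "\<sigma>\<^sup>2 = (\<Sum>u\<in>U. (m u)\<^sup>2)" "0 \<le> \<sigma>" by (simp_all add: \<sigma>_def sum_nonneg)
  have "\<sigma> \<le> real N * (162 * \<epsilon> * ln (1 / \<epsilon>))"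
  proof (cases "\<sigma> = 0")
    case True
    have "0 \<le> ln (1 / \<epsilon>)" using \<epsilon>(2) by linarith
    then show ?thesis using True \<epsilon>(1) by (simp only: mult_nonneg_nonneg of_nat_0_le_iff less_imp_le zero_le_numeral)
  next
    case False
    then have \<sigma>: "0 < \<sigma>" using \<sigma>2 by simp
    then have "U \<noteq> {}" by (auto simp: \<sigma>_def)
    define a where "a u = m u / \<sigma>" for u
    have "(\<Sum>u\<in>U. (a u)\<^sup>2) = (\<Sum>u\<in>U. (m u)\<^sup>2) / \<sigma>\<^sup>2" by (simp add: a_def power_divide sum_divide_distrib)
    then have a1: "(\<Sum>u\<in>U. (a u)\<^sup>2) \<le> 1" using \<sigma> unfolding \<sigma>2(1)[symmetric] by simp
    obtain p b where p: "p \<in> net d k"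
        "\<And>x. qform d (net_matrix k p) x = (\<Sum>u\<in>U. b u * (x (fst u) * x (snd u) - (if fst u = snd u then 1 else 0)))"
        "(\<Sum>u\<in>U. (a u - b u)\<^sup>2) \<le> 1 / 4"
      by (rule round_to_net[OF U \<open>U \<noteq> {}\<close> k a1]) (rule that)
    let ?\<theta> = "16 * ln (1 / \<epsilon>)" and ?q = "\<lambda>i. qform d (net_matrix k p) (z i)"
    have "(\<Sum>u\<in>U. b u * m u) = (\<Sum>i<N. c i * ?q i)"
      unfolding p(2) m_def sum_distrib_left
      by (subst sum.swap, intro sum.cong refl, rule mult.left_commute)
    also have "\<dots> \<le> (\<Sum>i<N. c i * ?\<theta> + max 0 (?q i - ?\<theta>))"
    proof (rule sum_mono)
      fix i assume "i \<in> {..<N}"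
      then have "c i * (?q i - ?\<theta>) \<le> c i * max 0 (?q i - ?\<theta>)" "c i * max 0 (?q i - ?\<theta>) \<le> 1 * max 0 (?q i - ?\<theta>)"
        using c(1)[of i] by (auto intro!: mult_left_mono mult_left_le_one_le)
      then show "c i * ?q i \<le> c i * ?\<theta> + max 0 (?q i - ?\<theta>)" by (simp only: right_diff_distrib mult_1)
    qed
    also have "\<dots> = (\<Sum>i<N. c i) * ?\<theta> + (\<Sum>i<N. max 0 (?q i - ?\<theta>))" by (simp only: sum.distrib sum_distrib_right)
    also have "\<dots> \<le> 5 * \<epsilon> * real N * ?\<theta> + \<epsilon> * real N"
    proof (rule add_mono[OF mult_right_mono[OF c(2)]])
      show "(\<Sum>i<N. max 0 (?q i - ?\<theta>)) \<le> \<epsilon> * real N" using ty p(1) unfolding typical_def by blast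
    qed (use \<epsilon> in linarith)
    also have "\<dots> \<le> 81 * \<epsilon> * real N * ln (1 / \<epsilon>)"
    proof -
      have "\<epsilon> * real N * 1 \<le> \<epsilon> * real N * ln (1 / \<epsilon>)" using \<epsilon> by (intro mult_left_mono) auto
      then show ?thesis by (simp add: algebra_simps)
    qed
    finally have bm: "(\<Sum>u\<in>U. b u * m u) \<le> 81 * \<epsilon> * real N * ln (1 / \<epsilon>)" .
    have "(\<Sum>u\<in>U. a u * m u) = (\<Sum>u\<in>U. (m u)\<^sup>2) / \<sigma>" by (simp add: a_def sum_divide_distrib power2_eq_square)
    then have am: "(\<Sum>u\<in>U. a u * m u) = \<sigma>" using \<sigma> unfolding \<sigma>2(1)[symmetric] by (simp add: power2_eq_square)
    have "(\<Sum>u\<in>U. (a u - b u) * m u) \<le> sqrt (\<Sum>u\<in>U. (a u - b u)\<^sup>2) * \<sigma>"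
      unfolding \<sigma>_def using abs_sum_Cauchy_Schwarz by (rule order.trans[OF abs_ge_self])
    also have "\<dots> \<le> 1 / 2 * \<sigma>"
      using p(3) \<sigma> by (intro mult_right_mono real_le_lsqrt) (auto simp: power2_eq_square)
    finally have "\<sigma> - (\<Sum>u\<in>U. b u * m u) \<le> 1 / 2 * \<sigma>" by (simp add: left_diff_distrib sum_subtractf am)
    then show ?thesis using bm by (simp add: mult_ac)
  qed
  then have "\<sigma>\<^sup>2 \<le> (real N * (162 * \<epsilon> * ln (1 / \<epsilon>)))\<^sup>2" using \<sigma>2(2) by (intro power_mono)
  then show ?thesis unfolding \<sigma>2(1) m_def .
qed

section \<open>Single coordinates of the sample, for dimension one with few points\<close>

lemma samples_coordinate:
  assumes "i < N" and [measurable]: "f \<in> borel_measurable (gaussian d \<mu>)"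
  shows "(\<integral>\<^sup>+ X. f (X i) \<partial>gaussian_samples N d \<mu>) = (\<integral>\<^sup>+ x. f x \<partial>gaussian d \<mu>)"
proof -
  have "distr (gaussian_samples N d \<mu>) (gaussian d \<mu>) (\<lambda>X. X i) = gaussian d \<mu>"
    unfolding gaussian_samples_def using assms(1) by (intro distr_PiM_component prob_space_gaussian) auto
  then have "(\<integral>\<^sup>+ x. f x \<partial>gaussian d \<mu>) = (\<integral>\<^sup>+ x. f x \<partial>distr (gaussian_samples N d \<mu>) (gaussian d \<mu>) (\<lambda>X. X i))"
    by simp
  also have "\<dots> = (\<integral>\<^sup>+ X. f (X i) \<partial>gaussian_samples N d \<mu>)"
    using assms(1) by (intro nn_integral_distr) auto
  finally show ?thesis ..
qed

lemma distributed_sample_coordinate: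
  assumes "i < N" "j < d"
  shows "distributed (gaussian_samples N d \<mu>) lborel (\<lambda>X. X i j) (normal_density (\<mu> j) 1)"
proof -
  have [measurable]: "(\<lambda>X. X i j) \<in> borel_measurable (gaussian_samples N d \<mu>)"
    using assms measurable_compose[OF measurable_sample measurable_gaussian_coordinate] by blast
  have "distr (gaussian_samples N d \<mu>) lborel (\<lambda>X. X i j) = density lborel (\<lambda>x. ennreal (normal_density (\<mu> j) 1 x))"
  proof (rule measure_eqI)
    fix A assume "A \<in> sets (distr (gaussian_samples N d \<mu>) lborel (\<lambda>X. X i j))"
    then have A [measurable]: "A \<in> sets borel" by simp
    have "emeasure (distr (gaussian_samples N d \<mu>) lborel (\<lambda>X. X i j)) A =
        (\<integral>\<^sup>+ x. indicator A x \<partial>distr (gaussian_samples N d \<mu>) lborel (\<lambda>X. X i j))" by simp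
    also have "\<dots> = (\<integral>\<^sup>+ X. indicator A (X i j) \<partial>gaussian_samples N d \<mu>)" by (rule nn_integral_distr) auto
    also have "\<dots> = (\<integral>\<^sup>+ x. indicator A (x j) \<partial>gaussian d \<mu>)"
      using assms by (intro samples_coordinate[where f = "\<lambda>x. indicator A (x j)"]) measurable
    also have "\<dots> = (\<integral>\<^sup>+ t. indicator A t \<partial>unit_normal (\<mu> j))"
      using assms by (intro gaussian_coordinate) auto
    finally show "emeasure (distr (gaussian_samples N d \<mu>) lborel (\<lambda>X. X i j)) A =
       emeasure (density lborel (\<lambda>x. ennreal (normal_density (\<mu> j) 1 x))) A" by (simp add: unit_normal_def)
  qed simp
  then show ?thesis by (simp add: distributed_def)
qed

lemma indep_sample_coordinates:
  assumes "0 < N" "j < d"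
  shows "prob_space.indep_vars (gaussian_samples N d \<mu>) (\<lambda>_. borel) (\<lambda>i X. X i j) {..<N}"
proof -
  interpret P: prob_space "gaussian_samples N d \<mu>" by (rule prob_space_samples)
  have "P.indep_vars (\<lambda>_. gaussian d \<mu>) (\<lambda>i X. X i) {..<N}"
  proof (subst P.indep_vars_iff_distr_eq_PiM')
    have "distr (gaussian_samples N d \<mu>) (\<Pi>\<^sub>M i\<in>{..<N}. gaussian d \<mu>) (\<lambda>X. \<lambda>i\<in>{..<N}. X i) =
        distr (gaussian_samples N d \<mu>) (gaussian_samples N d \<mu>) (\<lambda>X. X)"
      by (intro distr_cong) (auto simp: gaussian_samples_def space_PiM PiE_def extensional_def fun_eq_iff)
    also have "\<dots> = (\<Pi>\<^sub>M i\<in>{..<N}. gaussian d \<mu>)" by (simp add: distr_id2 gaussian_samples_def)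
    also have "\<dots> = (\<Pi>\<^sub>M i\<in>{..<N}. distr (gaussian_samples N d \<mu>) (gaussian d \<mu>) (\<lambda>X. X i))"
      unfolding gaussian_samples_def
      by (intro PiM_cong refl distr_PiM_component[symmetric] prob_space_gaussian) auto
    finally show "distr (gaussian_samples N d \<mu>) (\<Pi>\<^sub>M i\<in>{..<N}. gaussian d \<mu>) (\<lambda>X. \<lambda>i\<in>{..<N}. X i) =
       (\<Pi>\<^sub>M i\<in>{..<N}. distr (gaussian_samples N d \<mu>) (gaussian d \<mu>) (\<lambda>X. X i))" .
  qed (use assms in auto)
  then have "P.indep_vars (\<lambda>_. borel) (\<lambda>i X. (\<lambda>x. x j) (X i)) {..<N}"
    by (rule P.indep_vars_compose2) (use assms in measurable)
  then show ?thesis by simp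
qed

text \<open>
  When \<open>d = 1\<close> and \<open>\<tau>\<close> is close to 1, the success probability required is small, but so may be \<open>N\<close>.
  The mean is then good with probability of order \<open>\<epsilon> sqrt N\<close> only, which is still more than the probability of
  bad tails.
\<close>

lemma sample_mean_anticoncentration:
  fixes \<mu> :: "nat \<Rightarrow> real"
  assumes N: "0 < N" and \<epsilon>: "0 < \<epsilon>" and j: "j < d"
  defines "P \<equiv> gaussian_samples N d \<mu>"
  shows "{X \<in> space P. \<bar>\<Sum>i<N. X i j - \<mu> j\<bar> \<le> real N * \<epsilon>} \<in> sets P"
    "1 / 3 * min 1 (\<epsilon> * sqrt (real N)) \<le> measure P {X \<in> space P. \<bar>\<Sum>i<N. X i j - \<mu> j\<bar> \<le> real N * \<epsilon>}"
proof -
  interpret P: prob_space P unfolding P_def by (rule prob_space_samples)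
  have coord [measurable]: "(\<lambda>X. X i j) \<in> borel_measurable P" if "i < N" for i
    using that j unfolding P_def by measurable
  show meas: "{X \<in> space P. \<bar>\<Sum>i<N. X i j - \<mu> j\<bar> \<le> real N * \<epsilon>} \<in> sets P" by measurable
  \<comment> \<open>The half-width of the window is capped at one standard deviation, so the normal
    density is at least \<open>1 / (6 * \<sigma>)\<close> on all of it; the width
    \<open>2 * h\<close> then yields \<open>1 / 3 * (h / \<sigma>)\<close>.\<close>
  define h where "h = min (real N * \<epsilon>) (sqrt (real N))"
  define m where "m = real N * \<mu> j"
  define \<sigma> where "\<sigma> = sqrt (real N)"
  have \<sigma>: "0 < \<sigma>" "\<sigma>\<^sup>2 = real N" using N by (auto simp: \<sigma>_def)
  have h: "0 < h" "h \<le> \<sigma>" "h \<le> real N * \<epsilon>" "h / \<sigma> = min 1 (\<epsilon> * \<sigma>)"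
  proof -
    show "0 < h" "h \<le> \<sigma>" "h \<le> real N * \<epsilon>" using N \<epsilon> by (auto simp: h_def \<sigma>_def)
    have "real N * \<epsilon> / \<sigma> = \<epsilon> * \<sigma>" using \<sigma> by (simp add: field_simps power2_eq_square)
    then show "h / \<sigma> = min 1 (\<epsilon> * \<sigma>)" using \<sigma> by (auto simp: h_def \<sigma>_def[symmetric] min_def field_simps)
  qed
  have "distributed P lborel (\<lambda>X. \<Sum>i<N. X i j) (normal_density (\<Sum>i<N. \<mu> j) (sqrt (\<Sum>i<N. 1\<^sup>2)))"
    using N j unfolding P_def
    by (intro prob_space.sum_indep_normal prob_space_samples indep_sample_coordinates distributed_sample_coordinate) auto
  then have dist: "distributed P lborel (\<lambda>X. \<Sum>i<N. X i j) (normal_density m \<sigma>)"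
    by (simp add: m_def \<sigma>_def)
  let ?I = "{m - h..m + h}"
  have "(\<lambda>X. \<Sum>i<N. X i j) -` ?I \<inter> space P \<subseteq> {X \<in> space P. \<bar>\<Sum>i<N. X i j - \<mu> j\<bar> \<le> real N * \<epsilon>}"
    using h(3) by (auto simp: m_def sum_subtractf abs_le_iff)
  then have "emeasure P ((\<lambda>X. \<Sum>i<N. X i j) -` ?I \<inter> space P) \<le> emeasure P {X \<in> space P. \<bar>\<Sum>i<N. X i j - \<mu> j\<bar> \<le> real N * \<epsilon>}"
    by (intro emeasure_mono meas)
  moreover have "emeasure P ((\<lambda>X. \<Sum>i<N. X i j) -` ?I \<inter> space P) = (\<integral>\<^sup>+ x. ennreal (normal_density m \<sigma> x) * indicator ?I x \<partial>lborel)"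
    by (rule distributed_emeasure[OF dist]) simp
  moreover have "ennreal (1 / (6 * \<sigma>)) * ennreal (2 * h) \<le> (\<integral>\<^sup>+ x. ennreal (normal_density m \<sigma> x) * indicator ?I x \<partial>lborel)"
  proof -
    have "1 / (6 * \<sigma>) \<le> normal_density m \<sigma> x" if "x \<in> ?I" for x
    proof -
      have "\<bar>x - m\<bar> \<le> \<sigma>" using that h(2) by (auto simp: abs_le_iff)
      then have "(x - m)\<^sup>2 \<le> \<sigma>\<^sup>2" using \<sigma>(1) by (simp add: abs_le_square_iff[symmetric])
      then have "(x - m)\<^sup>2 / (2 * \<sigma>\<^sup>2) \<le> 1 / 2" using \<sigma>(1) by (simp add: divide_le_eq)
      then have "exp (- 1 / 2) \<le> exp (- (x - m)\<^sup>2 / (2 * \<sigma>\<^sup>2))" by simp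
      moreover have "1 / 2 \<le> exp (- 1 / 2 :: real)" using exp_ge_add_one_self[of "- 1 / 2 :: real"] by simp
      ultimately have e: "1 / 2 \<le> exp (- (x - m)\<^sup>2 / (2 * \<sigma>\<^sup>2))" by linarith
      have "sqrt (2 * pi * \<sigma>\<^sup>2) \<le> 13 / 5 * \<sigma>"
      proof (rule real_le_lsqrt)
        have "2 * pi \<le> 169 / 25" using pi_approx by simp
        then have "2 * pi * \<sigma>\<^sup>2 \<le> 169 / 25 * \<sigma>\<^sup>2" by (intro mult_right_mono) auto
        then show "2 * pi * \<sigma>\<^sup>2 \<le> (13 / 5 * \<sigma>)\<^sup>2" by (simp add: power_mult_distrib power2_eq_square)
      qed (use \<sigma> in simp)
      then have "1 / (13 / 5 * \<sigma>) \<le> 1 / sqrt (2 * pi * \<sigma>\<^sup>2)" using \<sigma>(1) by (intro divide_left_mono) auto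
      then have le: "1 / (13 / 5 * \<sigma>) * (1 / 2) \<le> 1 / sqrt (2 * pi * \<sigma>\<^sup>2) * exp (- (x - m)\<^sup>2 / (2 * \<sigma>\<^sup>2))"
        using e \<sigma>(1) by (intro mult_mono) auto
      have "1 / (6 * \<sigma>) \<le> 1 / (13 / 5 * \<sigma>) * (1 / 2)" using \<sigma>(1) by (simp add: field_simps)
      also note le
      finally show ?thesis by (simp add: normal_density_def)
    qed
    then have "(\<integral>\<^sup>+ x. ennreal (1 / (6 * \<sigma>)) * indicator ?I x \<partial>lborel) \<le> (\<integral>\<^sup>+ x. ennreal (normal_density m \<sigma> x) * indicator ?I x \<partial>lborel)"
      by (intro nn_integral_mono) (auto simp: indicator_def intro: ennreal_leI)
    then show ?thesis using h(1) by (simp add: nn_integral_cmult)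
  qed
  ultimately have "ennreal (1 / (6 * \<sigma>)) * ennreal (2 * h) \<le> emeasure P {X \<in> space P. \<bar>\<Sum>i<N. X i j - \<mu> j\<bar> \<le> real N * \<epsilon>}"
    by simp
  moreover have "ennreal (1 / (6 * \<sigma>)) * ennreal (2 * h) = ennreal (1 / 3 * (h / \<sigma>))"
    using \<sigma>(1) h(1) by (simp flip: ennreal_mult)
  ultimately show "1 / 3 * min 1 (\<epsilon> * sqrt (real N)) \<le> measure P {X \<in> space P. \<bar>\<Sum>i<N. X i j - \<mu> j\<bar> \<le> real N * \<epsilon>}"
    unfolding h(4) \<sigma>_def[symmetric] by (simp add: P.emeasure_eq_measure ennreal_le_iff)
qed

text \<open>The good mean may have probability of order only \<open>\<epsilon>\<close>, so the
  exceptional event must be rarer than that. The exponential moment is at most 2, and the generous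
  level \<open>N / \<epsilon> ^ 3\<close> gives \<open>2 * \<epsilon> ^ 3\<close> by Markov, at most
  a tenth of the minimum; finally \<open>1 / 3 - 1 / 10 \<ge> 1 / 5\<close>.\<close>

lemma one_dim_probability:
  assumes N: "0 < N" and \<epsilon>: "0 < \<epsilon>" "\<epsilon> \<le> 1 / 10" and j: "j < d"
  shows "with_probability_at_least (gaussian_samples N d \<mu>) (1 / 5 * min 1 (\<epsilon> * sqrt (real N)))
    (\<lambda>X. \<bar>\<Sum>i<N. X i j - \<mu> j\<bar> \<le> real N * \<epsilon> \<and> (\<Sum>i<N. exp ((X i j - \<mu> j)\<^sup>2 / 4)) \<le> real N / \<epsilon> ^ 3)"
proof -
  define P where "P = gaussian_samples N d \<mu>"
  interpret P: prob_space P unfolding P_def by (rule prob_space_samples)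
  have coord [measurable]: "(\<lambda>X. X i j) \<in> borel_measurable P" if "i < N" for i
    using that j unfolding P_def by measurable
  let ?S = "\<lambda>X. \<Sum>i<N. exp ((X i j - \<mu> j)\<^sup>2 / 4)"
  define E where "E = {X \<in> space P. \<bar>\<Sum>i<N. X i j - \<mu> j\<bar> \<le> real N * \<epsilon>}"
  define B where "B = {X \<in> space P. real N / \<epsilon> ^ 3 \<le> ?S X}"
  note E = sample_mean_anticoncentration[OF N \<epsilon>(1) j, of \<mu>, folded P_def, folded E_def]
  have B: "B \<in> sets P" unfolding B_def by measurable
  have "real N / \<epsilon> ^ 3 \<le> ?S X \<longleftrightarrow> 1 \<le> ennreal (\<epsilon> ^ 3 / real N) * ennreal (?S X)" for X
  proof -
    have "real N / \<epsilon> ^ 3 \<le> ?S X \<longleftrightarrow> 1 \<le> \<epsilon> ^ 3 / real N * ?S X" using \<epsilon> N by (simp add: field_simps)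
    also have "\<dots> \<longleftrightarrow> 1 \<le> ennreal (\<epsilon> ^ 3 / real N * ?S X)" by simp
    also have "ennreal (\<epsilon> ^ 3 / real N * ?S X) = ennreal (\<epsilon> ^ 3 / real N) * ennreal (?S X)"
      using \<epsilon> by (intro ennreal_mult) (auto intro!: sum_nonneg)
    finally show ?thesis .
  qed
  then have "emeasure P B = emeasure P {X \<in> space P. 1 \<le> ennreal (\<epsilon> ^ 3 / real N) * ennreal (?S X)}"
    by (simp add: B_def)
  also have "\<dots> \<le> ennreal (\<epsilon> ^ 3 / real N) * (\<integral>\<^sup>+ X. ennreal (?S X) * indicator (space P) X \<partial>P)"
    by (rule nn_integral_Markov_inequality) auto
  also have "(\<integral>\<^sup>+ X. ennreal (?S X) * indicator (space P) X \<partial>P) = (\<integral>\<^sup>+ X. (\<Sum>i<N. ennreal (exp ((X i j - \<mu> j)\<^sup>2 / 4))) \<partial>P)"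
    by (intro nn_integral_cong) (simp add: sum_ennreal)
  also have "\<dots> = (\<Sum>i<N. \<integral>\<^sup>+ X. ennreal (exp ((X i j - \<mu> j)\<^sup>2 / 4)) \<partial>P)"
    by (rule nn_integral_sum) auto
  also have "\<dots> \<le> (\<Sum>i<N. ennreal 2)"
  proof (rule sum_mono)
    fix i assume "i \<in> {..<N}"
    then have "(\<integral>\<^sup>+ X. ennreal (exp ((X i j - \<mu> j)\<^sup>2 / 4)) \<partial>P) = (\<integral>\<^sup>+ x. ennreal (exp ((x j - \<mu> j)\<^sup>2 / 4)) \<partial>gaussian d \<mu>)"
      unfolding P_def using j by (intro samples_coordinate[where f = "\<lambda>x. ennreal (exp ((x j - \<mu> j)\<^sup>2 / 4))"]) auto
    also have "\<dots> = (\<integral>\<^sup>+ t. ennreal (exp ((t - \<mu> j)\<^sup>2 / 4)) \<partial>unit_normal (\<mu> j))"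
      using j by (intro gaussian_coordinate) auto
    also have "\<dots> = ennreal (exp (ln 2 / 2))"
      using unit_normal_exp_quadratic[of "1/4" "\<mu> j" 0] by (simp add: ln_div)
    also have "exp (ln 2 / 2) \<le> (2 :: real)"
    proof -
      have "exp (ln 2 / 2) \<le> exp (ln (2::real))" by (subst exp_le_cancel_iff) simp
      then show ?thesis by simp
    qed
    finally show "(\<integral>\<^sup>+ X. ennreal (exp ((X i j - \<mu> j)\<^sup>2 / 4)) \<partial>P) \<le> ennreal 2" by (simp add: ennreal_leI)
  qed
  also have "ennreal (\<epsilon> ^ 3 / real N) * (\<Sum>i<N. ennreal 2) = ennreal (2 * \<epsilon> ^ 3)"
  proof -
    have "(\<Sum>i<N. ennreal 2) = ennreal (\<Sum>i<N. 2)" by (rule sum_ennreal) simp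
    moreover have "\<epsilon> ^ 3 / real N * (\<Sum>i<N. 2) = 2 * \<epsilon> ^ 3" using N by simp
    ultimately show ?thesis using \<epsilon> by (simp only: ennreal_mult[symmetric] divide_nonneg_nonneg zero_le_power less_imp_le of_nat_0_le_iff sum_nonneg zero_le_numeral)
  qed
  finally have "emeasure P B \<le> ennreal (2 * \<epsilon> ^ 3)" by (simp add: mult_left_mono)
  then have mB: "measure P B \<le> 2 * \<epsilon> ^ 3" using \<epsilon> by (simp add: P.emeasure_eq_measure ennreal_le_iff)
  have "2 * \<epsilon> ^ 3 \<le> 1 / 10 * min 1 (\<epsilon> * sqrt (real N))"
  proof -
    have "\<epsilon> ^ 2 \<le> (1 / 10) ^ 2" using \<epsilon> by (intro power_mono) auto
    then have "\<epsilon> * \<epsilon> ^ 2 \<le> \<epsilon> * (1 / 10) ^ 2" using \<epsilon> by (intro mult_left_mono) auto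
    moreover have "\<epsilon> ^ 3 = \<epsilon> * \<epsilon> ^ 2" by (simp add: power3_eq_cube power2_eq_square)
    moreover have "0 \<le> \<epsilon> * \<epsilon> ^ 2" using \<epsilon> by simp
    ultimately have "2 * \<epsilon> ^ 3 \<le> 1 / 10 * \<epsilon>" by (simp add: power2_eq_square)
    moreover have "\<epsilon> * 1 \<le> \<epsilon> * sqrt (real N)" using N \<epsilon> by (intro mult_left_mono) auto
    then have "\<epsilon> \<le> min 1 (\<epsilon> * sqrt (real N))" using \<epsilon> by simp
    ultimately show ?thesis by linarith
  qed
  moreover have "measure P E \<le> measure P (E - B) + measure P B"
  proof -
    have "measure P E \<le> measure P ((E - B) \<union> B)" using E(1) B by (intro P.finite_measure_mono) auto
    also have "\<dots> \<le> measure P (E - B) + measure P B" using E(1) B by (intro measure_Un_le) auto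
    finally show ?thesis .
  qed
  moreover have "0 \<le> min 1 (\<epsilon> * sqrt (real N))" using \<epsilon> by simp
  ultimately have "1 / 5 * min 1 (\<epsilon> * sqrt (real N)) \<le> measure P (E - B)" using E(2) mB by linarith
  moreover have "E - B \<in> sets P" using E(1) B by auto
  ultimately show ?thesis
    unfolding with_probability_at_least_def P_def[symmetric]
    by (intro bexI[of _ "E - B"]) (auto simp: E_def B_def)
qed

text \<open>From \<open>x \<le> exp x\<close> at
  \<open>x = z\<^sup>2 / 4 - 4 * ln (1 / \<epsilon>)\<close>: the excess of \<open>z\<^sup>2\<close>
  over \<open>16 * ln (1 / \<epsilon>)\<close> is at most
  \<open>4 * \<epsilon> ^ 4 * exp (z\<^sup>2 / 4)\<close>, whose sum is at most
  \<open>4 * \<epsilon> * N\<close>. The generous level in \<open>S\<close> thus costs only a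
  logarithm.\<close>

lemma one_dim_tail:
  fixes z :: "nat \<Rightarrow> real"
  assumes S: "(\<Sum>i<N. exp ((z i)\<^sup>2 / 4)) \<le> real N / \<epsilon> ^ 3" and \<epsilon>: "0 < \<epsilon>" "1 \<le> ln (1 / \<epsilon>)"
    and c: "\<And>i. i < N \<Longrightarrow> 0 \<le> c i \<and> c i \<le> 1" "(\<Sum>i<N. c i) \<le> 5 * \<epsilon> * real N"
  shows "(\<Sum>i<N. c i * (z i)\<^sup>2) \<le> real N * (170 * \<epsilon> * ln (1 / \<epsilon>))"
proof -
  let ?L = "ln (1 / \<epsilon>)"
  have "c i * (z i)\<^sup>2 \<le> c i * (16 * ?L) + 4 * (\<epsilon> ^ 4 * exp ((z i)\<^sup>2 / 4))" if "i < N" for i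
  proof -
    have "(z i)\<^sup>2 / 4 - 4 * ?L \<le> exp ((z i)\<^sup>2 / 4 - 4 * ?L)" using exp_ge_add_one_self[of "(z i)\<^sup>2 / 4 - 4 * ?L"] by linarith
    also have "\<dots> = \<epsilon> ^ 4 * exp ((z i)\<^sup>2 / 4)"
    proof -
      have "exp (- (4 * ?L)) = \<epsilon> ^ 4" using \<epsilon> exp_of_nat_mult[of 4 "- ?L"] by (simp add: ln_div)
      then have "exp ((z i)\<^sup>2 / 4 + - (4 * ?L)) = exp ((z i)\<^sup>2 / 4) * \<epsilon> ^ 4" by (simp only: exp_add)
      then show ?thesis by (simp add: mult.commute)
    qed
    finally have "(z i)\<^sup>2 \<le> 16 * ?L + 4 * (\<epsilon> ^ 4 * exp ((z i)\<^sup>2 / 4))" by simp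
    then have "c i * (z i)\<^sup>2 \<le> c i * (16 * ?L + 4 * (\<epsilon> ^ 4 * exp ((z i)\<^sup>2 / 4)))" using c(1)[OF that] by (intro mult_left_mono) auto
    also have "\<dots> \<le> c i * (16 * ?L) + 4 * (\<epsilon> ^ 4 * exp ((z i)\<^sup>2 / 4))"
      using c(1)[OF that] \<epsilon> by (simp add: distrib_left mult_left_le_one_le)
    finally show ?thesis .
  qed
  then have "(\<Sum>i<N. c i * (z i)\<^sup>2) \<le> (\<Sum>i<N. c i * (16 * ?L) + 4 * (\<epsilon> ^ 4 * exp ((z i)\<^sup>2 / 4)))"
    by (intro sum_mono) auto
  also have "\<dots> = (\<Sum>i<N. c i) * (16 * ?L) + 4 * (\<epsilon> ^ 4 * (\<Sum>i<N. exp ((z i)\<^sup>2 / 4)))"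
    by (simp only: sum.distrib sum_distrib_left sum_distrib_right)
  also have "\<dots> \<le> 5 * \<epsilon> * real N * (16 * ?L) + 4 * (\<epsilon> ^ 4 * (real N / \<epsilon> ^ 3))"
  proof -
    have "0 \<le> 16 * ?L" using \<epsilon>(2) by linarith
    then show ?thesis using \<epsilon>(1) by (intro add_mono mult_right_mono[OF c(2)] mult_left_mono S) auto
  qed
  also have "\<epsilon> ^ 4 * (real N / \<epsilon> ^ 3) = \<epsilon> * real N * 1" using \<epsilon> by (simp add: power_eq_if field_simps)
  also have "\<epsilon> * real N * 1 \<le> \<epsilon> * real N * ?L" using \<epsilon> by (intro mult_left_mono) auto
  finally have "(\<Sum>i<N. c i * (z i)\<^sup>2) \<le> 84 * (\<epsilon> * real N * ?L)" by simp
  also have "\<dots> \<le> 170 * (\<epsilon> * real N * ?L)"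
  proof -
    have "0 \<le> ?L" using \<epsilon>(2) by linarith
    from mult_nonneg_nonneg[OF mult_nonneg_nonneg[OF less_imp_le[OF \<epsilon>(1)] of_nat_0_le_iff[of N]] this]
    show ?thesis by linarith
  qed
  finally show ?thesis by (simp add: mult_ac)
qed

section \<open>Compiling sum expressions and array assignments\<close>

text \<open>Injective because \<open>(i + j)\<^sup>2 + j\<close> stays below
  \<open>(i + j + 1)\<^sup>2\<close>. It needs only addition and multiplication, as the machine has
  no integer division for the triangular-number pairing.\<close>

definition pairing :: "nat \<Rightarrow> nat \<Rightarrow> nat" where
  "pairing i j = (i + j) * (i + j) + j"

lemma pairing_eq_iff [simp]: "pairing i j = pairing i' j' \<longleftrightarrow> i = i' \<and> j = j'"
proof
  assume eq: "pairing i j = pairing i' j'"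
  have mono: "pairing a b < pairing a' b'" if "a + b < a' + b'" for a b a' b'
  proof -
    have "Suc (a + b) * Suc (a + b) \<le> (a' + b') * (a' + b')"
      using that by (intro mult_le_mono) auto
    then show ?thesis unfolding pairing_def by simp
  qed
  have "i + j = i' + j'"
    using mono[of i j i' j'] mono[of i' j' i j] eq by linarith
  then show "i = i' \<and> j = j'" using eq unfolding pairing_def by simp
qed simp

abbreviation V :: "nat \<Rightarrow> nexp" where "V v \<equiv> NMem (NConst v)"

text \<open>Arrays start behind the input, which has to stay readable in every iteration.\<close>

definition base :: "(nat \<Rightarrow> nat) \<Rightarrow> nat" where "base \<nu> = 2 + \<nu> 1 * \<nu> 0"

definition cell :: "(nat \<Rightarrow> nat) \<Rightarrow> nat \<Rightarrow> nat \<Rightarrow> nat \<Rightarrow> nat" where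
  "cell \<nu> a i j = base \<nu> + pairing a (pairing i j)"

definition NPairing :: "nexp \<Rightarrow> nexp \<Rightarrow> nexp" where
  "NPairing e f = NAdd (NMul (NAdd e f) (NAdd e f)) f"

definition NBase :: nexp where "NBase = NAdd (NConst 2) (NMul (V 1) (V 0))"

definition NCell :: "nat \<Rightarrow> nexp \<Rightarrow> nexp \<Rightarrow> nexp" where
  "NCell a e f = NAdd NBase (NPairing (NConst a) (NPairing e f))"

abbreviation Temp :: "nat \<Rightarrow> nexp" where "Temp h \<equiv> NCell 0 (NConst h) (NConst 0)"

lemma nval_NBase [simp]: "nval NBase s = base (fst s)"
  by (simp add: NBase_def base_def)

lemma nval_NCell [simp]: "nval (NCell a e f) s = cell (fst s) a (nval e s) (nval f s)"
  by (simp add: NCell_def NPairing_def cell_def pairing_def base_def NBase_def)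

lemma cell_eq_iff [simp]: "cell \<nu> a i j = cell \<nu> a' i' j' \<longleftrightarrow> a = a' \<and> i = i' \<and> j = j'"
  by (simp add: cell_def)

definition nev :: "nexp \<Rightarrow> (nat \<Rightarrow> nat) \<Rightarrow> nat" where
  "nev e \<nu> = nval e (\<nu>, \<lambda>_. 0)"

lemma nval_nev: "nval e s = nev e (fst s)"
  unfolding nev_def by (induction e) auto

lemma nev_simps [simp]:
  "nev (NConst n) \<nu> = n" "nev (NMem e) \<nu> = \<nu> (nev e \<nu>)"
  "nev (NAdd e f) \<nu> = nev e \<nu> + nev f \<nu>" "nev (NSub e f) \<nu> = nev e \<nu> - nev f \<nu>"
  "nev (NMul e f) \<nu> = nev e \<nu> * nev f \<nu>"
  by (simp_all add: nev_def)

lemma nev_NCell [simp]: "nev NBase \<nu> = base \<nu>" "nev (NCell a e f) \<nu> = cell \<nu> a (nev e \<nu>) (nev f \<nu>)"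
  by (simp_all add: nev_def)

text \<open>Natural memory is read only at constant addresses below \<open>L\<close>, the variables
  in scope, so deeper loop counters cannot influence the value.\<close>

primrec wfn :: "nat \<Rightarrow> nexp \<Rightarrow> bool" where
  "wfn L (NConst n) = True"
| "wfn L (NMem e) = (\<exists>v<L. e = NConst v)"
| "wfn L (NAdd e f) = (wfn L e \<and> wfn L f)"
| "wfn L (NSub e f) = (wfn L e \<and> wfn L f)"
| "wfn L (NMul e f) = (wfn L e \<and> wfn L f)"

lemma nev_cong: "wfn L e \<Longrightarrow> (\<And>v. v < L \<Longrightarrow> \<nu> v = \<nu>' v) \<Longrightarrow> nev e \<nu> = nev e \<nu>'"
  by (induction e) auto

text \<open>The only loop bounds are 1, \<open>d\<close> and \<open>N\<close>. The bound
  \<open>k\<close> is excluded on purpose: the running time must be polynomial in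
  \<open>N + d\<close> alone, whereas \<open>k\<close> is arbitrary.\<close>

definition bound_nexp :: "nexp \<Rightarrow> bool" where
  "bound_nexp n \<longleftrightarrow> n \<in> {NConst 1, V 0, V 1}"

lemma bound_nexp_le: "bound_nexp n \<Longrightarrow> \<nu> 0 + \<nu> 1 \<le> S \<Longrightarrow> 1 \<le> S \<Longrightarrow> nev n \<nu> \<le> S"
  unfolding bound_nexp_def by auto

lemma bound_nexp_wf: "bound_nexp n \<Longrightarrow> 3 \<le> L \<Longrightarrow> wfn L n"
  unfolding bound_nexp_def by auto

datatype binop = Plus | Minus | Times | Divide

primrec bop :: "binop \<Rightarrow> real \<Rightarrow> real \<Rightarrow> real" where
  "bop Plus x y = x + y"
| "bop Minus x y = x - y"
| "bop Times x y = x * y"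
| "bop Divide x y = x / y"

primrec rop :: "binop \<Rightarrow> rexp \<Rightarrow> rexp \<Rightarrow> rexp" where
  "rop Plus x y = RAdd x y"
| "rop Minus x y = RSub x y"
| "rop Times x y = RMul x y"
| "rop Divide x y = RDiv x y"

lemma rval_rop [simp]: "rval (rop o' e f) s = bop o' (rval e s) (rval f s)"
  by (cases o') auto

datatype xexp =
    XNat nexp
  | XIn nexp
  | XArr nat nexp nexp
  | XBin binop xexp xexp
  | XSum nat nexp xexp
  | XLess xexp xexp xexp xexp

text \<open>
  Array 0 is the evaluation stack of compiled code, so the arrays visible to expressions are shifted
  by one.  Reading an input cell beyond the input gives 0; this is tested at run time.
\<close>

primrec xval :: "xexp \<Rightarrow> (nat \<Rightarrow> nat) \<Rightarrow> (nat \<Rightarrow> real) \<Rightarrow> (nat \<Rightarrow> nat \<Rightarrow> nat \<Rightarrow> real) \<Rightarrow> real" where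
  "xval (XNat e) \<nu> I \<alpha> = real (nev e \<nu>)"
| "xval (XIn e) \<nu> I \<alpha> = (if nev e \<nu> < base \<nu> then I (nev e \<nu>) else 0)"
| "xval (XArr a e f) \<nu> I \<alpha> = \<alpha> a (nev e \<nu>) (nev f \<nu>)"
| "xval (XBin p e f) \<nu> I \<alpha> = bop p (xval e \<nu> I \<alpha>) (xval f \<nu> I \<alpha>)"
| "xval (XSum v n e) \<nu> I \<alpha> = (\<Sum>i<nev n \<nu>. xval e (\<nu>(v := i)) I \<alpha>)"
| "xval (XLess e f g h) \<nu> I \<alpha> =
     (if xval e \<nu> I \<alpha> < xval f \<nu> I \<alpha> then xval g \<nu> I \<alpha> else xval h \<nu> I \<alpha>)"

text \<open>The variable of a sum must equal the nesting level \<open>L\<close>, so nested sums use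
  distinct counters and none is overwritten while in use.\<close>

primrec wfx :: "nat \<Rightarrow> xexp \<Rightarrow> bool" where
  "wfx L (XNat e) = wfn L e"
| "wfx L (XIn e) = wfn L e"
| "wfx L (XArr a e f) = (wfn L e \<and> wfn L f)"
| "wfx L (XBin p e f) = (wfx L e \<and> wfx L f)"
| "wfx L (XSum v n e) = (v = L \<and> bound_nexp n \<and> wfx (Suc v) e)"
| "wfx L (XLess e f g h) = (wfx L e \<and> wfx L f \<and> wfx L g \<and> wfx L h)"

primrec arrays :: "xexp \<Rightarrow> nat set" where
  "arrays (XNat e) = {}"
| "arrays (XIn e) = {}"
| "arrays (XArr a e f) = {a}"
| "arrays (XBin p e f) = arrays e \<union> arrays f"
| "arrays (XSum v n e) = arrays e"
| "arrays (XLess e f g h) = arrays e \<union> arrays f \<union> arrays g \<union> arrays h"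

text \<open>Stack discipline: the result goes to \<open>Temp h\<close>, and intermediate results
  occupy levels from \<open>h\<close> upwards.\<close>

primrec xcomp :: "xexp \<Rightarrow> nat \<Rightarrow> com" where
  "xcomp (XNat e) h = RAssign (Temp h) (ROfNat e)"
| "xcomp (XIn e) h = Cond (NLess e NBase) (RAssign (Temp h) (RMem e)) (RAssign (Temp h) (ROfNat (NConst 0)))"
| "xcomp (XArr a e f) h = RAssign (Temp h) (RMem (NCell (Suc a) e f))"
| "xcomp (XBin p e f) h = Seq (xcomp e h) (Seq (xcomp f (Suc h))
     (RAssign (Temp h) (rop p (RMem (Temp h)) (RMem (Temp (Suc h))))))"
| "xcomp (XSum v n e) h = Seq (RAssign (Temp h) (ROfNat (NConst 0))) (Seq (NAssign (NConst v) (NConst 0))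
     (Loop (NLess (V v) n) (Seq (xcomp e (Suc h))
       (Seq (RAssign (Temp h) (RAdd (RMem (Temp h)) (RMem (Temp (Suc h)))))
            (NAssign (NConst v) (NAdd (V v) (NConst 1)))))))"
| "xcomp (XLess e f g g') h = Seq (xcomp e h) (Seq (xcomp f (Suc h))
     (Cond (RLess (RMem (Temp h)) (RMem (Temp (Suc h)))) (xcomp g h) (xcomp g' h)))"

primrec xtime :: "xexp \<Rightarrow> nat \<Rightarrow> nat" where
  "xtime (XNat e) S = 1"
| "xtime (XIn e) S = 2"
| "xtime (XArr a e f) S = 1"
| "xtime (XBin p e f) S = xtime e S + xtime f S + 1"
| "xtime (XSum v n e) S = 3 + S * (xtime e S + 3)"
| "xtime (XLess e f g h) S = xtime e S + xtime f S + (1 + xtime g S + xtime h S)"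

text \<open>\<open>inp\<close> and \<open>arr\<close> abstract a state to what expressions can see.
  The evaluation stack lies beyond \<open>base\<close> in array 0, so it is invisible to
  both.\<close>

definition inp :: "state \<Rightarrow> nat \<Rightarrow> real" where
  "inp s a = (if a < base (fst s) then snd s a else 0)"

definition arr :: "state \<Rightarrow> nat \<Rightarrow> nat \<Rightarrow> nat \<Rightarrow> real" where
  "arr s a i j = snd s (cell (fst s) (Suc a) i j)"

text \<open>The frame condition of compiled expressions. It keeps a left operand at level
  \<open>h\<close> intact while the right one is evaluated at \<open>Suc h\<close>.\<close>

definition agree :: "nat \<Rightarrow> nat \<Rightarrow> state \<Rightarrow> state \<Rightarrow> bool" where
  "agree L h s s' \<longleftrightarrow> (\<forall>v<L. fst s' v = fst s v) \<and>
     (\<forall>a. (\<forall>g\<ge>h. a \<noteq> cell (fst s) 0 g 0) \<longrightarrow> snd s' a = snd s a)"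

lemma base_cong: "\<nu> 0 = \<nu>' 0 \<Longrightarrow> \<nu> 1 = \<nu>' 1 \<Longrightarrow> base \<nu> = base \<nu>'"
  by (simp add: base_def)

lemma cell_cong: "\<nu> 0 = \<nu>' 0 \<Longrightarrow> \<nu> 1 = \<nu>' 1 \<Longrightarrow> cell \<nu> = cell \<nu>'"
  by (intro ext) (simp add: cell_def base_def)

lemma xval_cong:
  "wfx L e \<Longrightarrow> 3 \<le> L \<Longrightarrow> (\<And>v. v < L \<Longrightarrow> \<nu> v = \<nu>' v) \<Longrightarrow>
   (\<And>a. a \<in> arrays e \<Longrightarrow> \<alpha> a = \<alpha>' a) \<Longrightarrow> xval e \<nu> I \<alpha> = xval e \<nu>' I \<alpha>'"
proof (induction e arbitrary: \<nu> \<nu>' L)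
  case (XNat x)
  then show ?case using nev_cong[of L x \<nu> \<nu>'] by simp
next
  case (XIn x)
  then have "base \<nu> = base \<nu>'" by (intro base_cong) auto
  then show ?case using nev_cong[of L x \<nu> \<nu>'] XIn by simp
next
  case (XArr a e f)
  then show ?case using nev_cong[of L e \<nu> \<nu>'] nev_cong[of L f \<nu> \<nu>'] by simp
next
  case (XBin p e f)
  then show ?case by simp (metis)
next
  case (XSum v n e)
  have "nev n \<nu> = nev n \<nu>'"
    using XSum.prems by (intro nev_cong[of L]) (auto intro: bound_nexp_wf)
  moreover have "xval e (\<nu>(v := i)) I \<alpha> = xval e (\<nu>'(v := i)) I \<alpha>'" for i
    by (rule XSum.IH[of "Suc v"]) (use XSum.prems in \<open>auto simp: less_Suc_eq\<close>)
  ultimately show ?case by simp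
next
  case (XLess e f g h)
  have "xval e \<nu> I \<alpha> = xval e \<nu>' I \<alpha>'" "xval f \<nu> I \<alpha> = xval f \<nu>' I \<alpha>'"
    "xval g \<nu> I \<alpha> = xval g \<nu>' I \<alpha>'" "xval h \<nu> I \<alpha> = xval h \<nu>' I \<alpha>'"
    using XLess.prems
    by (auto intro!: XLess.IH[of L])
  then show ?case by simp
qed

lemma agree_refl [simp]: "agree L h s s" by (simp add: agree_def)

lemma agree_cell: "agree L h s s' \<Longrightarrow> 3 \<le> L \<Longrightarrow> cell (fst s') = cell (fst s)"
  unfolding agree_def by (intro cell_cong) auto

lemma agree_trans:
  "agree L h s s1 \<Longrightarrow> agree L' h' s1 s2 \<Longrightarrow> L \<le> L' \<Longrightarrow> h \<le> h' \<Longrightarrow> 3 \<le> L \<Longrightarrow> agree L h s s2"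
  using agree_cell[of L h s s1] unfolding agree_def by simp

lemma agree_absr:
  assumes "agree L h s s'" "3 \<le> L"
  shows "inp s' = inp s" "arr s' = arr s"
proof -
  have "base (fst s') = base (fst s)"
    using assms unfolding agree_def by (intro base_cong) auto
  then show "inp s' = inp s"
    using assms unfolding agree_def inp_def by (auto simp: fun_eq_iff cell_def)
  show "arr s' = arr s"
    using assms agree_cell[OF assms] unfolding agree_def arr_def by (auto simp: fun_eq_iff)
qed

lemma agree_xval:
  "agree L h s s' \<Longrightarrow> 3 \<le> L \<Longrightarrow> wfx L e \<Longrightarrow>
   xval e (fst s') (inp s') (arr s') = xval e (fst s) (inp s) (arr s)"
  by (simp add: agree_absr) (rule xval_cong[of L], auto simp: agree_def)

lemma agree_temp:
  "agree L h s s' \<Longrightarrow> 3 \<le> L \<Longrightarrow> g < h \<Longrightarrow> snd s' (cell (fst s') 0 g 0) = snd s (cell (fst s) 0 g 0)"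
  by (auto simp: agree_cell) (auto simp: agree_def)

text \<open>The invariant determines the guard, so the number of iterations is known in advance and
  a uniform bound \<open>T\<close> on the body suffices for the time.\<close>

lemma exec_counting_loop:
  assumes step: "\<And>i s. i < n \<Longrightarrow> I i s \<Longrightarrow> \<exists>t s'. exec c s t s' \<and> t \<le> T \<and> I (Suc i) s'"
    and I: "\<And>i s. I i s \<Longrightarrow> i \<le> n \<Longrightarrow> (holds b s \<longleftrightarrow> i < n)"
    and "I i s" "i \<le> n"
  shows "\<exists>t s'. exec (Loop b c) s t s' \<and> t \<le> 1 + (n - i) * (1 + T) \<and> I n s'"
  using \<open>i \<le> n\<close> \<open>I i s\<close>
proof (induction arbitrary: s rule: inc_induct)
  case base
  then have "\<not> holds b s" using I[of n s] by simp
  then have "exec (Loop b c) s 1 s" by (rule LoopFalse)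
  then show ?case using base by (intro exI[of _ 1] exI[of _ s]) simp
next
  case (step m)
  from step.hyps step.prems obtain t1 s1 where 1: "exec c s t1 s1" "t1 \<le> T" "I (Suc m) s1"
    using assms(1) by blast
  from step.IH[OF 1(3)] obtain t2 s2 where
    2: "exec (Loop b c) s1 t2 s2" "t2 \<le> 1 + (n - Suc m) * (1 + T)" "I n s2" by blast
  have "exec (Loop b c) s (1 + t1 + t2) s2"
    using I[of m s] step 1 2 by (intro LoopTrue) auto
  moreover have "n - m = Suc (n - Suc m)" using step.hyps by simp
  then have "1 + t1 + t2 \<le> 1 + (n - m) * (1 + T)" using 1 2 by simp
  ultimately show ?case using 2 by blast
qed

text \<open>Structural induction with scope, level and state generalised. Values of subexpressions
  are carried back to the initial state by \<open>agree_xval\<close>, since evaluation changes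
  neither the input nor the arrays. For a sum the loop invariant is the partial sum at level
  \<open>h\<close>.\<close>

lemma xcomp_correct:
  assumes "wfx L e" "3 \<le> L" "fst s 0 + fst s 1 \<le> S" "1 \<le> S"
  shows "\<exists>t s'. exec (xcomp e h) s t s' \<and> t \<le> xtime e S \<and> agree L h s s' \<and>
           snd s' (cell (fst s) 0 h 0) = xval e (fst s) (inp s) (arr s)"
  using assms
proof (induction e arbitrary: L h s)
  case (XNat x)
  show ?case
    by (intro exI[of _ 1] exI conjI, simp only: xcomp.simps, rule exec.RAssign)
       (auto simp: agree_def nval_nev)
next
  case (XIn x)
  let ?s' = "\<lambda>y. (fst s, (snd s)(cell (fst s) 0 h 0 := y))"
  have y: "exec (RAssign (Temp h) r) s 1 (?s' (rval r s))" for r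
    using exec.RAssign[of "Temp h" r s] by simp
  have a: "agree L h s (?s' y)" for y by (auto simp: agree_def)
  show ?case
  proof (cases "nev x (fst s) < base (fst s)")
    case True
    then have "exec (xcomp (XIn x) h) s (1 + 1) (?s' (rval (RMem x) s))"
      unfolding xcomp.simps by (intro exec.CondTrue y) (simp add: nval_nev)
    then show ?thesis using True a by (intro exI conjI) (auto simp: nval_nev inp_def)
  next
    case False
    then have "exec (xcomp (XIn x) h) s (1 + 1) (?s' (rval (ROfNat (NConst 0)) s))"
      unfolding xcomp.simps by (intro exec.CondFalse y) (simp add: nval_nev)
    then show ?thesis using False a by (intro exI conjI) auto
  qed
next
  case (XArr a e f)
  show ?case
    by (intro exI[of _ 1] exI conjI, simp only: xcomp.simps, rule exec.RAssign)
       (auto simp: agree_def nval_nev arr_def)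
next
  case (XBin p e f)
  from XBin.IH(1)[of L s h] XBin.prems obtain t1 s1 where
    1: "exec (xcomp e h) s t1 s1" "t1 \<le> xtime e S" "agree L h s s1"
       "snd s1 (cell (fst s) 0 h 0) = xval e (fst s) (inp s) (arr s)" by auto
  have c1: "cell (fst s1) = cell (fst s)" using 1 XBin.prems agree_cell by blast
  have "fst s1 0 + fst s1 1 \<le> S" using 1 XBin.prems by (auto simp: agree_def)
  from XBin.IH(2)[of L s1 "Suc h"] this XBin.prems obtain t2 s2 where
    2: "exec (xcomp f (Suc h)) s1 t2 s2" "t2 \<le> xtime f S" "agree L (Suc h) s1 s2"
       "snd s2 (cell (fst s1) 0 (Suc h) 0) = xval f (fst s1) (inp s1) (arr s1)" by auto
  have c2: "cell (fst s2) = cell (fst s)" using 2 XBin.prems agree_cell c1 by metis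
  have v2: "xval f (fst s1) (inp s1) (arr s1) = xval f (fst s) (inp s) (arr s)"
    using agree_xval[OF 1(3)] XBin.prems by simp
  have t2: "snd s2 (cell (fst s) 0 h 0) = snd s1 (cell (fst s) 0 h 0)"
    using agree_temp[OF 2(3), of h] XBin.prems c1 c2 by simp
  have a2: "agree L h s s2" using agree_trans[OF 1(3) 2(3)] XBin.prems by simp
  let ?s3 = "(fst s2, (snd s2)(cell (fst s) 0 h 0 := bop p (snd s2 (cell (fst s) 0 h 0)) (snd s2 (cell (fst s) 0 (Suc h) 0))))"
  have 3: "exec (RAssign (Temp h) (rop p (RMem (Temp h)) (RMem (Temp (Suc h))))) s2 1 ?s3"
    using exec.RAssign[of "Temp h" "rop p (RMem (Temp h)) (RMem (Temp (Suc h)))" s2] c2 by simp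
  have "agree L h s ?s3" using a2 by (auto simp: agree_def)
  moreover have "exec (xcomp (XBin p e f) h) s (t1 + (t2 + 1)) ?s3"
    using 1 2 3 unfolding xcomp.simps by (blast intro: exec.Seq)
  moreover have "t1 + (t2 + 1) \<le> xtime (XBin p e f) S" using 1 2 by simp
  ultimately show ?case using 1 2 v2 t2 c1 by (intro exI conjI) auto
next
  case (XSum v n e)
  let ?f = "\<lambda>i. xval e ((fst s)(v := i)) (inp s) (arr s)"
  let ?I = "\<lambda>i s'. agree v h s s' \<and> fst s' v = i \<and> snd s' (cell (fst s) 0 h 0) = (\<Sum>j<i. ?f j)"
  let ?c = "Seq (xcomp e (Suc h))
       (Seq (RAssign (Temp h) (RAdd (RMem (Temp h)) (RMem (Temp (Suc h)))))
            (NAssign (NConst v) (NAdd (V v) (NConst 1))))"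
  from XSum.prems have Lv: "L \<le> v" "3 \<le> v" "bound_nexp n" "wfx (Suc v) e" by auto
  let ?n = "nev n (fst s)"
  let ?s1 = "(fst s, (snd s)(cell (fst s) 0 h 0 := 0))"
  let ?s2 = "((fst s)(v := 0), (snd s)(cell (fst s) 0 h 0 := 0))"
  have "\<exists>t s'. exec (Loop (NLess (V v) n) ?c) ?s2 t s' \<and> t \<le> 1 + (?n - 0) * (1 + (xtime e S + 2)) \<and> ?I ?n s'"
  proof (rule exec_counting_loop[where I = ?I])
    fix i s1 assume i: "i < ?n" and I: "?I i s1"
    have "fst s1 0 + fst s1 1 \<le> S" using I XSum.prems Lv by (auto simp: agree_def)
    from XSum.IH[of "Suc v" s1 "Suc h"] this Lv XSum.prems obtain t s2 where
      2: "exec (xcomp e (Suc h)) s1 t s2" "t \<le> xtime e S" "agree (Suc v) (Suc h) s1 s2"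
       "snd s2 (cell (fst s1) 0 (Suc h) 0) = xval e (fst s1) (inp s1) (arr s1)" by auto
    have c1: "cell (fst s1) = cell (fst s)" using I Lv agree_cell by blast
    have c2: "cell (fst s2) = cell (fst s)" using 2 Lv agree_cell[OF 2(3)] c1 by simp
    have "xval e (fst s1) (inp s1) (arr s1) = ?f i"
      using I Lv by (auto simp: agree_absr intro!: xval_cong[of "Suc v"]) (auto simp: agree_def less_Suc_eq)
    with 2 c1 have v2: "snd s2 (cell (fst s) 0 (Suc h) 0) = ?f i" by simp
    have t2: "snd s2 (cell (fst s) 0 h 0) = snd s1 (cell (fst s) 0 h 0)"
      using agree_temp[OF 2(3), of h] Lv c1 c2 by simp
    let ?s3 = "(fst s2, (snd s2)(cell (fst s) 0 h 0 := (\<Sum>j<Suc i. ?f j)))"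
    let ?s4 = "((fst s2)(v := Suc i), (snd s2)(cell (fst s) 0 h 0 := (\<Sum>j<Suc i. ?f j)))"
    have 3: "exec (RAssign (Temp h) (RAdd (RMem (Temp h)) (RMem (Temp (Suc h))))) s2 1 ?s3"
      using exec.RAssign[of "Temp h" "RAdd (RMem (Temp h)) (RMem (Temp (Suc h)))" s2] c2 v2 t2 I by simp
    have "fst s2 v = i" using 2(3) I by (auto simp: agree_def)
    then have 4: "exec (NAssign (NConst v) (NAdd (V v) (NConst 1))) ?s3 1 ?s4"
      using exec.NAssign[of "NConst v" "NAdd (V v) (NConst 1)" ?s3] by simp
    have "agree v h s s2" using agree_trans[OF _ 2(3), of v h s] I Lv by simp
    then have "?I (Suc i) ?s4" by (auto simp: agree_def)
    moreover have "exec ?c s1 (t + (1 + 1)) ?s4" using 2 3 4 unfolding xcomp.simps by (blast intro: exec.Seq)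
    moreover have "t + (1 + 1) \<le> xtime e S + 2" using 2 by simp
    ultimately show "\<exists>t s'. exec ?c s1 t s' \<and> t \<le> xtime e S + 2 \<and> ?I (Suc i) s'" by blast
  next
    fix i s1 assume I: "?I i s1" and "i \<le> ?n"
    have "nev n (fst s1) = nev n (fst s)"
      using I bound_nexp_wf[OF Lv(3,2)] by (intro nev_cong) (auto simp: agree_def)
    then show "holds (NLess (V v) n) s1 \<longleftrightarrow> i < ?n" using I by (simp add: nval_nev)
  next
    show "?I 0 ?s2" by (auto simp: agree_def)
  qed simp
  then obtain t s' where L: "exec (Loop (NLess (V v) n) ?c) ?s2 t s'"
     "t \<le> 1 + ?n * (xtime e S + 3)" "?I ?n s'" by (auto simp: numeral_eq_Suc)
  have 1: "exec (RAssign (Temp h) (ROfNat (NConst 0))) s 1 ?s1"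
    using exec.RAssign[of "Temp h" "ROfNat (NConst 0)" s] by simp
  have 2: "exec (NAssign (NConst v) (NConst 0)) ?s1 1 ?s2"
    using exec.NAssign[of "NConst v" "NConst 0" ?s1] by simp
  have "exec (xcomp (XSum v n e) h) s (1 + (1 + t)) s'"
    using 1 2 L unfolding xcomp.simps by (blast intro: exec.Seq)
  moreover have "?n * (xtime e S + 3) \<le> S * (xtime e S + 3)"
    using bound_nexp_le[OF Lv(3), of "fst s" S] XSum.prems by (intro mult_right_mono) auto
  then have "1 + (1 + t) \<le> xtime (XSum v n e) S" unfolding xtime.simps using L(2) by linarith
  moreover have "agree L h s s'" using L Lv by (auto simp: agree_def)
  ultimately show ?case using L by (intro exI conjI) auto
next
  case (XLess e f g g')
  from XLess.IH(1)[of L s h] XLess.prems obtain t1 s1 where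
    1: "exec (xcomp e h) s t1 s1" "t1 \<le> xtime e S" "agree L h s s1"
       "snd s1 (cell (fst s) 0 h 0) = xval e (fst s) (inp s) (arr s)" by auto
  have c1: "cell (fst s1) = cell (fst s)" using 1 XLess.prems agree_cell by blast
  have "fst s1 0 + fst s1 1 \<le> S" using 1 XLess.prems by (auto simp: agree_def)
  from XLess.IH(2)[of L s1 "Suc h"] this XLess.prems obtain t2 s2 where
    2: "exec (xcomp f (Suc h)) s1 t2 s2" "t2 \<le> xtime f S" "agree L (Suc h) s1 s2"
       "snd s2 (cell (fst s1) 0 (Suc h) 0) = xval f (fst s1) (inp s1) (arr s1)" by auto
  have c2: "cell (fst s2) = cell (fst s)" using 2 XLess.prems agree_cell c1 by metis
  have v2: "xval f (fst s1) (inp s1) (arr s1) = xval f (fst s) (inp s) (arr s)"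
    using agree_xval[OF 1(3)] XLess.prems by simp
  have t2: "snd s2 (cell (fst s) 0 h 0) = snd s1 (cell (fst s) 0 h 0)"
    using agree_temp[OF 2(3), of h] XLess.prems c1 c2 by simp
  have a2: "agree L h s s2" using agree_trans[OF 1(3) 2(3)] XLess.prems by simp
  have S2: "fst s2 0 + fst s2 1 \<le> S" using a2 XLess.prems by (auto simp: agree_def)
  let ?b = "RLess (RMem (Temp h)) (RMem (Temp (Suc h)))"
  have b: "holds ?b s2 \<longleftrightarrow>
     xval e (fst s) (inp s) (arr s) < xval f (fst s) (inp s) (arr s)"
    using 1 2 c1 c2 t2 v2 by simp
  obtain t3 s3 where 3: "exec (Cond ?b (xcomp g h) (xcomp g' h)) s2 t3 s3"
     "t3 \<le> 1 + xtime g S + xtime g' S" "agree L h s2 s3"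
     "snd s3 (cell (fst s) 0 h 0) = xval (XLess e f g g') (fst s) (inp s) (arr s)"
  proof (cases "holds ?b s2")
    case True
    from XLess.IH(3)[of L s2 h] S2 XLess.prems obtain t s' where
      3: "exec (xcomp g h) s2 t s'" "t \<le> xtime g S" "agree L h s2 s'"
       "snd s' (cell (fst s2) 0 h 0) = xval g (fst s2) (inp s2) (arr s2)" by auto
    moreover have "xval g (fst s2) (inp s2) (arr s2) = xval g (fst s) (inp s) (arr s)"
      using agree_xval[OF a2] XLess.prems by simp
    moreover have "exec (Cond ?b (xcomp g h) (xcomp g' h)) s2 (1 + t) s'"
      using True 3(1) by (rule exec.CondTrue)
    ultimately show ?thesis using that[of "1 + t" s'] True b c2 by simp
  next
    case False
    from XLess.IH(4)[of L s2 h] S2 XLess.prems obtain t s' where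
      3: "exec (xcomp g' h) s2 t s'" "t \<le> xtime g' S" "agree L h s2 s'"
       "snd s' (cell (fst s2) 0 h 0) = xval g' (fst s2) (inp s2) (arr s2)" by auto
    moreover have "xval g' (fst s2) (inp s2) (arr s2) = xval g' (fst s) (inp s) (arr s)"
      using agree_xval[OF a2] XLess.prems by simp
    moreover have "exec (Cond ?b (xcomp g h) (xcomp g' h)) s2 (1 + t) s'"
      using False 3(1) by (rule exec.CondFalse)
    ultimately show ?thesis using that[of "1 + t" s'] False b c2 by simp
  qed
  have "exec (xcomp (XLess e f g g') h) s (t1 + (t2 + t3)) s3"
    using 1 2 3 unfolding xcomp.simps by (blast intro: exec.Seq)
  moreover have "t1 + (t2 + t3) \<le> xtime (XLess e f g g') S" using 1 2 3 by simp
  moreover have "agree L h s s3" using agree_trans[OF a2 3(3)] XLess.prems by simp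
  ultimately show ?case using 3 by blast
qed

section \<open>Array assignments and bounded loops\<close>

datatype stmt =
    Fill nat nexp nat nexp xexp
  | SSeq stmt stmt
  | SFor nat nexp stmt

primrec sval :: "stmt \<Rightarrow> (nat \<Rightarrow> nat) \<Rightarrow> (nat \<Rightarrow> real) \<Rightarrow> (nat \<Rightarrow> nat \<Rightarrow> nat \<Rightarrow> real) \<Rightarrow> nat \<Rightarrow> nat \<Rightarrow> nat \<Rightarrow> real" where
  "sval (Fill a r v n e) \<nu> I \<alpha> = \<alpha>(a := (\<alpha> a)(nev r \<nu> :=
     (\<lambda>i. if i < nev n \<nu> then xval e (\<nu>(v := i)) I \<alpha> else \<alpha> a (nev r \<nu>) i)))"
| "sval (SSeq c c') \<nu> I \<alpha> = sval c' \<nu> I (sval c \<nu> I \<alpha>)"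
| "sval (SFor v n c) \<nu> I \<alpha> = rec_nat \<alpha> (\<lambda>i. sval c (\<nu>(v := i)) I) (nev n \<nu>)"

text \<open>The condition \<open>a \<notin> arrays e\<close> makes entry-by-entry writing agree with
  the simultaneous assignment that \<open>sval\<close> describes.\<close>

primrec wfs :: "nat \<Rightarrow> stmt \<Rightarrow> bool" where
  "wfs L (Fill a r v n e) \<longleftrightarrow> v = L \<and> bound_nexp n \<and> wfn L r \<and> wfx (Suc L) e \<and> a \<notin> arrays e"
| "wfs L (SSeq c c') \<longleftrightarrow> wfs L c \<and> wfs L c'"
| "wfs L (SFor v n c) \<longleftrightarrow> v = L \<and> bound_nexp n \<and> wfs (Suc L) c"

primrec scomp :: "stmt \<Rightarrow> com" where
  "scomp (Fill a r v n e) = Seq (NAssign (NConst v) (NConst 0))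
     (Loop (NLess (V v) n) (Seq (xcomp e 0)
       (Seq (RAssign (NCell (Suc a) r (V v)) (RMem (Temp 0)))
            (NAssign (NConst v) (NAdd (V v) (NConst 1))))))"
| "scomp (SSeq c c') = Seq (scomp c) (scomp c')"
| "scomp (SFor v n c) = Seq (NAssign (NConst v) (NConst 0))
     (Loop (NLess (V v) n) (Seq (scomp c) (NAssign (NConst v) (NAdd (V v) (NConst 1)))))"

primrec stime :: "stmt \<Rightarrow> nat \<Rightarrow> nat" where
  "stime (Fill a r v n e) S = 2 + S * (xtime e S + 3)"
| "stime (SSeq c c') S = stime c S + stime c' S"
| "stime (SFor v n c) S = 2 + S * (stime c S + 2)"

definition sagree :: "nat \<Rightarrow> state \<Rightarrow> state \<Rightarrow> bool" where
  "sagree L s s' \<longleftrightarrow> (\<forall>v<L. fst s' v = fst s v) \<and> inp s' = inp s"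

lemma sagree_trans: "sagree L s s1 \<Longrightarrow> sagree L' s1 s2 \<Longrightarrow> L \<le> L' \<Longrightarrow> sagree L s s2"
  unfolding sagree_def by auto

lemma agree_sagree: "agree L h s s' \<Longrightarrow> 3 \<le> L \<Longrightarrow> sagree L s s'"
  unfolding sagree_def using agree_absr(1) by (auto simp: agree_def)

lemma sagree_cell: "sagree L s s' \<Longrightarrow> 3 \<le> L \<Longrightarrow> cell (fst s') = cell (fst s)"
  unfolding sagree_def by (intro cell_cong) auto

lemma sval_cong:
  "wfs L c \<Longrightarrow> 3 \<le> L \<Longrightarrow> (\<And>v. v < L \<Longrightarrow> \<nu> v = \<nu>' v) \<Longrightarrow> sval c \<nu> I \<alpha> = sval c \<nu>' I \<alpha>"
proof (induction c arbitrary: L \<nu> \<nu>' \<alpha>)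
  case (Fill a r v n e)
  have "nev n \<nu> = nev n \<nu>'" "nev r \<nu> = nev r \<nu>'"
    using Fill bound_nexp_wf[of n L] by (auto intro!: nev_cong[of L])
  moreover have "xval e (\<nu>(v := i)) I \<alpha> = xval e (\<nu>'(v := i)) I \<alpha>" for i
    by (rule xval_cong[of "Suc L"]) (use Fill in \<open>auto simp: less_Suc_eq\<close>)
  ultimately show ?case by (simp add: fun_eq_iff)
next
  case (SSeq c c')
  then show ?case
    using SSeq.IH(1)[of L \<nu> \<nu>' \<alpha>] SSeq.IH(2)[of L \<nu> \<nu>' "sval c \<nu>' I \<alpha>"] by simp
next
  case (SFor v n c)
  have n: "nev n \<nu> = nev n \<nu>'"
    using SFor.prems bound_nexp_wf[of n L] by (auto intro!: nev_cong[of L])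
  have "sval c (\<nu>(v := i)) I \<alpha> = sval c (\<nu>'(v := i)) I \<alpha>" for i \<alpha>
    by (rule SFor.IH[of "Suc L"]) (use SFor.prems in \<open>auto simp: less_Suc_eq\<close>)
  then have "(\<lambda>i. sval c (\<nu>(v := i)) I) = (\<lambda>i. sval c (\<nu>'(v := i)) I)" by (intro ext) auto
  then show ?case using n by simp
qed

lemma scomp_correct:
  assumes "wfs L c" "3 \<le> L" "fst s 0 + fst s 1 \<le> S" "1 \<le> S"
  shows "\<exists>t s'. exec (scomp c) s t s' \<and> t \<le> stime c S \<and> sagree L s s' \<and>
           arr s' = sval c (fst s) (inp s) (arr s)"
  using assms
proof (induction c arbitrary: L s)
  case (Fill a r v n e)
  then have wf: "v = L" "bound_nexp n" "wfn L r" "wfx (Suc L) e" "a \<notin> arrays e" by auto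
  let ?c = "Seq (xcomp e 0) (Seq (RAssign (NCell (Suc a) r (V v)) (RMem (Temp 0)))
            (NAssign (NConst v) (NAdd (V v) (NConst 1))))"
  let ?n = "nev n (fst s)" and ?r = "nev r (fst s)"
  let ?f = "\<lambda>i. xval e ((fst s)(v := i)) (inp s) (arr s)"
  let ?\<alpha> = "\<lambda>i. (arr s)(a := (arr s a)(?r := (\<lambda>j. if j < i then ?f j else arr s a ?r j)))"
  let ?I = "\<lambda>i s'. sagree L s s' \<and> fst s' v = i \<and> arr s' = ?\<alpha> i"
  let ?s0 = "((fst s)(v := 0), snd s)"
  have "\<exists>t s'. exec (Loop (NLess (V v) n) ?c) ?s0 t s' \<and> t \<le> 1 + (?n - 0) * (1 + (xtime e S + 2)) \<and> ?I ?n s'"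
  proof (rule exec_counting_loop[where I = ?I])
    fix i s1 assume i: "i < ?n" and I: "?I i s1"
    have "fst s1 0 + fst s1 1 \<le> S" using I Fill.prems by (auto simp: sagree_def)
    from xcomp_correct[OF wf(4), of s1 S 0] this Fill.prems obtain t s2 where
      2: "exec (xcomp e 0) s1 t s2" "t \<le> xtime e S" "agree (Suc L) 0 s1 s2"
       "snd s2 (cell (fst s1) 0 0 0) = xval e (fst s1) (inp s1) (arr s1)" by auto
    have c1: "cell (fst s1) = cell (fst s)" using I Fill.prems sagree_cell by blast
    have c2: "cell (fst s2) = cell (fst s)" using 2 Fill.prems agree_cell[OF 2(3)] c1 by simp
    have "xval e (fst s1) (inp s1) (arr s1) = xval e ((fst s)(v := i)) (inp s) (arr s1)"
      using I Fill.prems by (auto intro!: xval_cong[of "Suc L"] simp: sagree_def less_Suc_eq)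
    \<comment> \<open>The arrays at this point differ from the initial ones only in array
      \<open>a\<close>, which \<open>e\<close> does not read.\<close>
    also have "\<dots> = ?f i"
      by (rule xval_cong[of "Suc L"]) (use I wf Fill.prems in auto)
    finally have v2: "snd s2 (cell (fst s) 0 0 0) = ?f i" using 2 c1 by simp
    have r2: "nev r (fst s2) = ?r" 
      by (rule nev_cong[OF wf(3)]) (use 2(3) I in \<open>auto simp: agree_def sagree_def\<close>)
    have i2: "fst s2 v = i" using 2(3) I wf by (auto simp: agree_def)
    let ?m = "(snd s2)(cell (fst s) (Suc a) ?r i := ?f i)"
    let ?s3 = "(fst s2, ?m)" and ?s4 = "((fst s2)(v := Suc i), ?m)"
    have 3: "exec (RAssign (NCell (Suc a) r (V v)) (RMem (Temp 0))) s2 1 ?s3"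
      using exec.RAssign[of "NCell (Suc a) r (V v)" "RMem (Temp 0)" s2] c2 v2 r2 i2
      by (simp add: nval_nev)
    have 4: "exec (NAssign (NConst v) (NAdd (V v) (NConst 1))) ?s3 1 ?s4"
      using exec.NAssign[of "NConst v" "NAdd (V v) (NConst 1)" ?s3] i2 by simp
    have a2: "sagree L s s2" "arr s2 = ?\<alpha> i"
      using sagree_trans[of L s s1 "Suc L" s2] agree_sagree[OF 2(3)] agree_absr[OF 2(3)] I Fill.prems by auto
    have c4: "cell ((fst s2)(v := Suc i)) = cell (fst s)"
      using a2(1) wf Fill.prems by (intro cell_cong) (auto simp: sagree_def)
    have b4: "base ((fst s2)(v := Suc i)) = base (fst s2)"
      using wf Fill.prems by (intro base_cong) auto
    have b2: "base (fst s2) = base (fst s)"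
      using a2(1) wf Fill.prems by (intro base_cong) (auto simp: sagree_def)
    have "inp ?s4 = inp s2"
      unfolding inp_def using b4 b2 by (auto simp: fun_eq_iff cell_def)
    moreover have "arr ?s4 = ?\<alpha> (Suc i)"
    proof -
      have "arr ?s4 = (arr s2)(a := (arr s2 a)(?r := (arr s2 a ?r)(i := ?f i)))"
        by (auto simp: fun_eq_iff arr_def c4 c2)
      also have "\<dots> = ?\<alpha> (Suc i)" unfolding a2(2) by (auto simp: fun_eq_iff less_Suc_eq)
      finally show ?thesis .
    qed
    ultimately have "?I (Suc i) ?s4" using a2(1) wf by (auto simp: sagree_def)
    moreover have "exec ?c s1 (t + (1 + 1)) ?s4" using 2 3 4 unfolding scomp.simps by (blast intro: exec.Seq)
    moreover have "t + (1 + 1) \<le> xtime e S + 2" using 2 by simp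
    ultimately show "\<exists>t s'. exec ?c s1 t s' \<and> t \<le> xtime e S + 2 \<and> ?I (Suc i) s'" by blast
  next
    fix i s1 assume I: "?I i s1" and "i \<le> ?n"
    have "nev n (fst s1) = nev n (fst s)"
      using I bound_nexp_wf[OF wf(2) Fill.prems(2)] by (intro nev_cong) (auto simp: sagree_def)
    then show "holds (NLess (V v) n) s1 \<longleftrightarrow> i < ?n" using I by (simp add: nval_nev)
  next
    have "base ((fst s)(v := 0)) = base (fst s)" "cell ((fst s)(v := 0)) = cell (fst s)"
      using wf Fill.prems by (auto intro!: base_cong cell_cong)
    then show "?I 0 ?s0" using wf by (auto simp: sagree_def inp_def arr_def fun_eq_iff)
  qed simp
  then obtain t s' where L: "exec (Loop (NLess (V v) n) ?c) ?s0 t s'"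
     "t \<le> 1 + ?n * (xtime e S + 3)" "?I ?n s'" by (auto simp: numeral_eq_Suc)
  have 2: "exec (NAssign (NConst v) (NConst 0)) s 1 ?s0"
    using exec.NAssign[of "NConst v" "NConst 0" s] by simp
  have "exec (scomp (Fill a r v n e)) s (1 + t) s'"
    using 2 L(1) unfolding scomp.simps by (blast intro: exec.Seq)
  moreover have "?n * (xtime e S + 3) \<le> S * (xtime e S + 3)"
    using bound_nexp_le[OF wf(2), of "fst s" S] Fill.prems by (intro mult_right_mono) auto
  then have "1 + t \<le> stime (Fill a r v n e) S" unfolding stime.simps using L(2) by linarith
  ultimately show ?case using L by (intro exI conjI) auto
next
  case (SSeq c c')
  from SSeq.IH(1)[of L s] SSeq.prems obtain t1 s1 where
    1: "exec (scomp c) s t1 s1" "t1 \<le> stime c S" "sagree L s s1" "arr s1 = sval c (fst s) (inp s) (arr s)" by auto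
  have "fst s1 0 + fst s1 1 \<le> S" using 1 SSeq.prems by (auto simp: sagree_def)
  from SSeq.IH(2)[of L s1] this SSeq.prems obtain t2 s2 where
    2: "exec (scomp c') s1 t2 s2" "t2 \<le> stime c' S" "sagree L s1 s2" "arr s2 = sval c' (fst s1) (inp s1) (arr s1)" by auto
  have "sval c' (fst s1) (inp s1) (arr s1) = sval c' (fst s) (inp s) (arr s1)"
    using 1(3) SSeq.prems by (auto simp: sagree_def intro!: sval_cong[of L])
  moreover have "exec (scomp (SSeq c c')) s (t1 + t2) s2" using 1 2 by (auto intro: exec.Seq)
  ultimately show ?case using 1 2 sagree_trans[OF 1(3) 2(3)] by (intro exI conjI) auto
next
  case (SFor v n c)
  then have wf: "v = L" "bound_nexp n" "wfs (Suc L) c" by auto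
  let ?c = "Seq (scomp c) (NAssign (NConst v) (NAdd (V v) (NConst 1)))"
  let ?n = "nev n (fst s)"
  let ?\<alpha> = "rec_nat (arr s) (\<lambda>i. sval c ((fst s)(v := i)) (inp s))"
  let ?I = "\<lambda>i s'. sagree L s s' \<and> fst s' v = i \<and> arr s' = ?\<alpha> i"
  let ?s0 = "((fst s)(v := 0), snd s)"
  have set_v: "sagree L s' ((fst s')(v := i), snd s')" "arr ((fst s')(v := i), snd s') = arr s'" for s' i
  proof -
    have "base ((fst s')(v := i)) = base (fst s')" "cell ((fst s')(v := i)) = cell (fst s')"
      using wf SFor.prems by (auto intro!: base_cong cell_cong)
    then show "sagree L s' ((fst s')(v := i), snd s')" "arr ((fst s')(v := i), snd s') = arr s'"
      using wf by (auto simp: sagree_def inp_def arr_def fun_eq_iff)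
  qed
  have "\<exists>t s'. exec (Loop (NLess (V v) n) ?c) ?s0 t s' \<and> t \<le> 1 + (?n - 0) * (1 + (stime c S + 1)) \<and> ?I ?n s'"
  proof (rule exec_counting_loop[where I = ?I])
    fix i s1 assume i: "i < ?n" and I: "?I i s1"
    have "fst s1 0 + fst s1 1 \<le> S" using I SFor.prems by (auto simp: sagree_def)
    from SFor.IH[OF wf(3), of s1] this SFor.prems obtain t s2 where
      2: "exec (scomp c) s1 t s2" "t \<le> stime c S" "sagree (Suc L) s1 s2"
       "arr s2 = sval c (fst s1) (inp s1) (arr s1)" by auto
    have "sval c (fst s1) (inp s1) (arr s1) = sval c ((fst s)(v := i)) (inp s) (arr s1)"
      using I SFor.prems by (auto simp: sagree_def less_Suc_eq intro!: sval_cong[of "Suc L"])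
    then have a2: "arr s2 = ?\<alpha> (Suc i)" using 2 I by simp
    have i2: "fst s2 v = i" using 2(3) I wf by (auto simp: sagree_def)
    let ?s3 = "((fst s2)(v := Suc i), snd s2)"
    have 3: "exec (NAssign (NConst v) (NAdd (V v) (NConst 1))) s2 1 ?s3"
      using exec.NAssign[of "NConst v" "NAdd (V v) (NConst 1)" s2] i2 by simp
    have "sagree L s s2" using sagree_trans[OF _ 2(3)] I by simp
    then have "?I (Suc i) ?s3" using set_v[of s2 "Suc i"] a2 sagree_trans[of L s s2 L] by auto
    moreover have "exec ?c s1 (t + 1) ?s3" using 2 3 unfolding scomp.simps by (blast intro: exec.Seq)
    moreover have "t + 1 \<le> stime c S + 1" using 2 by simp
    ultimately show "\<exists>t s'. exec ?c s1 t s' \<and> t \<le> stime c S + 1 \<and> ?I (Suc i) s'" by blast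
  next
    fix i s1 assume I: "?I i s1" and "i \<le> ?n"
    have "nev n (fst s1) = nev n (fst s)"
      using I bound_nexp_wf[OF wf(2) SFor.prems(2)] by (intro nev_cong) (auto simp: sagree_def)
    then show "holds (NLess (V v) n) s1 \<longleftrightarrow> i < ?n" using I by (simp add: nval_nev)
  next
    show "?I 0 ?s0" using set_v[of s 0] by auto
  qed simp
  then obtain t s' where L: "exec (Loop (NLess (V v) n) ?c) ?s0 t s'"
     "t \<le> 1 + ?n * (stime c S + 2)" "?I ?n s'" by (auto simp: numeral_eq_Suc)
  have 2: "exec (NAssign (NConst v) (NConst 0)) s 1 ?s0"
    using exec.NAssign[of "NConst v" "NConst 0" s] by simp
  have "exec (scomp (SFor v n c)) s (1 + t) s'"
    using 2 L(1) unfolding scomp.simps by (blast intro: exec.Seq)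
  moreover have "?n * (stime c S + 2) \<le> S * (stime c S + 2)"
    using bound_nexp_le[OF wf(2), of "fst s" S] SFor.prems by (intro mult_right_mono) auto
  then have "1 + t \<le> stime (SFor v n c) S" unfolding stime.simps using L(2) by linarith
  ultimately show ?case using L by (intro exI conjI) auto
qed

text \<open>Rows are filled one after another, but \<open>e\<close> does not read the target array,
  so the result is the simultaneous assignment of the whole matrix.\<close>

lemma sval_matrix:
  assumes "a \<notin> arrays e" "wfx (Suc (Suc L)) e" "3 \<le> L" "wfn L m" "wfn L n" "m \<noteq> V L"
  shows "sval (SFor L n (Fill a (V L) (Suc L) m e)) \<nu> I \<alpha> =
     \<alpha>(a := (\<lambda>r c. if r < nev n \<nu> \<and> c < nev m \<nu> then xval e (\<nu>(L := r, Suc L := c)) I \<alpha> else \<alpha> a r c))"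
proof -
  have m: "nev m (\<nu>(L := i)) = nev m \<nu>" for i
    by (rule nev_cong[OF assms(4)]) auto
  have "rec_nat \<alpha> (\<lambda>i. sval (Fill a (V L) (Suc L) m e) (\<nu>(L := i)) I) N =
     \<alpha>(a := (\<lambda>r c. if r < N \<and> c < nev m \<nu> then xval e (\<nu>(L := r, Suc L := c)) I \<alpha> else \<alpha> a r c))"
    for N
  proof (induction N)
    case (Suc N)
    have "xval e (\<nu>(L := N, Suc L := i)) I (\<alpha>(a := \<beta>)) = xval e (\<nu>(L := N, Suc L := i)) I \<alpha>" for \<beta> i
      by (rule xval_cong[of "Suc (Suc L)"]) (use assms in auto)
    then show ?case unfolding nat.rec Suc.IH
      by (auto simp: m fun_eq_iff less_Suc_eq)
  qed (auto simp: fun_eq_iff)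
  then show ?thesis by simp
qed

section \<open>Polynomial bounds on running time\<close>

definition poly_bounded :: "(nat \<Rightarrow> nat) \<Rightarrow> bool" where
  "poly_bounded f \<longleftrightarrow> (\<exists>a b. \<forall>S\<ge>1. f S \<le> a * S ^ b)"

lemma poly_bounded_const: "poly_bounded (\<lambda>_. c)"
  unfolding poly_bounded_def by (intro exI[of _ c] exI[of _ 0]) simp

lemma poly_bounded_id: "poly_bounded (\<lambda>S. S)"
  unfolding poly_bounded_def by (intro exI[of _ 1] exI[of _ 1]) simp

lemma poly_bounded_add:
  assumes "poly_bounded f" "poly_bounded g"
  shows "poly_bounded (\<lambda>S. f S + g S)"
proof -
  from assms obtain a b a' b' where f: "\<And>S. S \<ge> 1 \<Longrightarrow> f S \<le> a * S ^ b"
    and g: "\<And>S. S \<ge> 1 \<Longrightarrow> g S \<le> a' * S ^ b'" unfolding poly_bounded_def by blast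
  have "f S + g S \<le> (a + a') * S ^ (b + b')" if "S \<ge> 1" for S
  proof -
    have "S ^ b \<le> S ^ (b + b')" "S ^ b' \<le> S ^ (b + b')" using that by (auto intro!: power_increasing)
    then have "a * S ^ b + a' * S ^ b' \<le> a * S ^ (b + b') + a' * S ^ (b + b')"
      by (intro add_mono mult_left_mono) auto
    then show ?thesis using f[OF that] g[OF that] by (simp add: algebra_simps)
  qed
  then show ?thesis unfolding poly_bounded_def by blast
qed

lemma poly_bounded_mult:
  assumes "poly_bounded f" "poly_bounded g"
  shows "poly_bounded (\<lambda>S. f S * g S)"
proof -
  from assms obtain a b a' b' where f: "\<And>S. S \<ge> 1 \<Longrightarrow> f S \<le> a * S ^ b"
    and g: "\<And>S. S \<ge> 1 \<Longrightarrow> g S \<le> a' * S ^ b'" unfolding poly_bounded_def by blast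
  have "f S * g S \<le> (a * a') * S ^ (b + b')" if "S \<ge> 1" for S
    using mult_mono[OF f[OF that] g[OF that]] by (simp add: power_add mult_ac)
  then show ?thesis unfolding poly_bounded_def by blast
qed

lemmas poly_bounded_intros =
  poly_bounded_const poly_bounded_id poly_bounded_add poly_bounded_mult

lemma poly_bounded_xtime: "poly_bounded (xtime e)"
proof (induction e)
  case (XNat x) show ?case unfolding xtime.simps by (rule poly_bounded_const)
next
  case (XIn x) show ?case unfolding xtime.simps by (rule poly_bounded_const)
next
  case (XArr a e f) show ?case unfolding xtime.simps by (rule poly_bounded_const)
qed (simp only: xtime.simps; intro poly_bounded_intros; assumption)+

lemma poly_bounded_stime: "poly_bounded (stime c)"
proof (induction c)
  case (Fill a r v n e)
  show ?case unfolding stime.simps by (intro poly_bounded_intros poly_bounded_xtime)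
qed (simp only: stime.simps; intro poly_bounded_intros; assumption)+

section \<open>The program\<close>

abbreviation "xadd \<equiv> XBin Plus"
abbreviation "xsub \<equiv> XBin Minus"
abbreviation "xmul \<equiv> XBin Times"
abbreviation "xdiv \<equiv> XBin Divide"
abbreviation xnum :: "nat \<Rightarrow> xexp" where "xnum n \<equiv> XNat (NConst n)"
abbreviation xvar :: "nat \<Rightarrow> xexp" where "xvar v \<equiv> XNat (V v)"

text \<open>
  Variables 0, 1, 2 hold \<open>d\<close>, \<open>N\<close>, \<open>k\<close>, and higher variables are loop indices, numbered by nesting depth.
\<close>

definition xpoint :: "nat \<Rightarrow> nexp \<Rightarrow> xexp" where
  "xpoint i j = XIn (NAdd (NAdd (NConst 2) (NMul (V i) (V 0))) j)"

definition xeps :: "nat \<Rightarrow> xexp" where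
  "xeps c = xmul (xmul (xnum c) (XIn (NConst 0))) (xvar 1)"

definition xdelta :: "nat \<Rightarrow> nat \<Rightarrow> xexp" where
  "xdelta a b = XLess (xvar a) (xvar b) (xnum 0) (XLess (xvar b) (xvar a) (xnum 0) (xnum 1))"

text \<open>\<open>F\<close> maps a variable number to an expression, so the same key can be
  evaluated both at index \<open>j\<close> and at the summation variable \<open>L\<close>. Ranks are
  recomputed at every use, which costs only a polynomial factor.\<close>

definition xtop :: "nat \<Rightarrow> nexp \<Rightarrow> xexp \<Rightarrow> (nat \<Rightarrow> xexp) \<Rightarrow> nat \<Rightarrow> xexp" where
  "xtop L n k F j = XLess (XSum L n (XLess (F j) (F L) (xnum 1) (XLess (F L) (F j) (xnum 0)
     (XLess (xvar L) (xvar j) (xnum 1) (xnum 0))))) k (xnum 1) (xnum 0)"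

abbreviation (input) "aW \<equiv> 0 :: nat"
abbreviation (input) "aU \<equiv> 1 :: nat"
abbreviation (input) "aM \<equiv> 2 :: nat"
abbreviation (input) "aQ \<equiv> 3 :: nat"
abbreviation (input) "aA \<equiv> 4 :: nat"
abbreviation (input) "aP \<equiv> 5 :: nat"
abbreviation (input) "aG \<equiv> 6 :: nat"
abbreviation (input) "aX \<equiv> 7 :: nat"
abbreviation (input) "aWN \<equiv> 8 :: nat"
abbreviation (input) "aKEY \<equiv> 9 :: nat"
abbreviation (input) "aDE \<equiv> 10 :: nat"
abbreviation (input) "aOUT \<equiv> 11 :: nat"

abbreviation xrow :: "nat \<Rightarrow> nat \<Rightarrow> xexp" where "xrow a i \<equiv> XArr a (NConst 0) (V i)"
abbreviation xent :: "nat \<Rightarrow> nat \<Rightarrow> nat \<Rightarrow> xexp" where "xent a i j \<equiv> XArr a (V i) (V j)"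

text \<open>A fill may not read its own target, so updated weights pass through \<open>aWN\<close>
  and are copied back in the next iteration. The comparison with 0 supplies the initial weights 1
  when \<open>t = 0\<close>.\<close>

definition "codeW = Fill aW (V 3) 4 (V 1) (XLess (xnum 0) (xvar 3) (xrow aWN 4) (xnum 1))"

definition "codeU = Fill aU (V 3) 4 (V 0)
  (xdiv (XSum 5 (V 1) (xmul (xent aW 3 5) (xpoint 5 (V 4)))) (XSum 5 (V 1) (xent aW 3 5)))"

definition "codeM = SFor 4 (V 0) (Fill aM (V 4) 5 (V 0)
  (xsub (xdiv (XSum 6 (V 1) (xmul (xent aW 3 6)
      (xmul (xsub (xpoint 6 (V 4)) (xent aU 3 4)) (xsub (xpoint 6 (V 5)) (xent aU 3 5)))))
    (XSum 6 (V 1) (xent aW 3 6))) (xdelta 4 5)))"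

definition xsq :: "xexp \<Rightarrow> xexp" where "xsq e = xmul e e"

definition "codeQ = Fill aQ (NConst 0) 4 (V 0)
  (XSum 5 (V 0) (xmul (xtop 6 (V 0) (xvar 2) (\<lambda>v. xsq (xent aM 4 v)) 5) (xsq (xent aM 4 5))))"

definition "codeA = SFor 4 (V 0) (Fill aA (V 4) 5 (V 0)
  (xmul (xtop 6 (V 0) (xvar 2) (xrow aQ) 4)
    (xmul (xtop 6 (V 0) (xvar 2) (\<lambda>v. xsq (xent aM 4 v)) 5) (xent aM 4 5))))"

definition "codeP = Fill aP (NConst 0) 4 (V 1)
  (XSum 5 (V 0) (XSum 6 (V 0) (xmul (xent aA 5 6)
    (xsub (xmul (xsub (xpoint 4 (V 5)) (xent aU 3 5)) (xsub (xpoint 4 (V 6)) (xent aU 3 6))) (xdelta 5 6)))))"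

definition "codeG = Fill aG (NConst 0) 4 (V 1)
  (XLess (xnum 0) (xent aW 3 4) (XLess (xnum 0) (xrow aP 4)
    (XLess (xeps 3) (XSum 5 (V 1) (XLess (xrow aP 5) (xrow aP 4) (xnum 0) (xent aW 3 5)))
      (xnum 0) (xrow aP 4)) (xnum 0)) (xnum 0))"

definition "codeX = Fill aX (NConst 0) 4 (NConst 1)
  (XSum 5 (V 1) (xmul (xtop 6 (V 1) (xnum 1) (xrow aG) 5) (xrow aG 5)))"

definition "codeWN = Fill aWN (NConst 0) 4 (V 1)
  (xmul (xent aW 3 4) (xsub (xnum 1) (xdiv (xrow aG 4) (XArr aX (NConst 0) (NConst 0)))))"

definition "codeKEY = Fill aKEY (V 3) 4 (NConst 1)
  (XLess (xeps 2) (XSum 5 (V 1) (xsub (xnum 1) (xent aW 3 5))) (xnum 0)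
    (xdiv (xnum 1) (xadd (xnum 1) (XSum 5 (V 0) (xmul (xtop 6 (V 0) (xvar 2) (xrow aQ) 5) (xrow aQ 5))))))"

definition "code_step = SSeq codeW (SSeq codeU (SSeq codeM (SSeq codeQ (SSeq codeA (SSeq codeP
  (SSeq codeG (SSeq codeX (SSeq codeWN codeKEY))))))))"

definition xcentral :: xexp where
  "xcentral = XLess (xeps 2) (XSum 5 (V 1) (XLess (xpoint 5 (NConst 0)) (xpoint 4 (NConst 0)) (xnum 0) (xnum 1)))
     (XLess (xeps 2) (XSum 5 (V 1) (XLess (xpoint 4 (NConst 0)) (xpoint 5 (NConst 0)) (xnum 0) (xnum 1))) (xnum 1) (xnum 0))
     (xnum 0)"

definition "codeDE = Fill aDE (NConst 0) 3 (V 0)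
  (XLess (xvar 0) (xnum 2)
    (xdiv (XSum 4 (V 1) (xmul xcentral (xpoint 4 (V 3)))) (XSum 4 (V 1) xcentral))
    (XSum 4 (V 1) (xmul (xtop 5 (V 1) (xnum 1) (\<lambda>v. XArr aKEY (V v) (NConst 0)) 4) (xent aU 4 3))))"

definition "codeOUT = Fill aOUT (NConst 0) 3 (V 0)
  (xmul (xtop 4 (V 0) (xvar 2) (\<lambda>v. xsq (xrow aDE v)) 3) (xrow aDE 3))"

definition "code = SSeq (SFor 3 (V 1) code_step) (SSeq codeDE codeOUT)"

lemmas code_defs = code_def code_step_def codeW_def codeU_def codeM_def codeQ_def codeA_def codeP_def
  codeG_def codeX_def codeWN_def codeKEY_def codeDE_def codeOUT_def
  xpoint_def xeps_def xdelta_def xtop_def xsq_def xcentral_def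

lemma wfs_code: "wfs 3 code"
  by (simp add: code_defs bound_nexp_def)

section \<open>Values computed by the program\<close>

locale code_input =
  fixes d N k :: nat and \<epsilon> :: real and y :: "nat \<Rightarrow> nat \<Rightarrow> real" and I :: "nat \<Rightarrow> real"
  assumes eps: "I 0 = \<epsilon>" and point: "\<And>i j. i < N \<Longrightarrow> j < d \<Longrightarrow> I (2 + i * d + j) = y i j"
    and d_pos: "0 < d"
begin

definition vars :: "nat \<Rightarrow> nat" where "vars = (\<lambda>_. 0)(0 := d, 1 := N, 2 := k)"

lemma xval_point:
  assumes "\<nu> 0 = d" "\<nu> 1 = N" "\<nu> i < N" "nev j \<nu> < d"
  shows "xval (xpoint i j) \<nu> I \<alpha> = y (\<nu> i) (nev j \<nu>)"
proof -
  have "\<nu> i * d + nev j \<nu> < \<nu> i * d + d" using assms by simp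
  also have "\<dots> \<le> N * d" using mult_le_mono1[of "Suc (\<nu> i)" N d] assms(3) by (simp add: Suc_le_eq)
  finally show ?thesis using assms point[of "\<nu> i" "nev j \<nu>"] by (simp add: xpoint_def base_def)
qed

lemma xval_eps: "\<nu> 1 = N \<Longrightarrow> xval (xeps c) \<nu> I \<alpha> = real c * \<epsilon> * real N"
  by (simp add: xeps_def base_def eps)

lemma xval_delta: "xval (xdelta a b) \<nu> I \<alpha> = (if \<nu> a = \<nu> b then 1 else 0)"
  by (simp add: xdelta_def)

lemma xval_sq: "xval (xsq e) \<nu> I \<alpha> = (xval e \<nu> I \<alpha>)\<^sup>2"
  by (simp add: xsq_def power2_eq_square)

lemma xval_top:
  assumes "\<And>l. l < nev n \<nu> \<Longrightarrow> xval (F j) (\<nu>(L := l)) I \<alpha> = f (\<nu> j)"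
    "\<And>l. l < nev n \<nu> \<Longrightarrow> xval (F L) (\<nu>(L := l)) I \<alpha> = f l"
    "xval K \<nu> I \<alpha> = real \<kappa>" "j \<noteq> L"
  shows "xval (xtop L n K F j) \<nu> I \<alpha> = topmask (nev n \<nu>) \<kappa> f (\<nu> j)"
proof -
  have "(\<Sum>i<nev n \<nu>. xval (XLess (F j) (F L) (xnum 1) (XLess (F L) (F j) (xnum 0) (XLess (xvar L) (xvar j) (xnum 1) (xnum 0)))) (\<nu>(L := i)) I \<alpha>)
     = rank (nev n \<nu>) f (\<nu> j)"
    unfolding rank_def using assms by (intro sum.cong) auto
  then show ?thesis using assms(3) unfolding xtop_def topmask_def by simp
qed

abbreviation "M w \<equiv> excess_cov N w y"

context
  fixes t :: nat and \<alpha> :: "nat \<Rightarrow> nat \<Rightarrow> nat \<Rightarrow> real" and w :: "nat \<Rightarrow> real"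
  assumes t: "t < N"
begin

abbreviation "\<nu> \<equiv> vars(3 := t)"

lemma eval_U:
  assumes "\<And>i. i < N \<Longrightarrow> \<alpha> aW t i = w i"
  shows "sval codeU \<nu> I \<alpha> = \<alpha>(aU := (\<alpha> aU)(t := (\<lambda>j. if j < d then wmean N w y j else \<alpha> aU t j)))"
  using assms by (simp add: codeU_def vars_def xval_point wmean_def fun_eq_iff cong: sum.cong_simp if_cong)

lemma sval_matrix4:
  assumes "a \<notin> arrays e" "wfx 6 e" "wfn 4 m" "wfn 4 n"
  shows "sval (SFor 4 n (Fill a (V 4) 5 m e)) \<rho> I \<beta> =
     \<beta>(a := (\<lambda>r c. if r < nev n \<rho> \<and> c < nev m \<rho> then xval e (\<rho>(4 := r, 5 := c)) I \<beta> else \<beta> a r c))"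
proof -
  have "m \<noteq> V 4" using assms(3) by auto
  have S: "Suc 4 = (5 :: nat)" "Suc 5 = (6 :: nat)" by simp_all
  show ?thesis
    by (rule sval_matrix[of a e 4 m n \<rho> I \<beta>, unfolded S]) (use assms \<open>m \<noteq> V 4\<close> in auto)
qed

lemma eval_M:
  assumes "\<And>i. i < N \<Longrightarrow> \<alpha> aW t i = w i" "\<And>j. j < d \<Longrightarrow> \<alpha> aU t j = wmean N w y j"
  shows "sval codeM \<nu> I \<alpha> = \<alpha>(aM := (\<lambda>r c. if r < d \<and> c < d then M w r c else \<alpha> aM r c))"
proof -
  have "sval codeM \<nu> I \<alpha> = \<alpha>(aM := (\<lambda>r c. if r < nev (V 0) \<nu> \<and> c < nev (V 0) \<nu> then xval (xsub (xdiv (XSum 6 (V 1) (xmul (xent aW 3 6)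
      (xmul (xsub (xpoint 6 (V 4)) (xent aU 3 4)) (xsub (xpoint 6 (V 5)) (xent aU 3 5)))))
    (XSum 6 (V 1) (xent aW 3 6))) (xdelta 4 5)) (\<nu>(4 := r, 5 := c)) I \<alpha> else \<alpha> aM r c))"
    unfolding codeM_def by (rule sval_matrix4) (simp_all add: xpoint_def xdelta_def bound_nexp_def)
  then show ?thesis using assms
    by (simp add: vars_def xval_point xval_delta excess_cov_def fun_eq_iff cong: sum.cong_simp if_cong conj_cong)
qed

lemma eval_Q:
  assumes "\<And>r c. r < d \<Longrightarrow> c < d \<Longrightarrow> \<alpha> aM r c = M w r c"
  shows "sval codeQ \<nu> I \<alpha> = \<alpha>(aQ := (\<alpha> aQ)(0 := (\<lambda>r. if r < d then rownorm d k (M w) r else \<alpha> aQ 0 r)))"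
proof -
  have "xval (xtop 6 (V 0) (xvar 2) (\<lambda>v. xsq (xent aM 4 v)) 5) (\<nu>(4 := r, 5 := c)) I \<alpha> = topmask d k (\<lambda>c. (M w r c)\<^sup>2) c"
    if "r < d" "c < d" for r c
    using xval_top[where \<nu> = "\<nu>(4 := r, 5 := c)" and L = 6 and j = 5 and n = "V 0" and f = "\<lambda>c. (M w r c)\<^sup>2" and \<kappa> = k
      and F = "\<lambda>v. xsq (xent aM 4 v)" and K = "xvar 2" and \<alpha> = \<alpha>] that assms
    by (simp add: vars_def xval_sq)
  then show ?thesis using assms
    by (simp add: codeQ_def vars_def xval_sq rownorm_def fun_eq_iff cong: sum.cong_simp if_cong)
qed

lemma eval_A:
  assumes "\<And>r c. r < d \<Longrightarrow> c < d \<Longrightarrow> \<alpha> aM r c = M w r c" "\<And>r. r < d \<Longrightarrow> \<alpha> aQ 0 r = rownorm d k (M w) r"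
  shows "sval codeA \<nu> I \<alpha> = \<alpha>(aA := (\<lambda>r c. if r < d \<and> c < d then selected d k (M w) r c else \<alpha> aA r c))"
proof -
  have 1: "xval (xtop 6 (V 0) (xvar 2) (\<lambda>v. xsq (xent aM 4 v)) 5) (\<nu>(4 := r, 5 := c)) I \<alpha> = topmask d k (\<lambda>c. (M w r c)\<^sup>2) c"
    if "r < d" "c < d" for r c
    using xval_top[where \<nu> = "\<nu>(4 := r, 5 := c)" and L = 6 and j = 5 and n = "V 0" and f = "\<lambda>c. (M w r c)\<^sup>2" and \<kappa> = k
      and F = "\<lambda>v. xsq (xent aM 4 v)" and K = "xvar 2" and \<alpha> = \<alpha>] that assms
    by (simp add: vars_def xval_sq)
  have 2: "xval (xtop 6 (V 0) (xvar 2) (xrow aQ) 4) (\<nu>(4 := r, 5 := c)) I \<alpha> = topmask d k (rownorm d k (M w)) r"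
    if "r < d" "c < d" for r c
    using xval_top[where \<nu> = "\<nu>(4 := r, 5 := c)" and L = 6 and j = 4 and n = "V 0" and f = "rownorm d k (M w)" and \<kappa> = k
      and F = "xrow aQ" and K = "xvar 2" and \<alpha> = \<alpha>] that assms
    by (simp add: vars_def)
  have "sval codeA \<nu> I \<alpha> = \<alpha>(aA := (\<lambda>r c. if r < nev (V 0) \<nu> \<and> c < nev (V 0) \<nu> then
      xval (xmul (xtop 6 (V 0) (xvar 2) (xrow aQ) 4) (xmul (xtop 6 (V 0) (xvar 2) (\<lambda>v. xsq (xent aM 4 v)) 5) (xent aM 4 5)))
       (\<nu>(4 := r, 5 := c)) I \<alpha> else \<alpha> aA r c))"
    unfolding codeA_def by (rule sval_matrix4) (simp_all add: xtop_def xsq_def bound_nexp_def)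
  then show ?thesis using assms 1 2
    by (simp add: vars_def selected_def fun_eq_iff cong: if_cong conj_cong)
qed

lemma eval_P:
  assumes "\<And>r c. r < d \<Longrightarrow> c < d \<Longrightarrow> \<alpha> aA r c = selected d k (M w) r c" "\<And>j. j < d \<Longrightarrow> \<alpha> aU t j = wmean N w y j"
  shows "sval codeP \<nu> I \<alpha> = \<alpha>(aP := (\<alpha> aP)(0 := (\<lambda>i. if i < N then
     score d (selected d k (M w)) (wmean N w y) (y i) else \<alpha> aP 0 i)))"
  using assms by (simp add: codeP_def vars_def xval_point xval_delta score_def fun_eq_iff cong: sum.cong_simp if_cong)

lemma eval_G:
  assumes "\<And>i. i < N \<Longrightarrow> \<alpha> aW t i = w i" "\<And>i. i < N \<Longrightarrow> \<alpha> aP 0 i = score d (selected d k (M w)) (wmean N w y) (y i)"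
  shows "sval codeG \<nu> I \<alpha> = \<alpha>(aG := (\<alpha> aG)(0 := (\<lambda>i. if i < N then filter_score d N k \<epsilon> y w i else \<alpha> aG 0 i)))"
  using assms by (simp add: codeG_def vars_def xval_eps filter_score_def tail_score_def not_less[symmetric] fun_eq_iff
    cong: sum.cong_simp if_cong)

lemma eval_X:
  assumes "\<And>i. i < N \<Longrightarrow> \<alpha> aG 0 i = filter_score d N k \<epsilon> y w i"
  shows "sval codeX \<nu> I \<alpha> = \<alpha>(aX := (\<alpha> aX)(0 := (\<lambda>i. if i < 1 then maxval N (filter_score d N k \<epsilon> y w) else \<alpha> aX 0 i)))"
proof -
  have "xval (xtop 6 (V 1) (xnum 1) (xrow aG) 5) (\<nu>(4 := r, 5 := i)) I \<alpha> = topmask N 1 (filter_score d N k \<epsilon> y w) i"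
    if "i < N" for i r
    using xval_top[where \<nu> = "\<nu>(4 := r, 5 := i)" and L = 6 and j = 5 and n = "V 1" and f = "filter_score d N k \<epsilon> y w" and \<kappa> = 1
      and F = "xrow aG" and K = "xnum 1" and \<alpha> = \<alpha>] that assms
    by (simp add: vars_def)
  then show ?thesis using assms
    by (simp add: codeX_def vars_def maxval_def fun_eq_iff cong: sum.cong_simp if_cong)
qed

lemma eval_WN:
  assumes "\<And>i. i < N \<Longrightarrow> \<alpha> aW t i = w i" "\<And>i. i < N \<Longrightarrow> \<alpha> aG 0 i = filter_score d N k \<epsilon> y w i"
    "\<alpha> aX 0 0 = maxval N (filter_score d N k \<epsilon> y w)"
  shows "sval codeWN \<nu> I \<alpha> = \<alpha>(aWN := (\<alpha> aWN)(0 := (\<lambda>i. if i < N then filter_step d N k \<epsilon> y w i else \<alpha> aWN 0 i)))"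
  using assms by (simp add: codeWN_def vars_def filter_step_def fun_eq_iff cong: if_cong)

lemma eval_KEY:
  assumes "\<And>i. i < N \<Longrightarrow> \<alpha> aW t i = w i" "\<And>r. r < d \<Longrightarrow> \<alpha> aQ 0 r = rownorm d k (M w) r"
  shows "sval codeKEY \<nu> I \<alpha> = \<alpha>(aKEY := (\<alpha> aKEY)(t := (\<lambda>i. if i < 1 then
     (if (\<Sum>i<N. 1 - w i) \<le> 2 * \<epsilon> * real N then 1 / (1 + sqnorm d k (M w)) else 0) else \<alpha> aKEY t i)))"
proof -
  have "xval (xtop 6 (V 0) (xvar 2) (xrow aQ) 5) (\<nu>(4 := i, 5 := r)) I \<alpha> = topmask d k (rownorm d k (M w)) r"
    if "r < d" for i r
    using xval_top[where \<nu> = "\<nu>(4 := i, 5 := r)" and L = 6 and j = 5 and n = "V 0" and f = "rownorm d k (M w)" and \<kappa> = k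
      and F = "xrow aQ" and K = "xvar 2" and \<alpha> = \<alpha>] that assms
    by (simp add: vars_def)
  then show ?thesis using assms
    by (simp add: codeKEY_def vars_def xval_eps sqnorm_def not_less[symmetric] fun_eq_iff cong: sum.cong_simp if_cong)
qed

end

text \<open>\<open>\<alpha>1\<close> to \<open>\<alpha>9\<close> are the array contents after the
  successive fills except the last. The claims about other rows \<open>t'\<close> are needed because
  the means and qualities of all iterates are read after the loop.\<close>

lemma eval_step:
  fixes \<alpha> :: "nat \<Rightarrow> nat \<Rightarrow> nat \<Rightarrow> real"
  assumes t: "t < N" and "w = weights d N k \<epsilon> y t" "\<And>i. 0 < t \<Longrightarrow> i < N \<Longrightarrow> \<alpha> aWN 0 i = w i"
  defines "\<beta> \<equiv> sval code_step (\<nu> t) I \<alpha>"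
  shows "\<And>j. j < d \<Longrightarrow> \<beta> aU t j = wmean N w y j" "\<beta> aKEY t 0 = quality d N k \<epsilon> y t"
    "\<And>i. i < N \<Longrightarrow> \<beta> aWN 0 i = weights d N k \<epsilon> y (Suc t) i"
    "\<And>t' j. t' \<noteq> t \<Longrightarrow> \<beta> aU t' j = \<alpha> aU t' j" "\<And>t' j. t' \<noteq> t \<Longrightarrow> \<beta> aKEY t' j = \<alpha> aKEY t' j"
proof -
  define \<alpha>1 where "\<alpha>1 = \<alpha>(aW := (\<alpha> aW)(t := (\<lambda>i. if i < N then w i else \<alpha> aW t i)))"
  define \<alpha>2 where "\<alpha>2 = \<alpha>1(aU := (\<alpha>1 aU)(t := (\<lambda>j. if j < d then wmean N w y j else \<alpha>1 aU t j)))"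
  define \<alpha>3 where "\<alpha>3 = \<alpha>2(aM := (\<lambda>r c. if r < d \<and> c < d then M w r c else \<alpha>2 aM r c))"
  define \<alpha>4 where "\<alpha>4 = \<alpha>3(aQ := (\<alpha>3 aQ)(0 := (\<lambda>r. if r < d then rownorm d k (M w) r else \<alpha>3 aQ 0 r)))"
  define \<alpha>5 where "\<alpha>5 = \<alpha>4(aA := (\<lambda>r c. if r < d \<and> c < d then selected d k (M w) r c else \<alpha>4 aA r c))"
  define \<alpha>6 where "\<alpha>6 = \<alpha>5(aP := (\<alpha>5 aP)(0 := (\<lambda>i. if i < N then
     score d (selected d k (M w)) (wmean N w y) (y i) else \<alpha>5 aP 0 i)))"
  define \<alpha>7 where "\<alpha>7 = \<alpha>6(aG := (\<alpha>6 aG)(0 := (\<lambda>i. if i < N then filter_score d N k \<epsilon> y w i else \<alpha>6 aG 0 i)))"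
  define \<alpha>8 where "\<alpha>8 = \<alpha>7(aX := (\<alpha>7 aX)(0 := (\<lambda>i. if i < 1 then maxval N (filter_score d N k \<epsilon> y w) else \<alpha>7 aX 0 i)))"
  define \<alpha>9 where "\<alpha>9 = \<alpha>8(aWN := (\<alpha>8 aWN)(0 := (\<lambda>i. if i < N then filter_step d N k \<epsilon> y w i else \<alpha>8 aWN 0 i)))"
  note defs = \<alpha>1_def \<alpha>2_def \<alpha>3_def \<alpha>4_def \<alpha>5_def \<alpha>6_def \<alpha>7_def \<alpha>8_def \<alpha>9_def
  have "sval codeW (\<nu> t) I \<alpha> = \<alpha>1"
    using assms(2,3) by (cases t) (simp_all add: codeW_def \<alpha>1_def vars_def weights_def fun_eq_iff)
  moreover have "sval codeU (\<nu> t) I \<alpha>1 = \<alpha>2" unfolding \<alpha>2_def by (rule eval_U[OF t]) (simp add: \<alpha>1_def)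
  moreover have "sval codeM (\<nu> t) I \<alpha>2 = \<alpha>3" unfolding \<alpha>3_def by (rule eval_M[OF t]) (simp_all add: \<alpha>1_def \<alpha>2_def)
  moreover have "sval codeQ (\<nu> t) I \<alpha>3 = \<alpha>4" unfolding \<alpha>4_def by (rule eval_Q[OF t]) (simp_all add: \<alpha>3_def)
  moreover have "sval codeA (\<nu> t) I \<alpha>4 = \<alpha>5" unfolding \<alpha>5_def by (rule eval_A[OF t]) (simp_all add: \<alpha>3_def \<alpha>4_def)
  moreover have "sval codeP (\<nu> t) I \<alpha>5 = \<alpha>6" unfolding \<alpha>6_def
    by (rule eval_P[OF t]) (simp_all add: \<alpha>2_def \<alpha>3_def \<alpha>4_def \<alpha>5_def)
  moreover have "sval codeG (\<nu> t) I \<alpha>6 = \<alpha>7" unfolding \<alpha>7_def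
    by (rule eval_G[OF t]) (simp_all add: \<alpha>1_def \<alpha>2_def \<alpha>3_def \<alpha>4_def \<alpha>5_def \<alpha>6_def)
  moreover have "sval codeX (\<nu> t) I \<alpha>7 = \<alpha>8" unfolding \<alpha>8_def by (rule eval_X[OF t]) (simp add: \<alpha>7_def)
  moreover have "sval codeWN (\<nu> t) I \<alpha>8 = \<alpha>9" unfolding \<alpha>9_def
    by (rule eval_WN[OF t]) (simp_all add: \<alpha>1_def \<alpha>2_def \<alpha>3_def \<alpha>4_def \<alpha>5_def \<alpha>6_def \<alpha>7_def \<alpha>8_def)
  moreover have "sval codeKEY (\<nu> t) I \<alpha>9 = \<alpha>9(aKEY := (\<alpha>9 aKEY)(t := (\<lambda>i. if i < 1 then
     (if (\<Sum>i<N. 1 - w i) \<le> 2 * \<epsilon> * real N then 1 / (1 + sqnorm d k (M w)) else 0) else \<alpha>9 aKEY t i)))"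
    by (rule eval_KEY[OF t]) (simp_all add: defs)
  ultimately have \<beta>: "\<beta> = \<alpha>9(aKEY := (\<alpha>9 aKEY)(t := (\<lambda>i. if i < 1 then
     (if (\<Sum>i<N. 1 - w i) \<le> 2 * \<epsilon> * real N then 1 / (1 + sqnorm d k (M w)) else 0) else \<alpha>9 aKEY t i)))"
    unfolding \<beta>_def code_step_def sval.simps by simp
  show "\<beta> aU t j = wmean N w y j" if "j < d" for j using that by (simp add: \<beta> defs)
  show "\<beta> aKEY t 0 = quality d N k \<epsilon> y t" by (simp add: \<beta> quality_def Let_def assms(2))
  show "\<beta> aWN 0 i = weights d N k \<epsilon> y (Suc t) i" if "i < N" for i
    using that by (simp add: \<beta> \<alpha>9_def weights_def assms(2))
  show "\<beta> aU t' j = \<alpha> aU t' j" "\<beta> aKEY t' j = \<alpha> aKEY t' j" if "t' \<noteq> t" for t' j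
    using that by (simp_all add: \<beta> defs)
qed

text \<open>The array \<open>aWN\<close> holds the weights for the coming iteration only once a step
  has been executed, hence the condition \<open>0 < n\<close>; initially \<open>codeW\<close> does
  not consult it.\<close>

lemma eval_loop:
  fixes \<alpha> :: "nat \<Rightarrow> nat \<Rightarrow> nat \<Rightarrow> real" and n :: nat
  assumes "n \<le> N"
  defines "R \<equiv> rec_nat \<alpha> (\<lambda>t. sval code_step (\<nu> t) I)"
  shows "(\<forall>t<n. \<forall>j<d. R n aU t j = wmean N (weights d N k \<epsilon> y t) y j) \<and>
    (\<forall>t<n. R n aKEY t 0 = quality d N k \<epsilon> y t) \<and>
    (0 < n \<longrightarrow> (\<forall>i<N. R n aWN 0 i = weights d N k \<epsilon> y n i))"
  using assms(1)
proof (induction n)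
  case (Suc n)
  have n: "n < N" using Suc.prems by simp
  note IH = Suc.IH[OF less_imp_le[OF n]]
  have "\<And>i. 0 < n \<Longrightarrow> i < N \<Longrightarrow> R n aWN 0 i = weights d N k \<epsilon> y n i" using IH by blast
  note st = eval_step[where t = n and w = "weights d N k \<epsilon> y n" and \<alpha> = "R n", OF n refl this]
  have R: "R (Suc n) = sval code_step (\<nu> n) I (R n)" by (simp add: R_def)
  show ?case using IH st[folded R] by (auto simp: less_Suc_eq)
qed simp

lemma xval_central:
  assumes "\<rho> 0 = d" "\<rho> 1 = N" "\<rho> 4 < N"
  shows "xval xcentral \<rho> I \<alpha> = central N \<epsilon> (\<lambda>i. y i 0) (\<rho> 4)"
  using assms d_pos by (simp add: xcentral_def xval_point xval_eps central_def cong: sum.cong_simp if_cong)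

lemma eval_code:
  assumes "j < d"
  shows "sval code vars I \<alpha> aOUT 0 j = estimate d N k \<epsilon> y j"
proof -
  define \<beta> where "\<beta> = rec_nat \<alpha> (\<lambda>t. sval code_step (\<nu> t) I) N"
  have \<beta>: "\<And>t j. t < N \<Longrightarrow> j < d \<Longrightarrow> \<beta> aU t j = wmean N (weights d N k \<epsilon> y t) y j"
    "\<And>t. t < N \<Longrightarrow> \<beta> aKEY t 0 = quality d N k \<epsilon> y t"
    unfolding \<beta>_def using eval_loop[of N \<alpha>] by blast+
  define \<gamma> where "\<gamma> = sval codeDE vars I \<beta>"
  have top: "xval (xtop 5 (V 1) (xnum 1) (\<lambda>v. XArr aKEY (V v) (NConst 0)) 4) (vars(3 := j, 4 := t)) I \<beta> =
     topmask N 1 (quality d N k \<epsilon> y) t" if "t < N" for t j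
    using xval_top[where \<nu> = "vars(3 := j, 4 := t)" and L = 5 and j = 4 and n = "V 1" and f = "quality d N k \<epsilon> y" and \<kappa> = 1
      and F = "\<lambda>v. XArr aKEY (V v) (NConst 0)" and K = "xnum 1" and \<alpha> = \<beta>] that \<beta>(2)
    by (simp add: vars_def)
  have DE: "\<gamma> aDE 0 j = dense_estimate d N k \<epsilon> y j" if j: "j < d" for j
  proof (cases "d < 2")
    case True
    then show ?thesis using j
      by (simp add: \<gamma>_def codeDE_def vars_def xval_central xval_point dense_estimate_def wmean_def cong: sum.cong_simp)
  next
    case False
    have "\<gamma> aDE 0 j = (\<Sum>t<N. topmask N 1 (quality d N k \<epsilon> y) t * \<beta> aU t j)"
      using False j top[of _ j] by (simp add: \<gamma>_def codeDE_def vars_def cong: sum.cong_simp)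
    then show ?thesis using False j \<beta>(1) by (simp add: dense_estimate_def filter_mean_def cong: sum.cong_simp)
  qed
  have "xval (xtop 4 (V 0) (xvar 2) (\<lambda>v. xsq (xrow aDE v)) 3) (vars(3 := j)) I \<gamma> =
     topmask d k (\<lambda>j. (dense_estimate d N k \<epsilon> y j)\<^sup>2) j"
    using xval_top[where \<nu> = "vars(3 := j)" and L = 4 and j = 3 and n = "V 0" and f = "\<lambda>j. (dense_estimate d N k \<epsilon> y j)\<^sup>2" and \<kappa> = k
      and F = "\<lambda>v. xsq (xrow aDE v)" and K = "xvar 2" and \<alpha> = \<gamma>] assms DE
    by (simp add: vars_def xval_sq)
  then have "sval codeOUT vars I \<gamma> aOUT 0 j = estimate d N k \<epsilon> y j"
    using assms DE by (simp add: codeOUT_def vars_def estimate_def)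
  moreover have "sval code vars I \<alpha> = sval codeOUT vars I \<gamma>"
    by (simp add: code_def \<gamma>_def \<beta>_def vars_def)
  ultimately show ?thesis by simp
qed

end

definition program :: com where
  "program = Seq (scomp code) (Seq (NAssign (NConst 3) (NConst 0))
     (Loop (NLess (V 3) (V 0)) (Seq (RAssign (V 3) (RMem (NCell (Suc aOUT) (NConst 0) (V 3))))
        (NAssign (NConst 3) (NAdd (V 3) (NConst 1))))))"

text \<open>With at least one sample the output cells lie inside the input region, so copying the
  result there cannot overwrite the array being read. For an empty sample the regions may overlap,
  and only the time bound is claimed.\<close>

lemma program_exec:
  fixes d k :: nat and \<epsilon> \<tau> :: real and xs :: "(nat \<Rightarrow> real) list"
  assumes "1 \<le> d"
  defines "s0 \<equiv> input_state d xs k \<epsilon> \<tau>"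
  shows "\<exists>t s. exec program s0 t s \<and> t \<le> stime code (length xs + d) + (2 + (length xs + d) * 3) \<and>
     (1 \<le> length xs \<longrightarrow> (\<forall>j<d. snd s j = sval code (fst s0) (inp s0) (arr s0) aOUT 0 j))"
proof -
  let ?S = "length xs + d"
  have "fst s0 0 + fst s0 1 \<le> ?S" "1 \<le> ?S" using assms by (simp_all add: s0_def input_state_def)
  from scomp_correct[OF wfs_code _ this] obtain t1 s1 where
    1: "exec (scomp code) s0 t1 s1" "t1 \<le> stime code ?S" "sagree 3 s0 s1"
      "arr s1 = sval code (fst s0) (inp s0) (arr s0)" by auto
  have f1: "fst s1 0 = d" "fst s1 1 = length xs" using 1(3) by (auto simp: sagree_def s0_def input_state_def)
  let ?b = "2 + length xs * d"
  have b: "base \<nu> = ?b" if "\<nu> 0 = d" "\<nu> 1 = length xs" for \<nu> using that by (simp add: base_def)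
  let ?c = "Seq (RAssign (V 3) (RMem (NCell (Suc aOUT) (NConst 0) (V 3)))) (NAssign (NConst 3) (NAdd (V 3) (NConst 1)))"
  let ?out = "\<lambda>j. arr s1 aOUT 0 j"
  let ?I = "\<lambda>i (s :: state). fst s 0 = d \<and> fst s 1 = length xs \<and> fst s 3 = i \<and>
     (1 \<le> length xs \<longrightarrow> (\<forall>a\<ge>?b. snd s a = snd s1 a) \<and> (\<forall>j<i. snd s j = ?out j))"
  let ?s2 = "((fst s1)(3 := 0), snd s1)"
  have "\<exists>t s. exec (Loop (NLess (V 3) (V 0)) ?c) ?s2 t s \<and> t \<le> 1 + (d - 0) * (1 + 2) \<and> ?I d s"
  proof (rule exec_counting_loop[where I = ?I])
    fix i s assume i: "i < d" and I: "?I i s"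
    let ?v = "snd s (cell (fst s) (Suc aOUT) 0 i)"
    let ?s3 = "(fst s, (snd s)(i := ?v))" and ?s4 = "((fst s)(3 := Suc i), (snd s)(i := ?v))"
    have "exec (RAssign (V 3) (RMem (NCell (Suc aOUT) (NConst 0) (V 3)))) s 1 ?s3"
      using exec.RAssign[of "V 3" "RMem (NCell (Suc aOUT) (NConst 0) (V 3))" s] I by simp
    moreover have "exec (NAssign (NConst 3) (NAdd (V 3) (NConst 1))) ?s3 1 ?s4"
      using exec.NAssign[of "NConst 3" "NAdd (V 3) (NConst 1)" ?s3] I by simp
    ultimately have ex: "exec ?c s (1 + 1) ?s4" by (rule exec.Seq)
    have "?I (Suc i) ?s4"
    proof (intro conjI impI)
      assume xs: "1 \<le> length xs"
      then have "d \<le> length xs * d" by (cases "length xs") auto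
      then have ib: "i < ?b" using i by linarith
      have "?v = ?out i"
      proof -
        have "cell (fst s) = cell (fst s1)" using I f1 by (intro cell_cong) auto
        moreover have "?b \<le> cell (fst s1) (Suc aOUT) 0 i" using b[OF f1] by (simp add: cell_def)
        ultimately show ?thesis using I xs by (simp add: arr_def)
      qed
      then show "\<forall>j<Suc i. snd ?s4 j = ?out j" using I xs by (auto simp: less_Suc_eq)
      show "\<forall>a\<ge>?b. snd ?s4 a = snd s1 a" using I xs ib by auto
    qed (use I in auto)
    moreover have "(1 + 1 :: nat) \<le> 2" by simp
    ultimately show "\<exists>t s'. exec ?c s t s' \<and> t \<le> 2 \<and> ?I (Suc i) s'" using ex by blast
  next
    show "holds (NLess (V 3) (V 0)) s \<longleftrightarrow> i < d" if "?I i s" for i s using that by simp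
    show "?I 0 ?s2" using f1 by simp
  qed simp
  then obtain t s where 3: "exec (Loop (NLess (V 3) (V 0)) ?c) ?s2 t s" "t \<le> 1 + d * 3" "?I d s"
    by (auto simp: numeral_eq_Suc)
  have 2: "exec (NAssign (NConst 3) (NConst 0)) s1 1 ?s2"
    using exec.NAssign[of "NConst 3" "NConst 0" s1] by simp
  have "exec program s0 (t1 + (1 + t)) s"
    unfolding program_def by (rule exec.Seq[OF 1(1) exec.Seq[OF 2 3(1)]])
  moreover have "t1 + (1 + t) \<le> stime code ?S + (2 + ?S * 3)" using 1(2) 3(2) by (simp add: add_mult_distrib)
  ultimately show ?thesis using 3(3) unfolding 1(4) by blast
qed

lemma polynomial_time_program: "polynomial_time program"
proof -
  have "poly_bounded (\<lambda>S. stime code S + (2 + S * 3))" by (intro poly_bounded_intros poly_bounded_stime)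
  then obtain a b where ab: "\<And>S. 1 \<le> S \<Longrightarrow> stime code S + (2 + S * 3) \<le> a * S ^ b"
    unfolding poly_bounded_def by blast
  show ?thesis
    unfolding polynomial_time_def
  proof (rule exI[of _ a], rule exI[of _ b], intro allI impI)
    fix d k :: nat and \<epsilon> \<tau> :: real and xs :: "(nat \<Rightarrow> real) list"
    assume "1 \<le> d \<and> 1 \<le> k \<and> 0 < \<epsilon> \<and> \<epsilon> < 1/2 \<and> 0 < \<tau> \<and> set xs \<subseteq> vectors d"
    then have d: "1 \<le> d" by simp
    then have "1 \<le> length xs + d" by simp
    from program_exec[OF d, of xs k \<epsilon> \<tau>] ab[OF this]
    show "\<exists>t s. exec program (input_state d xs k \<epsilon> \<tau>) t s \<and> t \<le> a * (length xs + d) ^ b"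
      by (meson order.trans)
  qed
qed

lemma program_returns:
  assumes "1 \<le> d" "1 \<le> length xs"
  shows "returns program d xs k \<epsilon> \<tau> (restrict (estimate d (length xs) k \<epsilon> (\<lambda>i. xs ! i)) {..<d})"
proof -
  let ?s0 = "input_state d xs k \<epsilon> \<tau>" and ?N = "length xs"
  have base: "base (fst ?s0) = 2 + ?N * d" by (simp add: base_def input_state_def)
  interpret code_input d ?N k \<epsilon> "\<lambda>i. xs ! i" "inp ?s0"
  proof
    show "inp ?s0 0 = \<epsilon>" using base by (simp add: inp_def input_state_def)
    show "0 < d" using assms by simp
    fix i j assume ij: "i < ?N" "j < d"
    have "i * d + j < i * d + d" using ij by simp
    also have "\<dots> \<le> ?N * d" using mult_le_mono1[of "Suc i" ?N d] ij by (simp add: Suc_le_eq)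
    finally show "inp ?s0 (2 + i * d + j) = (xs ! i) j"
      using base ij by (simp add: inp_def input_state_def)
  qed
  have vars: "fst ?s0 = vars" by (simp add: input_state_def vars_def)
  obtain t s where ts: "exec program ?s0 t s" "\<forall>j<d. snd s j = sval code vars (inp ?s0) (arr ?s0) aOUT 0 j"
    using program_exec[OF assms(1), of xs k \<epsilon> \<tau>] assms(2) unfolding vars by blast
  then have "restrict (estimate d ?N k \<epsilon> (\<lambda>i. xs ! i)) {..<d} = restrict (snd s) {..<d}"
    by (intro restrict_ext) (simp add: eval_code)
  then show ?thesis using ts(1) unfolding returns_def by blast
qed

section \<open>Success probability\<close>

text \<open>Both lists are rearrangements of lists beginning with the common part \<open>cs\<close>
  of the two multisets. Composing one rearrangement with the inverse of the other matches equal
  points on the positions of \<open>cs\<close>; the number of remaining positions is the size of the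
  multiset difference.\<close>

lemma corrupted_bijection:
  fixes xs ys :: "'a list"
  assumes "corrupted \<epsilon> xs ys"
  obtains \<pi> where "bij_betw \<pi> {..<length xs} {..<length xs}"
    "real (card {i. i < length xs \<and> ys ! i \<noteq> xs ! \<pi> i}) \<le> \<epsilon> * real (length xs)"
proof -
  let ?N = "length xs"
  have len: "length ys = ?N" and few: "real (size (mset xs - mset ys)) \<le> \<epsilon> * real ?N"
    using assms by (auto simp: corrupted_def)
  define C where "C = mset xs \<inter># mset ys"
  obtain cs qs rs where l: "mset cs = C" "mset qs = mset xs - C" "mset rs = mset ys - C"
    by (metis ex_mset)
  have "C \<subseteq># mset xs" "C \<subseteq># mset ys" by (simp_all add: C_def)
  then have mx: "mset xs = mset (cs @ qs)" "mset ys = mset (cs @ rs)"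
    by (simp_all add: l subset_mset.add_diff_inverse)
  obtain p where p: "p permutes {..<length (cs @ qs)}" "permute_list p (cs @ qs) = xs"
    using mset_eq_permutation[OF mx(1)] .
  obtain q where q: "q permutes {..<length (cs @ rs)}" "permute_list q (cs @ rs) = ys"
    using mset_eq_permutation[OF mx(2)] .
  have lx: "length (cs @ qs) = ?N" "length (cs @ rs) = ?N" using mx len by (metis size_mset)+
  have pq: "p permutes {..<?N}" "q permutes {..<?N}" using p q lx by simp_all
  define \<pi> where "\<pi> = inv p \<circ> q"
  have perm: "\<pi> permutes {..<?N}" unfolding \<pi>_def by (intro permutes_compose permutes_inv pq)
  have same: "ys ! i = xs ! \<pi> i" if "i < ?N" "q i < length cs" for i
  proof -
    have "\<pi> i < ?N" using permutes_in_image[OF perm, of i] that by simp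
    then have "xs ! \<pi> i = (cs @ qs) ! p (\<pi> i)" using permute_list_nth[OF p(1), of "\<pi> i"] lx(1) unfolding p(2) by simp
    also have "p (\<pi> i) = q i" using permutes_inverses(1)[OF pq(1)] by (simp add: \<pi>_def)
    also have "(cs @ qs) ! q i = (cs @ rs) ! q i" using that by (simp add: nth_append)
    also have "\<dots> = ys ! i" using permute_list_nth[OF q(1), of i] lx(2) that(1) unfolding q(2) by simp
    finally show ?thesis ..
  qed
  have "q ` {i. i < ?N \<and> ys ! i \<noteq> xs ! \<pi> i} \<subseteq> {length cs..<?N}"
  proof (rule image_subsetI)
    fix i assume "i \<in> {i. i < ?N \<and> ys ! i \<noteq> xs ! \<pi> i}"
    then have "i < ?N" "\<not> q i < length cs" using same by auto
    then show "q i \<in> {length cs..<?N}" using permutes_in_image[OF pq(2), of i] by simp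
  qed
  then have "card (q ` {i. i < ?N \<and> ys ! i \<noteq> xs ! \<pi> i}) \<le> ?N - length cs"
    using card_mono[of "{length cs..<?N}"] by fastforce
  moreover have "card (q ` {i. i < ?N \<and> ys ! i \<noteq> xs ! \<pi> i}) = card {i. i < ?N \<and> ys ! i \<noteq> xs ! \<pi> i}"
    by (intro card_image inj_on_subset[OF permutes_inj[OF pq(2)]]) auto
  moreover have "?N - length cs = size (mset xs - mset ys)"
  proof -
    have "mset xs - C = mset xs - mset ys" by (simp add: C_def diff_intersect_left_idem)
    then have "size (mset xs - mset ys) = length qs" using l(2) by (metis size_mset)
    then show ?thesis using lx(1) by simp
  qed
  ultimately show ?thesis using that[of \<pi>] few permutes_imp_bij[OF perm] by simp
qed

text \<open>The adversary may reorder the points, and all three clauses of \<open>typical\<close>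
  are sums over the sample, hence invariant under permutation.\<close>

lemma typical_permute:
  assumes "bij_betw \<pi> {..<N} {..<N}" "typical d N k \<epsilon> z"
  shows "typical d N k \<epsilon> (\<lambda>i. z (\<pi> i))"
proof -
  have "(\<Sum>i<N. f (z (\<pi> i))) = (\<Sum>i<N. f (z i))" for f :: "(nat \<Rightarrow> real) \<Rightarrow> real"
    by (rule sum.reindex_bij_betw[OF assms(1)])
  from this[of "\<lambda>x. x j" for j] this[of "\<lambda>x. x a * x b - (if a = b then 1 else 0)" for a b]
    this[of "\<lambda>x. max 0 (qform d (net_matrix k p) x - 16 * ln (1 / \<epsilon>))" for p]
  show ?thesis using assms(2) unfolding typical_def by simp
qed

lemma sqrt_bound:
  assumes "0 < \<epsilon>" "0 \<le> l" "\<eta> = K * \<epsilon> * l" "0 \<le> K" "K \<le> r\<^sup>2" "0 \<le> r"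
  shows "sqrt (\<epsilon> * \<eta>) \<le> r * (\<epsilon> * sqrt l)"
proof (rule real_le_lsqrt)
  have "\<epsilon> * \<eta> = K * (\<epsilon>\<^sup>2 * l)" using assms by (simp add: power2_eq_square)
  also have "\<dots> \<le> r\<^sup>2 * (\<epsilon>\<^sup>2 * l)" using assms by (intro mult_right_mono) auto
  finally show "\<epsilon> * \<eta> \<le> (r * (\<epsilon> * sqrt l))\<^sup>2" using assms by (simp add: power_mult_distrib)
qed (use assms in simp)

lemma corrupted_input:
  assumes A: "adversary d N \<epsilon> A" and X: "X \<in> space (gaussian_samples N d \<mu>)"
  obtains ys \<pi> where "A (map X [0..<N]) = ys" "length ys = N" "bij_betw \<pi> {..<N} {..<N}"
    "real (card ({..<N} - {i. i < N \<and> ys ! i = X (\<pi> i)})) \<le> \<epsilon> * real N"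
proof -
  let ?xs = "map X [0..<N]"
  have "X i \<in> vectors d" if "i < N" for i
    using X that by (auto simp: gaussian_samples_def gaussian_eq space_PiM vectors_def)
  then have "set ?xs \<subseteq> vectors d" by auto
  then have "corrupted \<epsilon> ?xs (A ?xs)" using A by (simp add: adversary_def)
  from corrupted_bijection[OF this] obtain \<pi> where \<pi>: "bij_betw \<pi> {..<N} {..<N}"
    "real (card {i. i < N \<and> A ?xs ! i \<noteq> ?xs ! \<pi> i}) \<le> \<epsilon> * real N" by auto
  have "?xs ! \<pi> i = X (\<pi> i)" if "i < N" for i
  proof -
    have "\<pi> i < N" using \<pi>(1) that by (auto simp: bij_betw_def)
    then show ?thesis by simp
  qed
  then have "{..<N} - {i. i < N \<and> A ?xs ! i = X (\<pi> i)} = {i. i < N \<and> A ?xs ! i \<noteq> ?xs ! \<pi> i}" by auto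
  moreover have "length (A ?xs) = N" using \<open>corrupted \<epsilon> ?xs (A ?xs)\<close> by (simp add: corrupted_def)
  ultimately show ?thesis using that[of "A ?xs" \<pi>] \<pi> by simp
qed

lemma l2_dist_estimate:
  "l2_dist d (restrict v {..<d}) \<mu> = L2_set (\<lambda>j. v j - \<mu> j) {..<d}"
  unfolding l2_dist_def by (rule L2_set_cong) auto

text \<open>Deterministic: on the typical event, which does not depend on the adversary, every
  adversary is defeated. The constant comes from
  \<open>\<eta> = 162 * \<epsilon> * ln (1 / \<epsilon>)\<close>,
  \<open>162 \<le> 13\<^sup>2\<close> and \<open>123 * 13 = 1599 \<le> 2000\<close>.\<close>

lemma filter_success:
  assumes d: "2 \<le> d" and k: "1 \<le> k" and sparse: "k_sparse d k \<mu>" and \<epsilon>: "0 < \<epsilon>" "\<epsilon> \<le> 1 / 20000"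
    and N: "0 < N" and ln1: "1 \<le> ln (1 / \<epsilon>)"
    and A: "adversary d N \<epsilon> A" and X: "X \<in> space (gaussian_samples N d \<mu>)"
    and ty: "typical d N k \<epsilon> (\<lambda>i j. X i j - \<mu> j)"
  shows "\<exists>\<mu>'. returns program d (A (map X [0..<N])) k \<epsilon> \<tau> \<mu>' \<and> l2_dist d \<mu>' \<mu> \<le> 2000 * \<epsilon> * sqrt (ln (1 / \<epsilon>))"
proof -
  obtain ys \<pi> where ys: "A (map X [0..<N]) = ys" "length ys = N" and \<pi>: "bij_betw \<pi> {..<N} {..<N}"
    and bad: "real (card ({..<N} - {i. i < N \<and> ys ! i = X (\<pi> i)})) \<le> \<epsilon> * real N"
    using corrupted_input[OF A X] .
  define z where "z i j = X (\<pi> i) j - \<mu> j" for i j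
  have tz: "typical d N k \<epsilon> z" using typical_permute[OF \<pi> ty] by (simp add: z_def[abs_def])
  have L0: "0 \<le> ln (1 / \<epsilon>)" using ln1 by linarith
  define \<eta> where "\<eta> = 162 * \<epsilon> * ln (1 / \<epsilon>)"
  define G where "G = {i. i < N \<and> ys ! i = X (\<pi> i)}"
  interpret good_sample d N k \<epsilon> \<eta> \<mu> "\<lambda>i. ys ! i" z G
  proof
    show "5 * \<epsilon> \<le> \<eta>"
    proof -
      have "\<epsilon> * 1 \<le> \<epsilon> * ln (1 / \<epsilon>)" using ln1 \<epsilon>(1) by (intro mult_left_mono) auto
      then show ?thesis unfolding \<eta>_def using \<epsilon>(1) by linarith
    qed
    show "(ys ! i) j = \<mu> j + z i j" if "i \<in> G" for i j using that by (simp add: G_def z_def)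
    show "\<bar>\<Sum>i<N. z i j\<bar> \<le> real N * (\<epsilon> / real k)" if "j < d" for j
      using tz that unfolding typical_def by blast
    show "\<bar>\<Sum>i<N. z i r * z i c - (if r = c then 1 else 0)\<bar> \<le> real N * (\<epsilon> / real k)" if "r < d" "c < d" for r c
      using tz that unfolding typical_def by blast
    show "(\<Sum>u\<in>U. (\<Sum>i<N. c i * (z i (fst u) * z i (snd u) - (if fst u = snd u then 1 else 0)))\<^sup>2) \<le> (real N * \<eta>)\<^sup>2"
      if "\<And>i. i < N \<Longrightarrow> 0 \<le> c i \<and> c i \<le> 1" "(\<Sum>i<N. c i) \<le> 5 * \<epsilon> * real N"
        "U \<subseteq> {..<d} \<times> {..<d}" "card U \<le> k * k" for c U
      unfolding \<eta>_def using k by (intro typical_tail[OF tz \<epsilon>(1) ln1 _ that]) auto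
  qed (use N k \<epsilon> bad in \<open>auto simp: G_def\<close>)
  have "sqrt (\<epsilon> * \<eta>) \<le> 13 * (\<epsilon> * sqrt (ln (1 / \<epsilon>)))"
    by (rule sqrt_bound[OF \<epsilon>(1) L0 \<eta>_def]) simp_all
  moreover have "L2_set (\<lambda>j. estimate d N k \<epsilon> (\<lambda>i. ys ! i) j - \<mu> j) {..<d} \<le> 123 * sqrt (\<epsilon> * \<eta>)"
    using estimate_error[OF d] sparse by (simp add: k_sparse_def \<xi>_def)
  moreover have "0 \<le> \<epsilon> * sqrt (ln (1 / \<epsilon>))" by (rule mult_nonneg_nonneg[OF less_imp_le[OF \<epsilon>(1)] real_sqrt_ge_zero[OF L0]])
  ultimately have "l2_dist d (restrict (estimate d N k \<epsilon> (\<lambda>i. ys ! i)) {..<d}) \<mu> \<le> 2000 * \<epsilon> * sqrt (ln (1 / \<epsilon>))"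
    unfolding l2_dist_estimate by linarith
  moreover have "returns program d ys k \<epsilon> \<tau> (restrict (estimate d N k \<epsilon> (\<lambda>i. ys ! i)) {..<d})"
    using program_returns[of d ys k \<epsilon> \<tau>] d N ys(2) by simp
  ultimately show ?thesis unfolding ys(1) by blast
qed

text \<open>The hypothesis \<open>tail\<close> quantifies over \<open>\<pi>\<close> because the
  matching with the corrupted list is only obtained inside the proof. It abstracts from the two
  different events that supply it.\<close>

lemma trimmed_success:
  assumes k: "1 \<le> k" and \<epsilon>: "0 < \<epsilon>" "\<epsilon> \<le> 1 / 20000"
    and N: "0 < N" and ln1: "1 \<le> ln (1 / \<epsilon>)"
    and A: "adversary 1 N \<epsilon> A" and X: "X \<in> space (gaussian_samples N 1 \<mu>)"
    and mean: "\<bar>\<Sum>i<N. X i 0 - \<mu> 0\<bar> \<le> real N * \<epsilon>"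
    and tail: "\<And>\<pi> c. bij_betw \<pi> {..<N} {..<N} \<Longrightarrow> (\<And>i. i < N \<Longrightarrow> 0 \<le> c i \<and> c i \<le> 1) \<Longrightarrow> (\<Sum>i<N. c i) \<le> 5 * \<epsilon> * real N \<Longrightarrow>
       (\<Sum>i<N. c i * (X (\<pi> i) 0 - \<mu> 0)\<^sup>2) \<le> real N * (170 * \<epsilon> * ln (1 / \<epsilon>))"
  shows "\<exists>\<mu>'. returns program 1 (A (map X [0..<N])) k \<epsilon> \<tau> \<mu>' \<and> l2_dist 1 \<mu>' \<mu> \<le> 2000 * \<epsilon> * sqrt (ln (1 / \<epsilon>))"
proof -
  obtain ys \<pi> where ys: "A (map X [0..<N]) = ys" "length ys = N" and \<pi>: "bij_betw \<pi> {..<N} {..<N}"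
    and bad: "real (card ({..<N} - {i. i < N \<and> ys ! i = X (\<pi> i)})) \<le> \<epsilon> * real N"
    using corrupted_input[OF A X] .
  have L0: "0 \<le> ln (1 / \<epsilon>)" using ln1 by linarith
  define \<eta> where "\<eta> = 170 * \<epsilon> * ln (1 / \<epsilon>)"
  define z where "z i = X (\<pi> i) 0 - \<mu> 0" for i
  define G where "G = {i. i < N \<and> ys ! i = X (\<pi> i)}"
  define y where "y i = (ys ! i) 0" for i
  have "\<bar>(\<Sum>i<N. central N \<epsilon> y i * y i) / (\<Sum>i<N. central N \<epsilon> y i) - \<mu> 0\<bar> \<le> 10 * sqrt (\<epsilon> * \<eta>)"
  proof (rule trimmed_mean_error[OF N])
    show "\<epsilon> \<le> \<eta>"
    proof -
      have "\<epsilon> * 1 \<le> \<epsilon> * ln (1 / \<epsilon>)" using ln1 \<epsilon>(1) by (intro mult_left_mono) auto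
      then show ?thesis unfolding \<eta>_def using \<epsilon>(1) by linarith
    qed
    show "G \<subseteq> {..<N}" "real (card ({..<N} - G)) \<le> \<epsilon> * real N" using bad by (auto simp: G_def)
    show "y i = \<mu> 0 + z i" if "i \<in> G" for i using that by (simp add: G_def z_def y_def)
    have "(\<Sum>i<N. z i) = (\<Sum>i<N. X i 0 - \<mu> 0)" unfolding z_def by (rule sum.reindex_bij_betw[OF \<pi>])
    then show "\<bar>\<Sum>i<N. z i\<bar> \<le> real N * \<epsilon>" using mean by simp
    show "(\<Sum>i<N. c i * (z i)\<^sup>2) \<le> real N * \<eta>"
      if "\<And>i. i < N \<Longrightarrow> 0 \<le> c i \<and> c i \<le> 1" "(\<Sum>i<N. c i) \<le> 5 * \<epsilon> * real N" for c
      unfolding z_def \<eta>_def by (rule tail[OF \<pi> that])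
  qed (use \<epsilon> in auto)
  moreover have "sqrt (\<epsilon> * \<eta>) \<le> 14 * (\<epsilon> * sqrt (ln (1 / \<epsilon>)))"
    by (rule sqrt_bound[OF \<epsilon>(1) L0 \<eta>_def]) simp_all
  moreover have "0 \<le> \<epsilon> * sqrt (ln (1 / \<epsilon>))" by (rule mult_nonneg_nonneg[OF less_imp_le[OF \<epsilon>(1)] real_sqrt_ge_zero[OF L0]])
  moreover have "estimate 1 N k \<epsilon> (\<lambda>i. ys ! i) 0 = (\<Sum>i<N. central N \<epsilon> y i * y i) / (\<Sum>i<N. central N \<epsilon> y i)"
    using k by (simp add: estimate_def topmask_def rank_def dense_estimate_def wmean_def y_def[abs_def])
  ultimately have "l2_dist 1 (restrict (estimate 1 N k \<epsilon> (\<lambda>i. ys ! i)) {..<1}) \<mu> \<le> 2000 * \<epsilon> * sqrt (ln (1 / \<epsilon>))"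
    unfolding l2_dist_estimate by (simp add: L2_set_def)
  moreover have "returns program 1 ys k \<epsilon> \<tau> (restrict (estimate 1 N k \<epsilon> (\<lambda>i. ys ! i)) {..<1})"
    using program_returns[of 1 ys k \<epsilon> \<tau>] N ys(2) by simp
  ultimately show ?thesis unfolding ys(1) by blast
qed

text \<open>In dimension one \<open>typical_tail\<close> with the single position
  \<open>(0, 0)\<close> controls \<open>z\<^sup>2 - 1\<close>; adding back the weight, at most
  \<open>5 * \<epsilon> * N\<close>, raises 162 to 167, below the common constant 170.\<close>

lemma typical_success_one:
  assumes k: "1 \<le> k" and \<epsilon>: "0 < \<epsilon>" "\<epsilon> \<le> 1 / 20000"
    and N: "0 < N" and ln1: "1 \<le> ln (1 / \<epsilon>)"
    and A: "adversary 1 N \<epsilon> A" and X: "X \<in> space (gaussian_samples N 1 \<mu>)"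
    and ty: "typical 1 N k \<epsilon> (\<lambda>i j. X i j - \<mu> j)"
  shows "\<exists>\<mu>'. returns program 1 (A (map X [0..<N])) k \<epsilon> \<tau> \<mu>' \<and> l2_dist 1 \<mu>' \<mu> \<le> 2000 * \<epsilon> * sqrt (ln (1 / \<epsilon>))"
proof (rule trimmed_success[OF k \<epsilon> N ln1 A X])
  have "\<bar>\<Sum>i<N. X i 0 - \<mu> 0\<bar> \<le> real N * (\<epsilon> / real k)" using ty by (simp add: typical_def)
  also have "\<dots> \<le> real N * (\<epsilon> / 1)" using k \<epsilon> by (intro mult_left_mono divide_left_mono) auto
  finally show "\<bar>\<Sum>i<N. X i 0 - \<mu> 0\<bar> \<le> real N * \<epsilon>" by simp
  fix \<pi> c assume \<pi>: "bij_betw \<pi> {..<N} {..<N}" and c: "\<And>i. i < N \<Longrightarrow> 0 \<le> c i \<and> c i \<le> 1" "(\<Sum>i<N. c i) \<le> 5 * \<epsilon> * real N"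
  define z where "z i j = X (\<pi> i) j - \<mu> j" for i j
  let ?B = "real N * (162 * \<epsilon> * ln (1 / \<epsilon>))"
  have tz: "typical 1 N k \<epsilon> z" using typical_permute[OF \<pi> ty] by (simp add: z_def[abs_def])
  have "card {(0 :: nat, 0 :: nat)} \<le> k * k" "{(0, 0)} \<subseteq> {..<1 :: nat} \<times> {..<1 :: nat}" "0 < k" using k by auto
  from typical_tail[OF tz \<epsilon>(1) ln1 this(3) c this(2,1)]
  have "(\<Sum>i<N. c i * (z i 0 * z i 0 - 1))\<^sup>2 \<le> ?B\<^sup>2" by simp
  moreover have L: "0 \<le> ln (1 / \<epsilon>)" using ln1 by linarith
  then have "0 \<le> ?B" using \<epsilon>(1) by (intro mult_nonneg_nonneg) auto
  ultimately have "\<bar>\<Sum>i<N. c i * (z i 0 * z i 0 - 1)\<bar> \<le> ?B" by (rule_tac power2_le_iff_abs_le[THEN iffD1])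
  then have "(\<Sum>i<N. c i * (z i 0)\<^sup>2) \<le> ?B + (\<Sum>i<N. c i)"
    by (simp add: right_diff_distrib sum_subtractf power2_eq_square)
  also have "\<dots> \<le> ?B + 5 * \<epsilon> * real N * ln (1 / \<epsilon>)"
  proof -
    have "5 * \<epsilon> * real N * 1 \<le> 5 * \<epsilon> * real N * ln (1 / \<epsilon>)" using \<epsilon>(1) ln1 by (intro mult_left_mono) auto
    then show ?thesis using c(2) by linarith
  qed
  also have "\<dots> = 167 * (real N * \<epsilon> * ln (1 / \<epsilon>))" by (simp add: algebra_simps)
  also have "\<dots> \<le> 170 * (real N * \<epsilon> * ln (1 / \<epsilon>))"
    using mult_nonneg_nonneg[OF mult_nonneg_nonneg[OF of_nat_0_le_iff[of N] less_imp_le[OF \<epsilon>(1)]] L] by linarith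
  finally show "(\<Sum>i<N. c i * (X (\<pi> i) 0 - \<mu> 0)\<^sup>2) \<le> real N * (170 * \<epsilon> * ln (1 / \<epsilon>))"
    by (simp add: z_def mult_ac)
qed

section \<open>Sample sizes and the final case distinction\<close>

lemma with_probability_mono:
  assumes "with_probability_at_least M p P" "q \<le> p" "\<And>x. x \<in> space M \<Longrightarrow> P x \<Longrightarrow> Q x"
  shows "with_probability_at_least M q Q"
proof -
  obtain E where E: "E \<in> sets M" "\<forall>x\<in>E. P x" "p \<le> measure M E" using assms(1) by (auto simp: with_probability_at_least_def)
  then have "\<forall>x\<in>E. Q x" using assms(3) sets.sets_into_space[OF E(1)] by blast
  then show ?thesis using E assms(2) by (auto simp: with_probability_at_least_def)
qed

text \<open>The condition \<open>dt\<close> keeps \<open>L = ln (d / \<tau>)\<close> above 1/10, so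
  \<open>L\<close> can pay for absolute constants. The entrywise events need
  \<open>N * (\<epsilon> / k)\<^sup>2\<close> of order \<open>L\<close>. The net has at most
  \<open>exp (5 * s * k^2)\<close> members, paid for by the extra logarithmic factor
  \<open>s\<close> in the sample bound and a spare factor \<open>1 / \<epsilon>\<close>.\<close>

lemma sample_size_suffices:
  assumes d: "1 \<le> d" and k: "1 \<le> k" and \<epsilon>: "0 < \<epsilon>" "\<epsilon> \<le> 1 / 20000" and \<tau>: "0 < \<tau>" "\<tau> < 1"
    and dt: "10 / 9 \<le> real d / \<tau>" and N: "sample_bound 2000 1 d k \<epsilon> \<tau> \<le> real N"
  shows "2 * real d * exp (- (real N * (\<epsilon> / real k)\<^sup>2 / 2)) + 2 * (real d)\<^sup>2 * exp (- (real N * (\<epsilon> / real k)\<^sup>2 / 16))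
      + real ((d * d * (4 * k + 1)) ^ (k * k)) * exp (- (real N * \<epsilon> / 16)) \<le> \<tau>"
proof -
  define s where "s = ln (3 + real d * real k / (\<epsilon> * \<tau>))"
  define L where "L = ln (real d / \<tau>)"
  have \<epsilon>\<tau>: "0 < \<epsilon> * \<tau>" "\<epsilon> * \<tau> \<le> \<tau>" "\<epsilon> * \<tau> \<le> 1" using \<epsilon> \<tau> by (auto intro: mult_le_one mult_left_le_one_le)
  have dk: "1 \<le> real d" "1 \<le> real k" using d k by auto
  have exps: "exp s = 3 + real d * real k / (\<epsilon> * \<tau>)"
    unfolding s_def using dk \<epsilon>\<tau> by (intro exp_ln) (auto intro!: add_pos_nonneg)
  have big: "real d \<le> exp s" "real k \<le> exp s" "1 / \<tau> \<le> exp s" "exp 1 \<le> exp s"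
  proof -
    have "real d * real k / 1 \<le> real d * real k / (\<epsilon> * \<tau>)" using \<epsilon>\<tau> by (intro divide_left_mono) auto
    moreover have "real d * 1 \<le> real d * real k" "1 * real k \<le> real d * real k" using dk by (auto intro!: mult_mono)
    ultimately show "real d \<le> exp s" "real k \<le> exp s" unfolding exps by simp_all
    have "1 * 1 \<le> real d * real k" using dk by (intro mult_mono) auto
    then have "1 / \<tau> \<le> real d * real k / \<tau>" using \<tau> by (intro divide_right_mono) auto
    also have "\<dots> \<le> real d * real k / (\<epsilon> * \<tau>)" using \<epsilon>\<tau> \<tau> by (intro divide_left_mono) auto
    finally show "1 / \<tau> \<le> exp s" unfolding exps by simp
    have "0 \<le> real d * real k / (\<epsilon> * \<tau>)" using \<epsilon>\<tau> by simp
    then show "exp 1 \<le> exp s" unfolding exps using exp_le by linarith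
  qed
  have s: "1 \<le> s" using big(4) by simp
  have L: "1 / 10 \<le> L" "exp (- L) = \<tau> / real d"
  proof -
    have "ln (\<tau> / real d) \<le> \<tau> / real d - 1" using \<tau> d by (intro ln_le_minus_one) auto
    moreover have "\<tau> / real d \<le> 9 / 10" using dt \<tau> d by (simp add: field_simps)
    moreover have "L = - ln (\<tau> / real d)" unfolding L_def using \<tau> d by (simp add: ln_div)
    ultimately show "1 / 10 \<le> L" by linarith
    show "exp (- L) = \<tau> / real d" unfolding \<open>L = - ln (\<tau> / real d)\<close> using \<tau> d by simp
  qed
  have kk: "1 \<le> (real k)\<^sup>2" using dk by simp
  have N': "2000 * s * ((real k)\<^sup>2 * L / \<epsilon>\<^sup>2) \<le> real N" using N by (simp add: sample_bound_def s_def L_def)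
  have x: "2000 * L \<le> real N * (\<epsilon> / real k)\<^sup>2"
  proof -
    have "2000 * L = 2000 * 1 * ((real k)\<^sup>2 * L / \<epsilon>\<^sup>2) * (\<epsilon> / real k)\<^sup>2" using \<epsilon> dk by (simp add: power_divide)
    also have "\<dots> \<le> 2000 * s * ((real k)\<^sup>2 * L / \<epsilon>\<^sup>2) * (\<epsilon> / real k)\<^sup>2"
      using s L by (intro mult_right_mono mult_left_mono) auto
    also have "\<dots> \<le> real N * (\<epsilon> / real k)\<^sup>2" using N' by (intro mult_right_mono) auto
    finally show ?thesis .
  qed
  have 1: "2 * real d * exp (- (real N * (\<epsilon> / real k)\<^sup>2 / 2)) + 2 * (real d)\<^sup>2 * exp (- (real N * (\<epsilon> / real k)\<^sup>2 / 16)) \<le> \<tau> / 2"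
  proof -
    let ?y = "real N * (\<epsilon> / real k)\<^sup>2"
    have "real d \<le> (real d)\<^sup>2" using dk by (simp add: power2_eq_square)
    moreover have "exp (- (?y / 2)) \<le> exp (- (?y / 16))" by simp
    ultimately have "2 * real d * exp (- (?y / 2)) \<le> 2 * (real d)\<^sup>2 * exp (- (?y / 16))" by (intro mult_mono) auto
    then have "2 * real d * exp (- (?y / 2)) + 2 * (real d)\<^sup>2 * exp (- (?y / 16)) \<le> 4 * (real d)\<^sup>2 * exp (- (?y / 16))" by simp
    \<comment> \<open>Here \<open>?y / 16 \<ge> 125 * L\<close>. Two copies of \<open>L\<close> turn
      \<open>d^2\<close> into \<open>\<tau>\<^sup>2\<close>, and the remaining
      \<open>123 * L \<ge> 12.3\<close> covers the numerical factor.\<close>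
    also have "exp (- (?y / 16)) \<le> exp (- L + - L + - 12)" using x L(1) by (subst exp_le_cancel_iff) linarith
    also have "\<dots> = (\<tau> / real d)\<^sup>2 * exp (- 12)" by (simp only: exp_add L(2) power2_eq_square)
    also have "exp (- 12) \<le> (1 / 8 :: real)"
      using exp_ge_add_one_self[of "12 :: real"] by (simp add: exp_minus field_simps)
    finally have "2 * real d * exp (- (?y / 2)) + 2 * (real d)\<^sup>2 * exp (- (?y / 16)) \<le> 4 * (real d)\<^sup>2 * ((\<tau> / real d)\<^sup>2 * (1 / 8))"
      by (simp add: mult_left_mono)
    also have "\<dots> = \<tau>\<^sup>2 / 2" using dk by (simp add: power_divide)
    also have "\<dots> \<le> \<tau> / 2" using \<tau> by (simp add: power2_eq_square mult_left_le)
    finally show ?thesis .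
  qed
  have 2: "real ((d * d * (4 * k + 1)) ^ (k * k)) * exp (- (real N * \<epsilon> / 16)) \<le> \<tau> / 2"
  proof -
    have five: "5 \<le> exp (2 * s)"
    proof -
      have "2 \<le> exp (1 :: real)" using exp_ge_add_one_self[of "1 :: real"] by simp
      moreover have "(5 :: real) \<le> exp 2" using exp_lower_Taylor_quadratic[of "2 :: real"] by simp
      then show ?thesis using s by (smt (verit) exp_le_cancel_iff)
    qed
    have "real (d * d * (4 * k + 1)) \<le> exp s * exp s * (exp (2 * s) * exp s)"
    proof -
      have "real (4 * k + 1) \<le> 5 * real k" using k by simp
      also have "\<dots> \<le> exp (2 * s) * exp s" using five big by (intro mult_mono) auto
      finally have "real (4 * k + 1) \<le> exp (2 * s) * exp s" .
      then have "real d * real d * real (4 * k + 1) \<le> exp s * exp s * (exp (2 * s) * exp s)"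
        using big by (intro mult_mono) auto
      then show ?thesis by (simp only: of_nat_mult)
    qed
    also have "\<dots> = exp (5 * s)" by (simp flip: exp_add)
    finally have "real (d * d * (4 * k + 1)) ^ (k * k) \<le> exp (5 * s) ^ (k * k)" by (intro power_mono) auto
    also have "\<dots> = exp (5 * s * (real k)\<^sup>2)" by (simp add: exp_of_nat_mult[symmetric] power2_eq_square mult_ac)
    finally have a: "real ((d * d * (4 * k + 1)) ^ (k * k)) \<le> exp (5 * s * (real k)\<^sup>2)" by simp
    \<comment> \<open>Of the 7, five cancel the cardinality of the net; the other two leave
      \<open>exp (- 2 * s)\<close>, one factor for \<open>\<tau>\<close> and one for 1/2.\<close>
    have "7 * s * (real k)\<^sup>2 \<le> real N * \<epsilon> / 16"
    proof -
      have "20000 \<le> 1 / \<epsilon>" using \<epsilon> by (simp add: field_simps)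
      then have "1 / 10 * 20000 \<le> L * (1 / \<epsilon>)" using L(1) by (intro mult_mono) auto
      then have "2000 * (s * (real k)\<^sup>2) * 2000 \<le> 2000 * (s * (real k)\<^sup>2) * (L * (1 / \<epsilon>))"
        using s by (intro mult_left_mono) auto
      also have "\<dots> = 2000 * s * ((real k)\<^sup>2 * L / \<epsilon>\<^sup>2) * \<epsilon>" using \<epsilon> by (simp add: power2_eq_square field_simps)
      also have "\<dots> \<le> real N * \<epsilon>" using N' \<epsilon> by (intro mult_right_mono) auto
      finally have "4000000 * (s * (real k)\<^sup>2) \<le> real N * \<epsilon>" by simp
      moreover have "0 \<le> s * (real k)\<^sup>2" using s by simp
      ultimately show ?thesis by linarith
    qed
    then have "exp (- (real N * \<epsilon> / 16)) \<le> exp (- (5 * s * (real k)\<^sup>2) - 2 * s)"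
    proof -
      assume "7 * s * (real k)\<^sup>2 \<le> real N * \<epsilon> / 16"
      moreover have "2 * s * 1 \<le> 2 * s * (real k)\<^sup>2" using s kk by (intro mult_left_mono) auto
      ultimately show ?thesis by (subst exp_le_cancel_iff) linarith
    qed
    then have "real ((d * d * (4 * k + 1)) ^ (k * k)) * exp (- (real N * \<epsilon> / 16)) \<le>
        exp (5 * s * (real k)\<^sup>2) * exp (- (5 * s * (real k)\<^sup>2) - 2 * s)"
      using a by (intro mult_mono) auto
    also have "\<dots> = exp (- s) * exp (- s)" by (simp flip: exp_add)
    also have "\<dots> \<le> \<tau> * (1 / 2)"
    proof (rule mult_mono)
      show "exp (- s) \<le> \<tau>" using big(3) \<tau> by (simp add: exp_minus field_simps)
      have "2 \<le> exp s" using s exp_ge_add_one_self[of s] by linarith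
      then show "exp (- s) \<le> 1 / 2" by (simp add: exp_minus field_simps)
    qed (use \<tau> in auto)
    finally show ?thesis by simp
  qed
  show ?thesis using 1 2 by linarith
qed

text \<open>As \<open>1 - \<tau> \<le> ln (1 / \<tau>)\<close>, the sample bound gives
  \<open>2000 * (1 - \<tau>) \<le> x\<^sup>2\<close> for \<open>x = \<epsilon> * sqrt N\<close>, and
  \<open>x\<^sup>2 \<le> x\<close> when \<open>x < 1\<close>. For \<open>x \<ge> 1\<close> the bound
  \<open>\<tau> \<ge> 9 / 10\<close> is enough.\<close>

lemma edge_sample_size:
  assumes k: "1 \<le> k" and \<epsilon>: "0 < \<epsilon>" and \<tau>: "9 / 10 \<le> \<tau>" "\<tau> < 1"
    and N: "sample_bound 2000 1 1 k \<epsilon> \<tau> \<le> real N"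
  shows "1 - \<tau> \<le> 1 / 5 * min 1 (\<epsilon> * sqrt (real N))"
proof (cases "1 \<le> \<epsilon> * sqrt (real N)")
  case False
  define s where "s = ln (3 + real k / (\<epsilon> * \<tau>))"
  have "0 \<le> real k / (\<epsilon> * \<tau>)" using \<epsilon> \<tau> by simp
  then have "exp 1 \<le> 3 + real k / (\<epsilon> * \<tau>)" using exp_le by linarith
  then have s: "1 \<le> s" unfolding s_def by (intro ln_ge_iff[THEN iffD2]) (auto intro: less_le_trans[OF exp_gt_zero])
  have L: "1 - \<tau> \<le> ln (1 / \<tau>)" using ln_le_minus_one[of \<tau>] \<tau> by (simp add: ln_div)
  have "2000 * (1 - \<tau>) = 2000 * 1 * (1 * (1 - \<tau>) / \<epsilon>\<^sup>2) * \<epsilon>\<^sup>2" using \<epsilon> by simp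
  also have "\<dots> \<le> 2000 * s * ((real k)\<^sup>2 * ln (1 / \<tau>) / \<epsilon>\<^sup>2) * \<epsilon>\<^sup>2"
    using s L \<tau> k by (intro mult_right_mono mult_mono divide_right_mono) auto
  also have "\<dots> \<le> real N * \<epsilon>\<^sup>2" using N by (intro mult_right_mono) (auto simp: sample_bound_def s_def)
  also have "\<dots> = (\<epsilon> * sqrt (real N)) * (\<epsilon> * sqrt (real N))" by (simp add: power2_eq_square)
  also have "\<dots> \<le> (\<epsilon> * sqrt (real N)) * 1" using False \<epsilon> by (intro mult_left_mono) auto
  finally show ?thesis using False \<tau> by (simp add: min_def)
next
  case True
  then show ?thesis using \<tau> by (simp add: min_def)
qed

text \<open>If \<open>d / \<tau> \<ge> 10 / 9\<close>, the typical event has probability at least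
  \<open>1 - \<tau>\<close>. Otherwise \<open>d = 1\<close> and \<open>\<tau>\<close> is close to 1,
  the sample may be tiny, and the event comes from anticoncentration of the mean. Both events
  concern the clean sample only, so an arbitrary adversary causes no measurability problem.\<close>

theorem theorem4p1:
  shows "\<exists>(P :: com) (C :: real) (K :: real) (c :: nat) (\<epsilon>\<^sub>0 :: real).
    0 < C \<and> 0 < K \<and> 0 < \<epsilon>\<^sub>0 \<and> \<epsilon>\<^sub>0 \<le> 1/2 \<and>
    polynomial_time P \<and>
    (\<forall>(d :: nat) (k :: nat) (\<mu> :: nat \<Rightarrow> real) (\<epsilon> :: real) (\<tau> :: real) (N :: nat) A.
       1 \<le> d \<and> 1 \<le> k \<and> \<mu> \<in> vectors d \<and> k_sparse d k \<mu> \<and>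
       0 < \<epsilon> \<and> \<epsilon> < \<epsilon>\<^sub>0 \<and> 0 < \<tau> \<and>
       sample_bound K c d k \<epsilon> \<tau> \<le> real N \<and> adversary d N \<epsilon> A \<longrightarrow>
       with_probability_at_least (gaussian_samples N d \<mu>) (1 - \<tau>)
         (\<lambda>X. \<exists>\<mu>'. returns P d (A (map X [0..<N])) k \<epsilon> \<tau> \<mu>' \<and>
                    l2_dist d \<mu>' \<mu> \<le> C * \<epsilon> * sqrt (ln (1 / \<epsilon>))))"
proof (rule exI[of _ program], rule exI[of _ 2000], rule exI[of _ 2000], rule exI[of _ 1],
    rule exI[of _ "1 / 20000"], intro conjI allI impI polynomial_time_program)
  fix d k N :: nat and \<mu> :: "nat \<Rightarrow> real" and \<epsilon> \<tau> :: real and A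
  assume H: "1 \<le> d \<and> 1 \<le> k \<and> \<mu> \<in> vectors d \<and> k_sparse d k \<mu> \<and>
       0 < \<epsilon> \<and> \<epsilon> < 1 / 20000 \<and> 0 < \<tau> \<and>
       sample_bound 2000 1 d k \<epsilon> \<tau> \<le> real N \<and> adversary d N \<epsilon> A"
  then have d: "1 \<le> d" and k: "1 \<le> k" and sparse: "k_sparse d k \<mu>" and \<epsilon>: "0 < \<epsilon>" "\<epsilon> \<le> 1 / 20000"
    and \<tau>: "0 < \<tau>" and N: "sample_bound 2000 1 d k \<epsilon> \<tau> \<le> real N" and A: "adversary d N \<epsilon> A" by auto
  let ?P = "\<lambda>X. \<exists>\<mu>'. returns program d (A (map X [0..<N])) k \<epsilon> \<tau> \<mu>' \<and> l2_dist d \<mu>' \<mu> \<le> 2000 * \<epsilon> * sqrt (ln (1 / \<epsilon>))"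
  show "with_probability_at_least (gaussian_samples N d \<mu>) (1 - \<tau>) ?P"
  proof (cases "1 \<le> \<tau>")
    case True
    \<comment> \<open>The required probability is at most 0, so the empty event serves.\<close>
    then show ?thesis unfolding with_probability_at_least_def by (intro bexI[of _ "{}"]) auto
  next
    case False
    then have \<tau>1: "\<tau> < 1" by simp
    have ln1: "1 \<le> ln (1 / \<epsilon>)"
    proof -
      have "3 \<le> 1 / \<epsilon>" using \<epsilon> by (simp add: field_simps)
      then have "exp 1 \<le> 1 / \<epsilon>" using exp_le by linarith
      then show ?thesis using \<epsilon>(1) by (simp add: ln_ge_iff)
    qed
    have N0: "0 < N"
    proof -
      \<comment> \<open>A strictly positive logarithm makes the sample bound positive, which forces
        at least one sample.\<close>
      have "1 < real d / \<tau>" using d \<tau> \<tau>1 by (simp add: field_simps)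
      moreover have "0 \<le> real d * real k / (\<epsilon> * \<tau>)" using \<epsilon> \<tau> by simp
      ultimately have "0 < sample_bound 2000 1 d k \<epsilon> \<tau>"
        unfolding sample_bound_def using k \<epsilon>(1) by (intro mult_pos_pos zero_less_power divide_pos_pos ln_gt_zero) auto
      then show ?thesis using N by linarith
    qed
    show ?thesis
    proof (cases "10 / 9 \<le> real d / \<tau>")
      case True
      have "with_probability_at_least (gaussian_samples N d \<mu>) (1 - \<tau>) (\<lambda>X. typical d N k \<epsilon> (\<lambda>i j. X i j - \<mu> j))"
        using \<epsilon> k by (intro typical_probability sample_size_suffices[OF d k \<epsilon> \<tau> \<tau>1 True N]) auto
      then show ?thesis
      proof (rule with_probability_mono[OF _ order.refl])
        fix X assume X: "X \<in> space (gaussian_samples N d \<mu>)" "typical d N k \<epsilon> (\<lambda>i j. X i j - \<mu> j)"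
        show "?P X"
        proof (cases "2 \<le> d")
          case True
          then show ?thesis by (rule filter_success[OF _ k sparse \<epsilon> N0 ln1 A X])
        next
          case False
          then have d1: "d = 1" using d by simp
          show ?thesis using typical_success_one[OF k \<epsilon> N0 ln1 A[unfolded d1] X[unfolded d1]] d1 by simp
        qed
      qed
    next
      case False
      have d1: "d = 1"
      proof (rule ccontr)
        assume "d \<noteq> 1"
        then have "2 \<le> real d" using d by simp
        then have "2 \<le> real d / \<tau>" using \<tau> \<tau>1 by (simp add: field_simps)
        then show False using False by simp
      qed
      then have "9 / 10 \<le> \<tau>" using False \<tau> by (simp add: field_simps)
      note size = edge_sample_size[OF k \<epsilon>(1) this \<tau>1 N[unfolded d1]]
      have "with_probability_at_least (gaussian_samples N d \<mu>) (1 / 5 * min 1 (\<epsilon> * sqrt (real N)))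
        (\<lambda>X. \<bar>\<Sum>i<N. X i 0 - \<mu> 0\<bar> \<le> real N * \<epsilon> \<and> (\<Sum>i<N. exp ((X i 0 - \<mu> 0)\<^sup>2 / 4)) \<le> real N / \<epsilon> ^ 3)"
        using N0 \<epsilon> d by (intro one_dim_probability) auto
      then show ?thesis
      proof (rule with_probability_mono[OF _ size])
        fix X assume X: "X \<in> space (gaussian_samples N d \<mu>)"
          and good: "\<bar>\<Sum>i<N. X i 0 - \<mu> 0\<bar> \<le> real N * \<epsilon> \<and> (\<Sum>i<N. exp ((X i 0 - \<mu> 0)\<^sup>2 / 4)) \<le> real N / \<epsilon> ^ 3"
        have "\<exists>\<mu>'. returns program 1 (A (map X [0..<N])) k \<epsilon> \<tau> \<mu>' \<and> l2_dist 1 \<mu>' \<mu> \<le> 2000 * \<epsilon> * sqrt (ln (1 / \<epsilon>))"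
        proof (rule trimmed_success[OF k \<epsilon> N0 ln1 A[unfolded d1] X[unfolded d1]])
          fix \<pi> c assume \<pi>: "bij_betw \<pi> {..<N} {..<N}" and c: "\<And>i. i < N \<Longrightarrow> 0 \<le> c i \<and> c i \<le> 1" "(\<Sum>i<N. c i) \<le> 5 * \<epsilon> * real N"
          have "(\<Sum>i<N. exp ((X (\<pi> i) 0 - \<mu> 0)\<^sup>2 / 4)) = (\<Sum>i<N. exp ((X i 0 - \<mu> 0)\<^sup>2 / 4))"
            by (rule sum.reindex_bij_betw[OF \<pi>])
          then have "(\<Sum>i<N. exp ((X (\<pi> i) 0 - \<mu> 0)\<^sup>2 / 4)) \<le> real N / \<epsilon> ^ 3" using good by simp
          from one_dim_tail[OF this \<epsilon>(1) ln1 c]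
          show "(\<Sum>i<N. c i * (X (\<pi> i) 0 - \<mu> 0)\<^sup>2) \<le> real N * (170 * \<epsilon> * ln (1 / \<epsilon>))" .
        qed (use good in simp)
        then show "?P X" by (simp add: d1)
      qed
    qed
  qed
qed auto

end
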